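(* If $\lambda\in\mathbb N^n$ is a skew-symmetric partition and $\mu:=\mathrm{half}_<(\lambda)$ then $$G\!P_\mu(x_1,x_2,\dots,x_n)=L^{\mathsf P}_{(\lambda_n,\dots,\lambda_2,\lambda_1)}.$$
   Context: Let $\mathbb N=\{0,1,2,\dots\}$, $\mathbb P=\{1,2,3,\dots\}$, and let $\beta$ be a formal parameter. $S_\infty$ is the group of permutations of $\mathbb P$ generated by $s_i=(i\;\,i+1)$; it acts on $\mathbb Z[\beta][x_1,x_2,\dots]$ by permuting the $x$-variables. Define $\partial_if=(f-s_if)/(x_i-x_{i+1})$ and $\pi^{(\beta)}_if=f+x_{i+1}(1+\beta x_i)\partial_if$. These satisfy the braid relations, so $\pi^{(\beta)}_w=\pi^{(\beta)}_{i_1}\cdots\pi^{(\beta)}_{i_l}$ is well-defined for any reduced word $i_1\cdots i_l$ of $w\in S_\infty$. Put $x\oplus y=x+y+\beta xy$ and $x\ominus y=\frac{x-y}{1+\beta y}$. A weak composition is a sequence $\alpha=(\alpha_1,\alpha_2,\dots)$ of nonnegative integers with finite sum; $x^\alpha=\prod_ix_i^{\alpha_i}$; $\mathbb N^n$ is identified with the weak compositions having $\alpha_i=0$ for $i>n$. A partition is a weakly decreasing weak composition; it is strict if its nonzero parts are distinct. $S_\infty$ acts by $w\alpha=(\alpha_{w^{-1}(1)},\alpha_{w^{-1}(2)},\dots)$. Let $\lambda(\alpha)$ be the partition sorting $\alpha$ and $u(\alpha)$ the minimal-length $u\in S_\infty$ with $\alpha=u\lambda(\alpha)$. Let $\mathsf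 D_\lambda=\{(i,j)\in\mathbb P\times\mathbb P:1\le j\le\lambda_i\}$. An addable (removable) corner of $\lambda$ is a cell that can be added to (removed from) $\mathsf D_\lambda$ so that the result is again the Young diagram of a partition. A partition $\lambda$ is skew-symmetric if it equals its transpose and, for every $i$: if $(i,i)$ is a removable corner then $(i,i+1)$ is not an addable corner, and if $(i,i)$ is an addable corner then $(i,i-1)$ is not a removable corner. A weak composition $\alpha$ is skew-symmetric if $\lambda(\alpha)$ is; for such $\alpha$ with $u=u(\alpha)$, $\lambda=\lambda(\alpha)$ put $L^{\mathsf P}_\alpha=\pi^{(\beta)}_u\big(\prod_{(i,j)\in\mathsf D_\lambda,\,i>j}(x_i\oplus x_j)\big)$. For a symmetric partition $\lambda$ (that is, $\lambda$ equal to its transpose), $\mathrm{half}_<(\lambda)$ is the strict partition with nonzero parts $\{\lambda_i-i:i\in\mathbb P\}\cap\mathbb P$. For a strict partition $\mu$ with $r$ nonzero parts, $G\!P_\mu\in\mathbb Z[\beta][[x_1,x_2,\dots]]$ is the unique power series with $$G\!P_\mu(x_1,\dots,x_n)=\frac1{(n-r)!}\sum_{w\in S_n}w\Big(x^\mu\prod_{i=1}^r\prod_{j=i+1}^n\frac{x_i\oplus x_j}{x_i\ominus x_j}\Big)\quad\text{for all }n\ge r,$$ where $f(x_1,\dots,x_n)$ means $f$ with $x_{n+1}=x_{n+2}=\cdots=0$ and $S_n$ permutes $x_1,\dots,x_n$. *)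

theory Defs
  imports
    Main
    "HOL-Library.Poly_Mapping"
    "HOL-Computational_Algebra.Polynomial"
    "HOL-Computational_Algebra.Fraction_Field"
    "HOL-Combinatorics.Transposition"
    "HOL-Combinatorics.Permutations"
begin

section \<open>The ring of polynomials and its fraction field\<close>

text \<open>
  Sequences are indexed by the positive integers, represented as the positive elements of
  type \<^typ>\<open>nat\<close>; permutations fix the index 0 and the variable with index 0 never plays a role.
  The coefficient ring of polynomials in \<open>\<beta>\<close> is \<^typ>\<open>int poly\<close>.
\<close>

type_synonym ring_x = "(nat \<Rightarrow>\<^sub>0 nat) \<Rightarrow>\<^sub>0 int poly"

definition X :: "nat \<Rightarrow> ring_x" where
  "X i = Poly_Mapping.single (Poly_Mapping.single i 1) 1"

definition beta :: ring_x where
  "beta = Poly_Mapping.single 0 [:0, 1:]"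

definition to_frac :: "ring_x \<Rightarrow> ring_x fract" where
  "to_frac p = Fraction_Field.Fract p 1"

definition oplus :: "'a::comm_ring_1 \<Rightarrow> 'a \<Rightarrow> 'a \<Rightarrow> 'a" where
  "oplus b x y = x + y + b * x * y"

definition ominus :: "'a::field \<Rightarrow> 'a \<Rightarrow> 'a \<Rightarrow> 'a" where
  "ominus b x y = (x - y) / (1 + b * y)"


section \<open>Permuting the variables\<close>

text \<open>
  For a bijection \<open>w\<close>, the coefficient of \<open>m\<close> in \<open>w f\<close> is the coefficient of \<open>m \<circ> w\<close> in \<open>f\<close>;
  this is the ring automorphism sending \<open>x\<^sub>i\<close> to \<open>x\<^sub>w\<^sub>(\<^sub>i\<^sub>)\<close>, see \<open>perm_poly_X\<close> and \<open>perm_poly_mult\<close>.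
\<close>

definition perm_poly :: "(nat \<Rightarrow> nat) \<Rightarrow> ring_x \<Rightarrow> ring_x" where
  "perm_poly w f = Poly_Mapping.map_key (Poly_Mapping.map_key w) f"

lemma lookup_map_key_bij:
  "bij w \<Longrightarrow> Poly_Mapping.lookup (Poly_Mapping.map_key w m) k = Poly_Mapping.lookup m (w k)"
  by (simp add: Poly_Mapping.map_key.rep_eq bij_is_inj)

lemma map_key_inv_cancel:
  assumes "bij w"
  shows "Poly_Mapping.map_key w (Poly_Mapping.map_key (inv w) m) = m"
    and "Poly_Mapping.map_key (inv w) (Poly_Mapping.map_key w m) = m"
proof -
  show "Poly_Mapping.map_key w (Poly_Mapping.map_key (inv w) m) = m"
    by (rule poly_mapping_eqI)
      (simp add: lookup_map_key_bij assms bij_imp_bij_inv inv_f_f[OF bij_is_inj[OF assms]])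
  show "Poly_Mapping.map_key (inv w) (Poly_Mapping.map_key w m) = m"
    by (rule poly_mapping_eqI)
      (simp add: lookup_map_key_bij assms bij_imp_bij_inv surj_f_inv_f[OF bij_is_surj[OF assms]])
qed

lemma inj_map_key:
  fixes w :: "nat \<Rightarrow> nat"
  shows "bij w \<Longrightarrow> inj (Poly_Mapping.map_key w :: (nat \<Rightarrow>\<^sub>0 nat) \<Rightarrow> _)"
  by (rule inj_on_inverseI) (rule map_key_inv_cancel(2))

lemma perm_poly_add:
  "bij w \<Longrightarrow> perm_poly w (f + g) = perm_poly w f + perm_poly w g"
  by (simp add: perm_poly_def map_key_plus inj_map_key)

lemma perm_poly_single:
  assumes "bij w"
  shows "perm_poly w (Poly_Mapping.single m c) =
    Poly_Mapping.single (Poly_Mapping.map_key (inv w) m) c"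
  using map_key_single[OF inj_map_key[OF assms], of "Poly_Mapping.map_key (inv w) m" c]
  by (simp add: perm_poly_def map_key_inv_cancel[OF assms])

lemma perm_poly_X:
  assumes "bij w"
  shows "perm_poly w (X i) = X (w i)"
proof -
  have "Poly_Mapping.map_key (inv w) (Poly_Mapping.single i (1::nat)) = Poly_Mapping.single (w i) 1"
    using map_key_single[OF bij_is_inj[OF bij_imp_bij_inv[OF assms]], of "w i" "1::nat"]
    by (simp only: inv_f_f[OF bij_is_inj[OF assms]])
  then show ?thesis
    by (simp add: X_def perm_poly_single assms)
qed

lemma perm_poly_mult:
  assumes "bij w"
  shows "perm_poly w (f * g) = perm_poly w f * perm_poly w g"
proof -
  have zero: "perm_poly w 0 = 0"
    by (simp add: perm_poly_def inj_map_key assms)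
  have sum: "perm_poly w (\<Sum>a\<in>A. F a) = (\<Sum>a\<in>A. perm_poly w (F a))"
    for A :: "(nat \<Rightarrow>\<^sub>0 nat) set" and F
    by (induction A rule: infinite_finite_induct) (simp_all add: zero perm_poly_add assms)
  have decomp: "h = (\<Sum>m\<in>Poly_Mapping.keys h. Poly_Mapping.single m (Poly_Mapping.lookup h m))"
    for h :: ring_x
    by (rule poly_mapping_eqI)
      (auto simp: lookup_sum lookup_single when_def in_keys_iff)
  have single: "perm_poly w (Poly_Mapping.single k a * Poly_Mapping.single l b) =
      perm_poly w (Poly_Mapping.single k a) * perm_poly w (Poly_Mapping.single l b)" for k l a b
    by (simp add: mult_single perm_poly_single assms map_key_plus bij_imp_bij_inv bij_is_inj)
  have "perm_poly w ((\<Sum>k\<in>A. Poly_Mapping.single k (F k)) * (\<Sum>l\<in>B. Poly_Mapping.single l (G l))) =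
      perm_poly w (\<Sum>k\<in>A. Poly_Mapping.single k (F k)) * perm_poly w (\<Sum>l\<in>B. Poly_Mapping.single l (G l))"
    for A B F G
    by (simp only: sum_product sum single)
  from this[of "Poly_Mapping.lookup f" "Poly_Mapping.keys f" "Poly_Mapping.lookup g" "Poly_Mapping.keys g"]
  show ?thesis
    by (simp only: decomp[symmetric])
qed

definition perm_fract :: "(nat \<Rightarrow> nat) \<Rightarrow> ring_x fract \<Rightarrow> ring_x fract" where
  "perm_fract w q = (THE r. \<exists>a b. b \<noteq> 0 \<and> q = Fraction_Field.Fract a b \<and>
     r = Fraction_Field.Fract (perm_poly w a) (perm_poly w b))"

lemma perm_fract_Fract:
  assumes w: "bij w" and b: "b \<noteq> 0"
  shows "perm_fract w (Fraction_Field.Fract a b) =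
    Fraction_Field.Fract (perm_poly w a) (perm_poly w b)"
proof -
  have zero: "perm_poly w p = 0 \<longleftrightarrow> p = 0" for p
  proof
    assume "perm_poly w p = 0"
    then have "Poly_Mapping.lookup p (Poly_Mapping.map_key w m) = 0" for m
      using Poly_Mapping.map_key.rep_eq[of "Poly_Mapping.map_key w" p] inj_map_key[OF w]
      by (simp add: perm_poly_def fun_eq_iff)
    then have "Poly_Mapping.lookup p m = 0" for m
      using map_key_inv_cancel(1)[OF w, of m] by metis
    then show "p = 0"
      by (intro poly_mapping_eqI) simp
  qed (simp add: perm_poly_def inj_map_key w)
  have eq: "Fraction_Field.Fract (perm_poly w c) (perm_poly w d) =
      Fraction_Field.Fract (perm_poly w a) (perm_poly w b)"
    if d: "d \<noteq> 0" and cd: "Fraction_Field.Fract a b = Fraction_Field.Fract c d" for c d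
  proof -
    have "a * d = c * b"
      using cd eq_fract(1)[OF b d] by blast
    then have "perm_poly w c * perm_poly w b = perm_poly w a * perm_poly w d"
      by (simp only: perm_poly_mult[OF w, symmetric])
    moreover have "perm_poly w b \<noteq> 0" "perm_poly w d \<noteq> 0"
      using b d zero by blast+
    ultimately show ?thesis
      using eq_fract(1) by blast
  qed
  show ?thesis
    unfolding perm_fract_def
  proof (rule the_equality)
    show "\<exists>c d. d \<noteq> 0 \<and> Fraction_Field.Fract a b = Fraction_Field.Fract c d \<and>
      Fraction_Field.Fract (perm_poly w a) (perm_poly w b) =
      Fraction_Field.Fract (perm_poly w c) (perm_poly w d)"
      using b by blast
  qed (use eq in blast)
qed


section \<open>The operators \<open>\<pi>\<close>\<close>

definition simple_refl :: "nat \<Rightarrow> nat \<Rightarrow> nat" where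
  "simple_refl i = transpose i (Suc i)"

definition divided_diff :: "nat \<Rightarrow> ring_x \<Rightarrow> ring_x" where
  "divided_diff i f = (THE g. (X i - X (Suc i)) * g = f - perm_poly (simple_refl i) f)"

definition pi_op :: "nat \<Rightarrow> ring_x \<Rightarrow> ring_x" where
  "pi_op i f = f + X (Suc i) * (1 + beta * X i) * divided_diff i f"

definition word_perm :: "nat list \<Rightarrow> nat \<Rightarrow> nat" where
  "word_perm is = foldr (\<circ>) (map simple_refl is) id"

definition pi_word :: "nat list \<Rightarrow> ring_x \<Rightarrow> ring_x" where
  "pi_word is = foldr (\<circ>) (map pi_op is) id"

text \<open>The generators are involutions, so the group they generate consists of the products of words.\<close>

definition S_inf :: "(nat \<Rightarrow> nat) set" where
  "S_inf = word_perm ` lists {1..}"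

definition perm_length :: "(nat \<Rightarrow> nat) \<Rightarrow> nat" where
  "perm_length w = (LEAST k. \<exists>is\<in>lists {1..}. word_perm is = w \<and> length is = k)"

definition reduced_word :: "nat list \<Rightarrow> (nat \<Rightarrow> nat) \<Rightarrow> bool" where
  "reduced_word is w \<longleftrightarrow> is \<in> lists {1..} \<and> word_perm is = w \<and> length is = perm_length w"

definition pi_perm :: "(nat \<Rightarrow> nat) \<Rightarrow> ring_x \<Rightarrow> ring_x" where
  "pi_perm w = pi_word (SOME is. reduced_word is w)"


section \<open>Weak compositions and partitions\<close>

definition weak_composition :: "(nat \<Rightarrow> nat) \<Rightarrow> bool" where
  "weak_composition \<alpha> \<longleftrightarrow> \<alpha> 0 = 0 \<and> finite {i. \<alpha> i \<noteq> 0}"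

definition compositions_upto :: "nat \<Rightarrow> (nat \<Rightarrow> nat) set" where
  "compositions_upto n = {\<alpha>. weak_composition \<alpha> \<and> (\<forall>i>n. \<alpha> i = 0)}"

definition is_partition :: "(nat \<Rightarrow> nat) \<Rightarrow> bool" where
  "is_partition \<mu> \<longleftrightarrow> weak_composition \<mu> \<and> (\<forall>i\<ge>1. \<forall>j\<ge>i. \<mu> j \<le> \<mu> i)"

definition num_parts :: "(nat \<Rightarrow> nat) \<Rightarrow> nat" where
  "num_parts \<mu> = card {i. \<mu> i \<noteq> 0}"

definition strict_partition :: "(nat \<Rightarrow> nat) \<Rightarrow> bool" where
  "strict_partition \<mu> \<longleftrightarrow> is_partition \<mu> \<and> inj_on \<mu> {i. \<mu> i \<noteq> 0}"

definition monomial :: "(nat \<Rightarrow> nat) \<Rightarrow> ring_x" where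
  "monomial \<alpha> = (\<Prod>i\<in>{i. \<alpha> i \<noteq> 0}. X i ^ \<alpha> i)"

definition perm_comp :: "(nat \<Rightarrow> nat) \<Rightarrow> (nat \<Rightarrow> nat) \<Rightarrow> (nat \<Rightarrow> nat)" where
  "perm_comp w \<alpha> = (\<lambda>i. \<alpha> (inv w i))"

definition sort_comp :: "(nat \<Rightarrow> nat) \<Rightarrow> (nat \<Rightarrow> nat)" where
  "sort_comp \<alpha> = (THE \<mu>. is_partition \<mu> \<and> (\<exists>w\<in>S_inf. \<alpha> = perm_comp w \<mu>))"

definition min_perm :: "(nat \<Rightarrow> nat) \<Rightarrow> (nat \<Rightarrow> nat)" where
  "min_perm \<alpha> = (ARG_MIN perm_length u. u \<in> S_inf \<and> \<alpha> = perm_comp u (sort_comp \<alpha>))"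

definition diagram :: "(nat \<Rightarrow> nat) \<Rightarrow> (nat \<times> nat) set" where
  "diagram \<mu> = {(i, j). 1 \<le> i \<and> 1 \<le> j \<and> j \<le> \<mu> i}"

definition addable :: "(nat \<Rightarrow> nat) \<Rightarrow> nat \<times> nat \<Rightarrow> bool" where
  "addable \<mu> c \<longleftrightarrow> c \<notin> diagram \<mu> \<and>
     (\<exists>\<nu>. is_partition \<nu> \<and> diagram \<nu> = insert c (diagram \<mu>))"

definition removable :: "(nat \<Rightarrow> nat) \<Rightarrow> nat \<times> nat \<Rightarrow> bool" where
  "removable \<mu> c \<longleftrightarrow> c \<in> diagram \<mu> \<and>
     (\<exists>\<nu>. is_partition \<nu> \<and> diagram \<nu> = diagram \<mu> - {c})"

definition transpose_partition :: "(nat \<Rightarrow> nat) \<Rightarrow> (nat \<Rightarrow> nat)" where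
  "transpose_partition \<mu> = (\<lambda>j. if j = 0 then 0 else card {i. 1 \<le> i \<and> j \<le> \<mu> i})"

definition symmetric_partition :: "(nat \<Rightarrow> nat) \<Rightarrow> bool" where
  "symmetric_partition \<mu> \<longleftrightarrow> is_partition \<mu> \<and> transpose_partition \<mu> = \<mu>"

text \<open>For \<open>i = 1\<close> the pair \<open>(i, i - 1)\<close> is not a cell, hence not a removable corner.\<close>

definition skew_symmetric_partition :: "(nat \<Rightarrow> nat) \<Rightarrow> bool" where
  "skew_symmetric_partition \<mu> \<longleftrightarrow> symmetric_partition \<mu> \<and>
     (\<forall>i\<ge>1. (removable \<mu> (i, i) \<longrightarrow> \<not> addable \<mu> (i, i + 1)) \<and>
            (addable \<mu> (i, i) \<longrightarrow> \<not> removable \<mu> (i, i - 1)))"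

text \<open>
  Subtraction on \<^typ>\<open>nat\<close> truncates, so the indices with \<open>\<mu> i \<le> i\<close> only contribute the value 0,
  which is removed by intersecting with the positive integers.
\<close>

definition half_less :: "(nat \<Rightarrow> nat) \<Rightarrow> (nat \<Rightarrow> nat)" where
  "half_less \<mu> = (THE \<nu>. strict_partition \<nu> \<and>
     {\<nu> i | i. \<nu> i \<noteq> 0} = {\<mu> i - i | i. 1 \<le> i} \<inter> {1..})"

definition reverse_comp :: "nat \<Rightarrow> (nat \<Rightarrow> nat) \<Rightarrow> (nat \<Rightarrow> nat)" where
  "reverse_comp n \<alpha> = (\<lambda>i. if 1 \<le> i \<and> i \<le> n then \<alpha> (n + 1 - i) else 0)"


section \<open>Shifted Lascoux polynomials and \<open>GP\<close>-functions\<close>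

definition LP :: "(nat \<Rightarrow> nat) \<Rightarrow> ring_x" where
  "LP \<alpha> = pi_perm (min_perm \<alpha>)
     (\<Prod>(i, j)\<in>{(i, j)\<in>diagram (sort_comp \<alpha>). i > j}. oplus beta (X i) (X j))"

text \<open>
  Power series are represented by their coefficient functions.
  The function \<^term>\<open>Poly_Mapping.lookup\<close> includes polynomials into power series.
\<close>

type_synonym series_x = "(nat \<Rightarrow>\<^sub>0 nat) \<Rightarrow> int poly"

definition restrict_vars :: "nat \<Rightarrow> series_x \<Rightarrow> series_x" where
  "restrict_vars n f = (\<lambda>m. if Poly_Mapping.keys m \<subseteq> {1..n} then f m else 0)"

definition GP_rational :: "(nat \<Rightarrow> nat) \<Rightarrow> nat \<Rightarrow> ring_x fract" where
  "GP_rational \<mu> n = 1 / of_nat (fact (n - num_parts \<mu>)) *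
     (\<Sum>w | w permutes {1..n}. perm_fract w (to_frac (monomial \<mu>) *
       (\<Prod>i\<in>{1..num_parts \<mu>}. \<Prod>j\<in>{i+1..n}.
          oplus (to_frac beta) (to_frac (X i)) (to_frac (X j)) /
          ominus (to_frac beta) (to_frac (X i)) (to_frac (X j)))))"

text \<open>
  The rational functions above are polynomials, since \<open>1 / ominus x y = (1 + \<beta> y) / (x - y)\<close> and
  the poles along \<open>x\<^sub>i = x\<^sub>j\<close> cancel in the symmetrization. So the equality of a power series with
  such a function is expressed through a polynomial equal to both of them.
  The first conjunct says that the variable with index 0 does not occur.
\<close>

definition GP :: "(nat \<Rightarrow> nat) \<Rightarrow> series_x" where
  "GP \<mu> = (THE f. (\<forall>m. 0 \<in> Poly_Mapping.keys m \<longrightarrow> f m = 0) \<and>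
     (\<forall>n\<ge>num_parts \<mu>. \<exists>p. restrict_vars n f = Poly_Mapping.lookup p \<and>
        to_frac p = GP_rational \<mu> n))"

end

theory Submission
  imports Defs "HOL-Combinatorics.Multiset_Permutations" Complex_Main
begin

text \<open>
  Write \<open>x \<oplus> y = x + y + \<beta> x y\<close> and \<open>q(x) = x / (1 + \<beta> x)\<close>. At a point with \<open>x\<^sub>i \<noteq> x\<^sub>i\<^sub>+\<^sub>1\<close> the
  operator \<open>\<pi>\<^sub>i\<close> has the value \<open>c(x\<^sub>i, x\<^sub>i\<^sub>+\<^sub>1) f + c(x\<^sub>i\<^sub>+\<^sub>1, x\<^sub>i) s\<^sub>i f\<close>, where
  \<open>c(x, y) = x (1 + \<beta> y) / (x - y) = q(x) / (q(x) - q(y))\<close>; in the variables \<open>q(x\<^sub>i)\<close> it is the usual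
  isobaric divided difference. Polynomials are determined by their values at points with \<open>\<beta> > 0\<close> and
  distinct positive coordinates (\<open>eval_eqI\<close>), and at such a point \<open>GP\<^sub>\<mu>\<close> is a function
  \<open>gp_value\<close> of the finite set \<open>A\<close> of coordinates: selecting the coordinate \<open>x\<close> that takes the first
  place in the symmetrization gives the recursion
  \<open>GP\<^sub>\<mu>(A) = \<Sum>\<^sub>x x^(\<mu>\<^sub>1) \<Prod>\<^sub>y (x \<oplus> y) (1 + \<beta> y) / (x - y) GP\<^sub>\<mu>\<^sub>'(A - {x})\<close>, where \<open>\<mu>'\<close> omits \<open>\<mu>\<^sub>1\<close>.

  The key fact is a stability property (\<open>gp_value_stable\<close>): if \<open>|A| > \<mu>\<^sub>1\<close>, then
  \<open>\<Sum>\<^sub>x GP\<^sub>\<mu>(A - {x}) \<Prod>\<^sub>z c(z, x) = GP\<^sub>\<mu>(A)\<close>. So \<open>\<pi>\<^sub>1 \<cdots> \<pi>\<^sub>m\<close> turns \<open>GP\<^sub>\<mu>(x\<^sub>1, \<dots>, x\<^sub>m)\<close> into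
  \<open>GP\<^sub>\<mu>(x\<^sub>1, \<dots>, x\<^sub>m\<^sub>+\<^sub>1)\<close> as soon as \<open>m \<ge> \<mu>\<^sub>1\<close>. To see this, consider \<open>GP\<^sub>\<mu>(A \<union> {y})\<close> as a function of \<open>y\<close>.
  It is a polynomial of degree at most \<open>\<mu>\<^sub>1\<close>, because the residues at the simple poles \<open>y \<in> A\<close> cancel
  (\<open>gp_value_polynomial\<close>). Its value at \<open>y = - q(x)\<close>, which solves \<open>x \<oplus> y = 0\<close>, is \<open>GP\<^sub>\<mu>(A - {x})\<close>:
  this is the K-theoretic Q-cancellation property (\<open>gp_value_cancel\<close>). Its value at \<open>y = 0\<close> is
  \<open>GP\<^sub>\<mu>(A)\<close>. The identity is Lagrange interpolation at \<open>0\<close> from the nodes \<open>- q(x)\<close>.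

  On the other side, a reduced word of the minimal permutation sorting \<open>(\<lambda>\<^sub>n, \<dots>, \<lambda>\<^sub>1)\<close> describes a chain
  of compositions from \<open>\<lambda>\<close> to \<open>(\<lambda>\<^sub>n, \<dots>, \<lambda>\<^sub>1)\<close> in which every step exchanges adjacent entries
  \<open>\<alpha>\<^sub>i > \<alpha>\<^sub>i\<^sub>+\<^sub>1\<close>. By the braid relations the polynomial obtained does not depend on the chain
  (\<open>lascoux_path_unique\<close>), and exchanging equal entries does not change it (\<open>lascoux_path_fixed\<close>).
  So a convenient chain may be chosen. Group the factors \<open>x\<^sub>i \<oplus> x\<^sub>j\<close> of the initial product into rows: row
  \<open>i\<close> contains \<open>j = i + 1, \<dots>, \<lambda>\<^sub>i\<close>. Process the rows from the last to the first, with this invariant: when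
  the entries at places \<open>k, \<dots>, m\<close> have been reversed, the polynomial is the product of the rows
  before \<open>k\<close> and \<open>GP\<close> of the parts \<open>\<lambda>\<^sub>k - k, \<lambda>\<^sub>k\<^sub>+\<^sub>1 - (k + 1), \<dots>\<close> in \<open>x\<^sub>k, \<dots>, x\<^sub>m\<close>. Carrying the entry
  \<open>\<lambda>\<^sub>k\<close> to the far end of the segment \<open>k, \<dots>, \<lambda>\<^sub>k\<close> uses up row \<open>k\<close> and is exactly one step of the recursion
  for \<open>GP\<close>, because the segment has \<open>(\<lambda>\<^sub>k - k) + 1\<close> places (\<open>stage_add_row\<close>). Lengthening the segment by
  one place is the stability property (\<open>stage_extend\<close>). At the end the segment is \<open>1, \<dots>, n\<close>.

  Finally, the polynomials so obtained, for all large \<open>n\<close>, and their restrictions to fewer variables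
  are the polynomials required in the definition of the power series \<open>GP\<^sub>\<mu>\<close> (\<open>restrict_GP\<close>).
\<close>

section \<open>Evaluating polynomials at real points\<close>

definition eval_coeff :: "real \<Rightarrow> int poly \<Rightarrow> real" where
  "eval_coeff b c = poly (map_poly real_of_int c) b"

lemma eval_coeff_pCons [simp]: "eval_coeff b (pCons a p) = of_int a + b * eval_coeff b p"
  by (simp add: eval_coeff_def map_poly_pCons)

lemma eval_coeff_0 [simp]: "eval_coeff b 0 = 0"
  by (simp add: eval_coeff_def)

lemma eval_coeff_1 [simp]: "eval_coeff b 1 = 1"
  by (simp add: one_pCons)

lemma eval_coeff_add [simp]: "eval_coeff b (p + q) = eval_coeff b p + eval_coeff b q"
  by (induction p q rule: poly_induct2) (simp_all add: algebra_simps)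

lemma eval_coeff_smult [simp]: "eval_coeff b (smult a p) = of_int a * eval_coeff b p"
  by (induction p) (simp_all add: algebra_simps)

lemma eval_coeff_mult [simp]: "eval_coeff b (p * q) = eval_coeff b p * eval_coeff b q"
  by (induction p) (simp_all add: algebra_simps)

lemma eval_coeff_eq_0:
  assumes "\<And>b. b > 0 \<Longrightarrow> eval_coeff b c = 0"
  shows "c = 0"
proof -
  have "infinite {x. poly (map_poly real_of_int c) x = 0}"
  proof
    assume "finite {x. poly (map_poly real_of_int c) x = 0}"
    moreover have "{0<..} \<subseteq> {x. poly (map_poly real_of_int c) x = 0}"
      using assms by (auto simp: eval_coeff_def)
    ultimately show False
      using infinite_Ioi[of "0::real"] finite_subset by blast
  qed
  then have "map_poly real_of_int c = 0"
    using poly_roots_finite by blast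
  then have "of_int (coeff c k) = (0::real)" for k
    by (metis coeff_0 coeff_map_poly of_int_0)
  then show ?thesis
    by (intro poly_eqI) simp
qed

definition eval_mon :: "(nat \<Rightarrow> real) \<Rightarrow> (nat \<Rightarrow>\<^sub>0 nat) \<Rightarrow> real" where
  "eval_mon v m = (\<Prod>i\<in>Poly_Mapping.keys m. v i ^ Poly_Mapping.lookup m i)"

definition evaluate :: "real \<Rightarrow> (nat \<Rightarrow> real) \<Rightarrow> ring_x \<Rightarrow> real" where
  "evaluate b v f = (\<Sum>m\<in>Poly_Mapping.keys f. eval_coeff b (Poly_Mapping.lookup f m) * eval_mon v m)"

lemma eval_mon_superset:
  assumes "finite I" "Poly_Mapping.keys m \<subseteq> I"
  shows "eval_mon v m = (\<Prod>i\<in>I. v i ^ Poly_Mapping.lookup m i)"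
  unfolding eval_mon_def using assms
  by (intro prod.mono_neutral_left) (auto simp: in_keys_iff)

lemma eval_superset:
  assumes "finite A" "Poly_Mapping.keys f \<subseteq> A"
  shows "evaluate b v f = (\<Sum>m\<in>A. eval_coeff b (Poly_Mapping.lookup f m) * eval_mon v m)"
  unfolding evaluate_def using assms
  by (intro sum.mono_neutral_left) (auto simp: in_keys_iff)

lemma eval_mon_add: "eval_mon v (m + m') = eval_mon v m * eval_mon v m'"
proof -
  let ?I = "Poly_Mapping.keys m \<union> Poly_Mapping.keys m'"
  have "eval_mon v (m + m') = (\<Prod>i\<in>?I. v i ^ Poly_Mapping.lookup (m + m') i)"
    by (intro eval_mon_superset) (simp_all add: Poly_Mapping.keys_add)
  also have "\<dots> = (\<Prod>i\<in>?I. v i ^ Poly_Mapping.lookup m i) * (\<Prod>i\<in>?I. v i ^ Poly_Mapping.lookup m' i)"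
    by (simp add: lookup_add power_add prod.distrib)
  also have "\<dots> = eval_mon v m * eval_mon v m'"
    by (simp add: eval_mon_superset[symmetric])
  finally show ?thesis .
qed

lemma eval_0 [simp]: "evaluate b v 0 = 0"
  by (simp add: evaluate_def)

lemma eval_single: "evaluate b v (Poly_Mapping.single m c) = eval_coeff b c * eval_mon v m"
  by (simp add: eval_superset[of "{m}"])

lemma eval_add [simp]: "evaluate b v (f + g) = evaluate b v f + evaluate b v g"
proof -
  let ?I = "Poly_Mapping.keys f \<union> Poly_Mapping.keys g"
  have "evaluate b v (f + g) = (\<Sum>m\<in>?I. eval_coeff b (Poly_Mapping.lookup (f + g) m) * eval_mon v m)"
    by (intro eval_superset) (simp_all add: Poly_Mapping.keys_add)
  also have "\<dots> = evaluate b v f + evaluate b v g"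
    by (simp add: lookup_add distrib_right sum.distrib eval_superset[symmetric])
  finally show ?thesis .
qed

lemma eval_sum [simp]: "evaluate b v (sum f A) = (\<Sum>a\<in>A. evaluate b v (f a))"
  by (induction A rule: infinite_finite_induct) simp_all

lemma ring_x_decomp:
  "f = (\<Sum>m\<in>Poly_Mapping.keys f. Poly_Mapping.single m (Poly_Mapping.lookup f m))" for f :: ring_x
  by (rule poly_mapping_eqI) (auto simp: lookup_sum lookup_single when_def in_keys_iff)

lemma eval_mult [simp]: "evaluate b v (f * g) = evaluate b v f * evaluate b v g"
proof -
  have single: "evaluate b v (Poly_Mapping.single m c * Poly_Mapping.single m' c') =
      evaluate b v (Poly_Mapping.single m c) * evaluate b v (Poly_Mapping.single m' c')" for m c m' c'
    by (simp add: mult_single eval_single eval_mon_add)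
  have "evaluate b v ((\<Sum>m\<in>A. Poly_Mapping.single m (F m)) * (\<Sum>m\<in>B. Poly_Mapping.single m (G m))) =
      evaluate b v (\<Sum>m\<in>A. Poly_Mapping.single m (F m)) * evaluate b v (\<Sum>m\<in>B. Poly_Mapping.single m (G m))"
    for A B F G
    by (simp only: sum_product eval_sum single)
  from this[of "Poly_Mapping.lookup f" "Poly_Mapping.keys f" "Poly_Mapping.lookup g" "Poly_Mapping.keys g"]
  show ?thesis
    by (simp only: ring_x_decomp[symmetric])
qed

lemma eval_1 [simp]: "evaluate b v 1 = 1"
  using eval_single[of b v 0 1] by (simp add: eval_mon_def)

lemma eval_uminus [simp]: "evaluate b v (- f) = - evaluate b v f"
proof -
  have "evaluate b v (f + - f) = evaluate b v f + evaluate b v (- f)"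
    by (rule eval_add)
  then show ?thesis by simp
qed

lemma eval_diff [simp]: "evaluate b v (f - g) = evaluate b v f - evaluate b v g"
  using eval_add[of b v f "- g"] by simp

lemma eval_prod [simp]: "evaluate b v (prod f A) = (\<Prod>a\<in>A. evaluate b v (f a))"
  by (induction A rule: infinite_finite_induct) simp_all

lemma eval_power [simp]: "evaluate b v (f ^ k) = evaluate b v f ^ k"
  by (induction k) simp_all

lemma eval_of_nat [simp]: "evaluate b v (of_nat k) = of_nat k"
  by (induction k) simp_all

lemma eval_X [simp]: "evaluate b v (X i) = v i"
  by (simp add: X_def eval_single eval_mon_def)

lemma eval_beta [simp]: "evaluate b v beta = b"
  by (simp add: beta_def eval_single eval_mon_def)

lemma eval_oplus [simp]: "evaluate b v (oplus f g h) = oplus (evaluate b v f) (evaluate b v g) (evaluate b v h)"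
  by (simp add: oplus_def)

lemma eval_perm_poly:
  assumes "bij w"
  shows "evaluate b v (perm_poly w f) = evaluate b (v \<circ> w) f"
proof -
  have mon: "eval_mon v (Poly_Mapping.map_key (inv w) m) = eval_mon (v \<circ> w) m" for m
  proof -
    have "Poly_Mapping.keys (Poly_Mapping.map_key (inv w) m) = w ` Poly_Mapping.keys m"
      using assms by (auto simp: keys_map_key bij_imp_bij_inv bij_is_inj bij_vimage_eq_inv_image inv_inv_eq)
    then show ?thesis
      using assms
      by (simp add: eval_mon_def prod.reindex bij_is_inj[THEN inj_on_subset] lookup_map_key_bij
          bij_imp_bij_inv bij_is_inj)
  qed
  have "perm_poly w (\<Sum>m\<in>A. F m) = (\<Sum>m\<in>A. perm_poly w (F m))" for A :: "(nat \<Rightarrow>\<^sub>0 nat) set" and F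
    by (induction A rule: infinite_finite_induct)
      (simp_all add: perm_poly_add assms, simp_all add: perm_poly_def inj_map_key assms)
  then have "evaluate b v (perm_poly w (\<Sum>m\<in>A. Poly_Mapping.single m (F m))) =
      evaluate b (v \<circ> w) (\<Sum>m\<in>A. Poly_Mapping.single m (F m))" for A F
    by (simp add: perm_poly_single assms eval_single mon)
  from this[of "Poly_Mapping.lookup f" "Poly_Mapping.keys f"] show ?thesis
    by (simp only: ring_x_decomp[symmetric])
qed

text \<open>
  Induction on the set of variables: for fixed values of the other variables, the sum is a polynomial in
  the new variable with infinitely many roots, so each of its coefficients vanishes.
\<close>

lemma eval_mon_sum_eq_0:
  assumes "finite I" "finite A" "\<And>m. m \<in> A \<Longrightarrow> Poly_Mapping.keys m \<subseteq> I"
    and "\<And>v. inj_on v I \<Longrightarrow> (\<And>i. i \<in> I \<Longrightarrow> 0 < v i) \<Longrightarrow> (\<Sum>m\<in>A. c m * eval_mon v m) = 0"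
    and "m \<in> A"
  shows "c m = 0"
  using assms
proof (induction I arbitrary: A c m rule: finite_induct)
  case empty
  then have "A = {m}" "m = 0"
    by auto
  then show ?case
    using empty.prems(3)[of "\<lambda>_. 1"] by (simp add: eval_mon_def)
next
  case (insert i I)
  define d where "d = Poly_Mapping.lookup m i"
  define A' where "A' = (\<lambda>m. m - Poly_Mapping.single i (Poly_Mapping.lookup m i)) ` {m\<in>A. Poly_Mapping.lookup m i = d}"
  define c' where "c' = (\<lambda>m. c (m + Poly_Mapping.single i d))"
  have split: "m = (m - Poly_Mapping.single i (Poly_Mapping.lookup m i)) + Poly_Mapping.single i (Poly_Mapping.lookup m i)"
    for m :: "nat \<Rightarrow>\<^sub>0 nat"
    by (rule poly_mapping_eqI) (auto simp: lookup_add lookup_minus lookup_single when_def)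
  have keys: "Poly_Mapping.keys (m - Poly_Mapping.single i (Poly_Mapping.lookup m i)) \<subseteq> I" if "m \<in> A" for m
    using insert.prems(2)[OF that]
    by (auto simp: subset_eq in_keys_iff lookup_minus lookup_single when_def split: if_splits)
  have "c' (m - Poly_Mapping.single i d) = 0"
  proof (rule insert.IH[where A = A'])
    show "finite A'"
      using insert.prems by (auto simp: A'_def)
    show "Poly_Mapping.keys m' \<subseteq> I" if "m' \<in> A'" for m'
      using that keys by (auto simp: A'_def)
    show "m - Poly_Mapping.single i d \<in> A'"
      using insert.prems(4) by (auto simp: A'_def d_def)
    fix v :: "nat \<Rightarrow> real" assume v: "inj_on v I" "\<And>i. i \<in> I \<Longrightarrow> 0 < v i"
    define e where "e = (\<lambda>m. eval_mon v (m - Poly_Mapping.single i (Poly_Mapping.lookup m i)))"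
    define p where "p = (\<Sum>m\<in>A. Polynomial.monom (c m * e m) (Poly_Mapping.lookup m i))"
    have "poly p t = 0" if t: "t > 0" "t \<notin> v ` I" for t
    proof -
      let ?v = "v(i := t)"
      have "inj_on ?v (insert i I)"
        using v t insert.hyps by (auto simp: inj_on_def)
      moreover have "0 < ?v k" if "k \<in> insert i I" for k
        using that v t by auto
      ultimately have "(\<Sum>m\<in>A. c m * eval_mon ?v m) = 0"
        by (rule insert.prems(3))
      moreover have "eval_mon ?v m = e m * t ^ Poly_Mapping.lookup m i" if "m \<in> A" for m
      proof -
        have "eval_mon ?v m = eval_mon ?v (m - Poly_Mapping.single i (Poly_Mapping.lookup m i)) *
            eval_mon ?v (Poly_Mapping.single i (Poly_Mapping.lookup m i))"
          by (subst split) (rule eval_mon_add)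
        also have "eval_mon ?v (m - Poly_Mapping.single i (Poly_Mapping.lookup m i)) = e m"
          unfolding e_def eval_mon_def using keys[OF that] insert.hyps
          by (intro prod.cong) auto
        also have "eval_mon ?v (Poly_Mapping.single i (Poly_Mapping.lookup m i)) = t ^ Poly_Mapping.lookup m i"
          by (simp add: eval_mon_def)
        finally show ?thesis .
      qed
      ultimately show ?thesis
        by (simp add: p_def poly_sum poly_monom mult.assoc)
    qed
    then have "{0<..} - v ` I \<subseteq> {t. poly p t = 0}"
      by auto
    moreover have "infinite ({0<..} - v ` I)"
      using insert by (intro Diff_infinite_finite) (simp_all add: infinite_Ioi)
    ultimately have "p = 0"
      using poly_roots_finite[of p] finite_subset by blast
    then have "0 = coeff p d" by simp
    also have "\<dots> = (\<Sum>m\<in>A. if Poly_Mapping.lookup m i = d then c m * e m else 0)"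
      by (simp add: p_def coeff_sum)
    also have "\<dots> = (\<Sum>m | m \<in> A \<and> Poly_Mapping.lookup m i = d. c m * e m)"
      using insert.prems(1) by (simp add: sum.inter_filter)
    also have "\<dots> = (\<Sum>m'\<in>A'. c' m' * eval_mon v m')"
    proof -
      have shift: "m = (m - Poly_Mapping.single i d) + Poly_Mapping.single i d" if "Poly_Mapping.lookup m i = d" for m
        using split[of m] that by simp
      then have "inj_on (\<lambda>m. m - Poly_Mapping.single i d) {m\<in>A. Poly_Mapping.lookup m i = d}"
        by (intro inj_onI) (metis (mono_tags, lifting) mem_Collect_eq)
      moreover have "c' (m - Poly_Mapping.single i d) = c m" if "Poly_Mapping.lookup m i = d" for m
        using shift[OF that] by (simp add: c'_def)
      moreover have "A' = (\<lambda>m. m - Poly_Mapping.single i d) ` {m\<in>A. Poly_Mapping.lookup m i = d}"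
        by (auto simp: A'_def)
      ultimately show ?thesis
        by (simp add: sum.reindex e_def)
    qed
    finally show "(\<Sum>m'\<in>A'. c' m' * eval_mon v m') = 0" by simp
  qed
  then show ?case
    using split[of m] by (simp add: c'_def d_def)
qed

lemma eval_eq_0_imp:
  assumes "\<And>b v. 0 < b \<Longrightarrow> inj v \<Longrightarrow> (\<And>i. 0 < v i) \<Longrightarrow> evaluate b v f = 0"
  shows "f = 0"
proof -
  define I where "I = (\<Union>m\<in>Poly_Mapping.keys f. Poly_Mapping.keys m)"
  have "Poly_Mapping.lookup f m = 0" if m: "m \<in> Poly_Mapping.keys f" for m
  proof (rule eval_coeff_eq_0)
    fix b :: real assume b: "b > 0"
    show "eval_coeff b (Poly_Mapping.lookup f m) = 0"
    proof (rule eval_mon_sum_eq_0[where I = I and A = "Poly_Mapping.keys f"])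
      fix v :: "nat \<Rightarrow> real" assume v: "inj_on v I" "\<And>i. i \<in> I \<Longrightarrow> 0 < v i"
      define M where "M = (\<Sum>i\<in>I. v i)"
      \<comment> \<open>Only the variables of \<open>f\<close> matter; the others get values beyond all of these to make \<open>v\<close> injective.\<close>
      define v' where "v' = (\<lambda>i. if i \<in> I then v i else M + 1 + real i)"
      have fin: "finite I" by (simp add: I_def)
      have le: "v i \<le> M" if "i \<in> I" for i
        unfolding M_def using v(2) by (intro member_le_sum) (auto simp: that fin intro: less_imp_le)
      have M: "M \<ge> 0"
        unfolding M_def using v(2) by (intro sum_nonneg) (auto intro: less_imp_le)
      have "inj v'"
      proof (rule injI)
        fix i j assume "v' i = v' j"
        then show "i = j"
          using le[of i] le[of j] v(1) by (auto simp: v'_def inj_on_def split: if_splits)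
      qed
      moreover have "0 < v' i" for i
        using v(2) M by (auto simp: v'_def)
      ultimately have "evaluate b v' f = 0"
        using assms b by blast
      moreover have "eval_mon v' m = eval_mon v m" if "m \<in> Poly_Mapping.keys f" for m
        unfolding eval_mon_def using that by (intro prod.cong) (auto simp: v'_def I_def)
      ultimately show "(\<Sum>m\<in>Poly_Mapping.keys f. eval_coeff b (Poly_Mapping.lookup f m) * eval_mon v m) = 0"
        by (simp add: evaluate_def)
    qed (use m in \<open>auto simp: I_def\<close>)
  qed
  then show ?thesis
    by (metis in_keys_iff lookup_zero poly_mapping_eqI)
qed

text \<open>
  All identities of polynomials below are checked by means of this test. Positivity of \<open>\<beta>\<close> and of the
  coordinates ensures that the factors \<open>1 + \<beta> x\<^sub>i\<close> are nonzero, and injectivity ensures that the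
  differences \<open>x\<^sub>i - x\<^sub>j\<close> are.
\<close>

lemma eval_eqI:
  assumes "\<And>b v. 0 < b \<Longrightarrow> inj v \<Longrightarrow> (\<And>i. 0 < v i) \<Longrightarrow> evaluate b v f = evaluate b v g"
  shows "f = g"
  using eval_eq_0_imp[of "f - g"] assms by simp

section \<open>The values of GP on finite sets\<close>

text \<open>
  This is \<open>(x \<oplus> y) / (x \<ominus> y)\<close>.
\<close>

definition gp_ratio :: "real \<Rightarrow> real \<Rightarrow> real \<Rightarrow> real" where
  "gp_ratio b x y = oplus b x y * (1 + b * y) / (x - y)"

text \<open>
  This is \<open>x / (x \<ominus> y) = q(x) / (q(x) - q(y))\<close>, the coefficient with which \<open>\<pi>\<^sub>i\<close> acts.
\<close>

definition pi_weight :: "real \<Rightarrow> real \<Rightarrow> real \<Rightarrow> real" where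
  "pi_weight b x y = x * (1 + b * y) / (x - y)"

text \<open>
  The symmetrization formula for \<open>GP\<close>, summed over the choices of the variables in the places of the
  nonzero parts. It only depends on the set of values of the variables, which makes the
  symmetry evident and allows inductions that remove or insert a variable.
\<close>

fun gp_value :: "real \<Rightarrow> nat list \<Rightarrow> real set \<Rightarrow> real" where
  "gp_value b [] A = 1"
| "gp_value b (a # ms) A =
    (\<Sum>x\<in>A. x ^ a * (\<Prod>y\<in>A - {x}. gp_ratio b x y) * gp_value b ms (A - {x}))"

lemma gp_value_drop_zero:
  assumes "finite A" "0 \<in> A" "0 \<notin> set ms"
  shows "gp_value b ms A = gp_value b ms (A - {0})"
  using assms
proof (induction ms arbitrary: A)
  case (Cons a ms)
  have "x ^ a * (\<Prod>y\<in>A - {x}. gp_ratio b x y) * gp_value b ms (A - {x}) =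
      x ^ a * (\<Prod>y\<in>A - {0} - {x}. gp_ratio b x y) * gp_value b ms (A - {0} - {x})"
    if "x \<in> A - {0}" for x
  proof -
    have "(\<Prod>y\<in>A - {x}. gp_ratio b x y) = gp_ratio b x 0 * (\<Prod>y\<in>A - {x} - {0}. gp_ratio b x y)"
      using Cons.prems that by (intro prod.remove) auto
    moreover have "gp_ratio b x 0 = 1"
      using that by (simp add: gp_ratio_def oplus_def)
    moreover have "gp_value b ms (A - {x}) = gp_value b ms (A - {x} - {0})"
      using Cons that by auto
    moreover have "A - {x} - {0} = A - {0} - {x}"
      by auto
    ultimately show ?thesis
      by simp
  qed
  then show ?case
    using Cons.prems by (simp only: gp_value.simps sum.remove[of A 0] cong: sum.cong) simp
qed simp

text \<open>
  If \<open>x \<oplus> y = 0\<close>, then a choice that gives \<open>x\<close> or \<open>y\<close> one of the places of the nonzero parts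
  contributes a factor \<open>x \<oplus> y\<close>. For the other choices, \<open>x\<close> and \<open>y\<close> contribute
  reciprocal factors.
\<close>

lemma gp_value_cancel:
  assumes "finite A" "x \<in> A" "0 < x" "\<And>z. z \<in> A \<Longrightarrow> 0 \<le> z" "0 < b"
  shows "gp_value b ms (insert (- x / (1 + b * x)) A) = gp_value b ms (A - {x})"
  using assms(1,2,4)
proof (induction ms arbitrary: A)
  case (Cons a ms)
  define y where "y = - x / (1 + b * x)"
  have pos: "1 + b * z > 0" if "z \<ge> 0" for z
    using assms(5) that by (simp add: add_pos_nonneg)
  have y_neg: "y < 0"
    using assms(3) pos[of x] by (simp add: y_def divide_neg_pos)
  then have y: "y \<notin> A"
    using Cons.prems(3) by fastforce
  have yx: "y * (1 + b * x) = - x"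
    using pos[of x] assms(3) by (simp add: y_def)
  have "oplus b x y = 0" "oplus b y x = 0"
    using yx by (auto simp: oplus_def algebra_simps)
  then have zero: "gp_ratio b x y = 0" "gp_ratio b y x = 0"
    by (simp_all add: gp_ratio_def)
  have inv: "gp_ratio b z x * gp_ratio b z y = 1" if z: "z \<in> A - {x}" for z
  proof -
    have z0: "z \<ge> 0" "z \<noteq> x" using z Cons.prems(3) by auto
    have u: "1 + b * x \<noteq> 0" using pos[of x] assms(3) by simp
    have 1: "1 + b * y = 1 / (1 + b * x)"
      using u by (simp add: eq_divide_eq algebra_simps) (use yx in algebra)
    have 2: "oplus b z y = (z - x) / (1 + b * x)"
      using u by (simp add: oplus_def eq_divide_eq) (use yx in algebra)
    have 3: "z - y = oplus b z x / (1 + b * x)"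
      using u by (simp add: oplus_def eq_divide_eq) (use yx in algebra)
    have cancel: "g * u / d * (d / u * (1 / u) / (g / u)) = 1" if "g \<noteq> 0" "d \<noteq> 0" "u \<noteq> 0" for g d u :: real
      using that by (simp add: field_simps)
    have "oplus b z x > 0"
      using assms(3,5) z0 by (simp add: oplus_def add_nonneg_pos add_pos_nonneg)
    then show ?thesis
      unfolding gp_ratio_def 1 2 3 using u z0 by (intro cancel) auto
  qed
  let ?t = "\<lambda>B z. z ^ a * (\<Prod>u\<in>B - {z}. gp_ratio b z u) * gp_value b ms (B - {z})"
  have ty: "?t (insert y A) y = 0"
    using zero(2) y Cons.prems(1,2) by (auto intro!: prod_zero)
  have tx: "?t (insert y A) x = 0"
  proof -
    have "(\<Prod>u\<in>insert y A - {x}. gp_ratio b x u) = 0"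
      by (rule prod_zero) (use zero(1) y Cons.prems(1,2) in auto)
    then show ?thesis by simp
  qed
  have tz: "?t (insert y A) z = ?t (A - {x}) z" if z: "z \<in> A - {x}" for z
  proof -
    have "z \<noteq> y" using z y by auto
    have "(\<Prod>u\<in>insert y A - {z}. gp_ratio b z u) = gp_ratio b z y * (\<Prod>u\<in>insert y A - {z} - {y}. gp_ratio b z u)"
      using Cons.prems(1) \<open>z \<noteq> y\<close> by (intro prod.remove) auto
    also have "insert y A - {z} - {y} = A - {z}" using y by auto
    also have "(\<Prod>u\<in>A - {z}. gp_ratio b z u) = gp_ratio b z x * (\<Prod>u\<in>A - {z} - {x}. gp_ratio b z u)"
      using Cons.prems(1,2) z by (intro prod.remove) auto
    also have "A - {z} - {x} = A - {x} - {z}" by auto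
    finally have "(\<Prod>u\<in>insert y A - {z}. gp_ratio b z u) = (\<Prod>u\<in>A - {x} - {z}. gp_ratio b z u)"
      using inv[OF z] by (simp add: algebra_simps)
    moreover have "gp_value b ms (insert y A - {z}) = gp_value b ms (A - {x} - {z})"
    proof -
      have "insert y A - {z} = insert y (A - {z})" using \<open>z \<noteq> y\<close> by auto
      moreover have "gp_value b ms (insert y (A - {z})) = gp_value b ms (A - {z} - {x})"
        unfolding y_def using Cons z by (intro Cons.IH) auto
      moreover have "A - {z} - {x} = A - {x} - {z}" by auto
      ultimately show ?thesis by simp
    qed
    ultimately show ?thesis by simp
  qed
  have "gp_value b (a # ms) (insert y A) = ?t (insert y A) y + (\<Sum>z\<in>A. ?t (insert y A) z)"
    using Cons.prems(1) y by simp
  also have "\<dots> = (\<Sum>z\<in>A - {x}. ?t (insert y A) z)"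
    using Cons.prems(1,2) ty tx by (simp only: sum.remove[of A x])
  also have "\<dots> = gp_value b (a # ms) (A - {x})"
    unfolding gp_value.simps by (rule sum.cong[OF refl]) (rule tz)
  finally show ?case by (simp add: y_def)
qed simp

lemma prod_linear_factors_dvd:
  fixes p :: "real poly"
  assumes "finite A" "\<And>z. z \<in> A \<Longrightarrow> poly p z = 0"
  shows "(\<Prod>z\<in>A. [:- z, 1:]) dvd p"
  using assms
proof (induction A rule: finite_induct)
  case (insert x A)
  then obtain r where r: "p = (\<Prod>z\<in>A. [:- z, 1:]) * r"
    by (metis dvdE insertCI)
  have "poly (\<Prod>z\<in>A. [:- z, 1:]) x \<noteq> 0"
    using insert.hyps by (auto simp: poly_prod)
  then have "poly r x = 0"
    using insert.prems[of x] r by simp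
  then have "[:- x, 1:] dvd r"
    by (simp add: poly_eq_0_iff_dvd)
  then show ?case
    using insert.hyps r by (metis dvd_triv_right mult.commute mult_dvd_mono prod.insert dvd_refl)
qed simp

lemma degree_prod_linear_factors:
  fixes c d :: "real \<Rightarrow> real"
  shows "degree (\<Prod>z\<in>A. [:c z, d z:]) \<le> card A"
proof (cases "finite A")
  case True
  have "degree (\<Prod>z\<in>A. [:c z, d z:]) \<le> (\<Sum>z\<in>A. degree [:c z, d z:])"
    using degree_prod_sum_le[OF True, of "\<lambda>z. [:c z, d z:]"] by (simp add: comp_def)
  also have "\<dots> \<le> (\<Sum>z\<in>A. 1)"
    by (intro sum_mono) auto
  finally show ?thesis by simp
qed simp

fun first_part :: "nat list \<Rightarrow> nat" where
  "first_part [] = 0"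
| "first_part (a # ms) = a"

text \<open>
  By induction, only the factors with the difference of \<open>y\<close> and an element \<open>w\<close> of \<open>A\<close> can produce a pole,
  and such a factor occurs when \<open>y\<close> or \<open>w\<close> is chosen first. The two residues at \<open>y = w\<close> are
  opposite, since after removing the chosen element the same set \<open>A\<close> remains. The degree bound comes from
  counting factors; it uses that the parts are strictly decreasing.
\<close>

lemma gp_value_polynomial:
  assumes "finite A" "sorted_wrt (>) ms" "0 \<notin> set ms"
  shows "\<exists>p. degree p \<le> first_part ms \<and> (\<forall>y. y \<notin> A \<longrightarrow> gp_value b ms (insert y A) = poly p y)"
  using assms
proof (induction ms arbitrary: A)
  case Nil
  show ?case by (intro exI[of _ 1]) simp
next
  case (Cons a ms)
  have "first_part ms < a"
    using Cons.prems by (cases ms) auto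
  have "\<exists>p. degree p \<le> first_part ms \<and> (\<forall>y. y \<notin> A - {x} \<longrightarrow> gp_value b ms (insert y (A - {x})) = poly p y)" for x
    by (rule Cons.IH) (use Cons.prems in auto)
  then obtain pf where pf: "\<And>x. degree (pf x) \<le> first_part ms"
      "\<And>x y. y \<notin> A - {x} \<Longrightarrow> gp_value b ms (insert y (A - {x})) = poly (pf x) y"
    by metis
  define c where "c = (\<lambda>x. x ^ a * (\<Prod>z\<in>A - {x}. gp_ratio b x z))"
  \<comment> \<open>\<open>N\<close> is the numerator over the common denominator \<open>\<Prod>(y - z)\<close>; \<open>N1\<close> comes from choosing \<open>y\<close> first, and \<open>N2 x\<close>, up to sign, from choosing \<open>x\<close>.\<close>
  define N1 where "N1 = smult (gp_value b ms A * (\<Prod>z\<in>A. 1 + b * z)) (Polynomial.monom 1 a * (\<Prod>z\<in>A. [:z, 1 + b * z:]))"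
  define N2 where "N2 = (\<lambda>x. smult (c x) ([:x, 1 + b * x:] * [:1, b:] * (\<Prod>z\<in>A - {x}. [:- z, 1:]) * pf x))"
  define N where "N = N1 - (\<Sum>x\<in>A. N2 x)"
  have split: "poly (\<Prod>z\<in>A. [:- z, 1:]) y = (y - x) * poly (\<Prod>z\<in>A - {x}. [:- z, 1:]) y" if "x \<in> A" for x y
    using that Cons.prems(1) by (simp add: prod.remove algebra_simps)
  have val: "gp_value b (a # ms) (insert y A) * poly (\<Prod>z\<in>A. [:- z, 1:]) y = poly N y" if y: "y \<notin> A" for y
  proof -
    have "gp_value b (a # ms) (insert y A) = y ^ a * (\<Prod>z\<in>A. gp_ratio b y z) * gp_value b ms A +
        (\<Sum>x\<in>A. x ^ a * (\<Prod>z\<in>insert y A - {x}. gp_ratio b x z) * gp_value b ms (insert y A - {x}))"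
      using Cons.prems(1) y by simp
    moreover have "y ^ a * (\<Prod>z\<in>A. gp_ratio b y z) * gp_value b ms A * poly (\<Prod>z\<in>A. [:- z, 1:]) y = poly N1 y"
    proof -
      have "(\<Prod>z\<in>A. gp_ratio b y z) * poly (\<Prod>z\<in>A. [:- z, 1:]) y = (\<Prod>z\<in>A. gp_ratio b y z * (y - z))"
        by (simp add: poly_prod prod.distrib)
      also have "\<dots> = (\<Prod>z\<in>A. (1 + b * z) * (z + y * (1 + b * z)))"
      proof (intro prod.cong refl)
        fix z assume "z \<in> A"
        then have "gp_ratio b y z * (y - z) = oplus b y z * (1 + b * z)"
          using y by (auto simp: gp_ratio_def)
        then show "gp_ratio b y z * (y - z) = (1 + b * z) * (z + y * (1 + b * z))"
          by (simp add: oplus_def algebra_simps)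
      qed
      finally show ?thesis
        by (simp add: N1_def poly_prod poly_monom prod.distrib)
    qed
    moreover have "x ^ a * (\<Prod>z\<in>insert y A - {x}. gp_ratio b x z) * gp_value b ms (insert y A - {x}) *
        poly (\<Prod>z\<in>A. [:- z, 1:]) y = - poly (N2 x) y" if x: "x \<in> A" for x
    proof -
      have "x \<noteq> y" using x y by auto
      have eq: "insert y A - {x} = insert y (A - {x})" using \<open>x \<noteq> y\<close> by auto
      have "(\<Prod>z\<in>insert y A - {x}. gp_ratio b x z) = gp_ratio b x y * (\<Prod>z\<in>A - {x}. gp_ratio b x z)"
        unfolding eq using Cons.prems(1) y by simp
      moreover have "gp_value b ms (insert y A - {x}) = poly (pf x) y"
        unfolding eq using y by (intro pf(2)) auto
      ultimately have "x ^ a * (\<Prod>z\<in>insert y A - {x}. gp_ratio b x z) * gp_value b ms (insert y A - {x}) *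
          poly (\<Prod>z\<in>A. [:- z, 1:]) y =
          c x * poly (\<Prod>z\<in>A - {x}. [:- z, 1:]) y * poly (pf x) y * (gp_ratio b x y * (y - x))"
        unfolding split[OF x] by (simp add: c_def mult_ac)
      also have "gp_ratio b x y * (y - x) = - (oplus b x y * (1 + b * y))"
        using \<open>x \<noteq> y\<close> by (simp add: gp_ratio_def field_simps)
      also have "oplus b x y * (1 + b * y) = poly ([:x, 1 + b * x:] * [:1, b:]) y"
        by (simp add: oplus_def algebra_simps)
      finally show ?thesis
        unfolding N2_def poly_smult poly_mult by (simp add: mult_ac)
    qed
    ultimately show ?thesis
      by (simp add: N_def distrib_right sum_distrib_right poly_sum sum_negf)
  qed
  have root: "poly N w = 0" if w: "w \<in> A" for w
  proof -
    have "poly (N2 x) w = 0" if "x \<in> A - {w}" for x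
    proof -
      have "poly (\<Prod>z\<in>A - {x}. [:- z, 1:]) w = 0"
        using that w Cons.prems(1) by (auto simp: poly_prod)
      then show ?thesis by (simp add: N2_def)
    qed
    then have "poly N w = poly N1 w - poly (N2 w) w"
      using Cons.prems(1) w by (simp add: N_def poly_sum sum.remove)
    moreover have "poly (N2 w) w = poly N1 w"
    proof -
      have "poly (pf w) w = gp_value b ms A"
        using pf(2)[of w w] w by (simp add: insert_absorb)
      moreover have "(\<Prod>z\<in>A - {w}. gp_ratio b w z) * (\<Prod>z\<in>A - {w}. w - z) =
          (\<Prod>z\<in>A - {w}. 1 + b * z) * (\<Prod>z\<in>A - {w}. z + w * (1 + b * z))"
        unfolding prod.distrib[symmetric]
      proof (intro prod.cong refl)
        fix z assume "z \<in> A - {w}"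
        then have "gp_ratio b w z * (w - z) = oplus b w z * (1 + b * z)"
          by (auto simp: gp_ratio_def)
        then show "gp_ratio b w z * (w - z) = (1 + b * z) * (z + w * (1 + b * z))"
          by (simp add: oplus_def algebra_simps)
      qed
      ultimately show ?thesis
        using Cons.prems(1) w
        by (simp add: N1_def N2_def c_def poly_prod poly_monom prod.remove[of A w] algebra_simps)
    qed
    ultimately show ?thesis by simp
  qed
  obtain p where p: "N = (\<Prod>z\<in>A. [:- z, 1:]) * p"
    using prod_linear_factors_dvd[OF Cons.prems(1) root] by (auto simp: dvd_def)
  have "degree N \<le> a + card A"
    unfolding N_def
  proof (intro degree_diff_le degree_sum_le)
    have "degree N1 \<le> degree (Polynomial.monom (1::real) a * (\<Prod>z\<in>A. [:z, 1 + b * z:]))"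
      unfolding N1_def by (rule degree_smult_le)
    also have "\<dots> \<le> degree (Polynomial.monom (1::real) a) + degree (\<Prod>z\<in>A. [:z, 1 + b * z:])"
      by (rule degree_mult_le)
    also have "\<dots> \<le> a + card A"
      by (intro add_mono degree_monom_le degree_prod_linear_factors)
    finally show "degree N1 \<le> a + card A" .
    show "degree (N2 x) \<le> a + card A" if x: "x \<in> A" for x
    proof -
      have "degree (N2 x) \<le> degree ([:x, 1 + b * x:] * [:1, b:] * (\<Prod>z\<in>A - {x}. [:- z, 1:]) * pf x)"
        unfolding N2_def by (rule degree_smult_le)
      also have "\<dots> \<le> degree ([:x, 1 + b * x:] * [:1, b:] * (\<Prod>z\<in>A - {x}. [:- z, 1:])) + degree (pf x)"
        by (rule degree_mult_le)
      also have "\<dots> \<le> degree ([:x, 1 + b * x:] * [:1, b:]) + degree (\<Prod>z\<in>A - {x}. [:- z, 1:]) + degree (pf x)"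
        by (intro add_mono degree_mult_le order_refl)
      also have "\<dots> \<le> 2 + card (A - {x}) + first_part ms"
      proof (intro add_mono degree_prod_linear_factors pf(1))
        show "degree ([:x, 1 + b * x:] * [:1, b:]) \<le> 2"
          using degree_mult_le[of "[:x, 1 + b * x:]" "[:1, b:]"] by (auto split: if_splits)
      qed
      also have "\<dots> \<le> a + card A"
        using x Cons.prems(1) \<open>first_part ms < a\<close> card_Suc_Diff1[of A x] by simp
      finally show ?thesis .
    qed
  qed (fact Cons.prems(1))
  have "degree p \<le> a"
  proof (cases "p = 0")
    case False
    have "(\<Prod>z\<in>A. [:- z, 1:]) \<noteq> 0" using Cons.prems(1) by simp
    then have "degree N = degree (\<Prod>z\<in>A. [:- z, 1:]) + degree p"
      using False unfolding p by (rule degree_mult_eq)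
    moreover have "degree (\<Prod>z\<in>A. [:- z, 1:]) = card A"
      by (subst degree_prod_eq_sum_degree) auto
    ultimately show ?thesis using \<open>degree N \<le> a + card A\<close> by simp
  qed simp
  moreover have "gp_value b (a # ms) (insert y A) = poly p y" if y: "y \<notin> A" for y
  proof -
    have "poly (\<Prod>z\<in>A. [:- z, 1:]) y \<noteq> 0"
      using y Cons.prems(1) by (auto simp: poly_prod)
    then show ?thesis
      using val[OF y] p by simp
  qed
  ultimately show ?case
    unfolding first_part.simps by blast
qed

text \<open>
  Lagrange interpolation, evaluated at 0.
\<close>

lemma lagrange_at_zero:
  fixes p :: "real poly"
  assumes "finite B" "degree p < card B"
  shows "(\<Sum>t\<in>B. poly p t * (\<Prod>s\<in>B - {t}. s / (s - t))) = poly p 0"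
proof -
  define L where "L = (\<Sum>t\<in>B. smult (poly p t) (\<Prod>s\<in>B - {t}. smult (1 / (t - s)) [:- s, 1:]))"
  have "p = L"
  proof (rule poly_eqI_degree[of B])
    fix u assume u: "u \<in> B"
    have "(\<Prod>s\<in>B - {t}. (u - s) / (t - s)) = 0" if "t \<in> B - {u}" for t
      using that u assms(1) by (intro prod_zero) auto
    then have "(\<Sum>t\<in>B - {u}. poly p t * (\<Prod>s\<in>B - {t}. (u - s) / (t - s))) = 0"
      by (intro sum.neutral ballI) (metis mult_zero_right)
    moreover have "(\<Prod>s\<in>B - {u}. (u - s) / (u - s)) = 1"
      by (intro prod.neutral) auto
    moreover have "poly L u = (\<Sum>t\<in>B. poly p t * (\<Prod>s\<in>B - {t}. (u - s) / (t - s)))"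
      by (simp add: L_def poly_sum poly_prod diff_divide_distrib)
    ultimately show "poly p u = poly L u"
      using assms(1) u by (simp add: sum.remove[of B u] del: prod_zero_iff)
  next
    show "degree p < card B" by fact
    have "degree L \<le> card B - 1"
      unfolding L_def
    proof (intro degree_sum_le assms(1))
      fix t assume "t \<in> B"
      have "degree (smult (poly p t) (\<Prod>s\<in>B - {t}. smult (1 / (t - s)) [:- s, 1:])) \<le>
          degree (\<Prod>s\<in>B - {t}. [:1 / (t - s) * - s, 1 / (t - s):])"
        using degree_smult_le by simp
      also have "\<dots> \<le> card (B - {t})"
        by (rule degree_prod_linear_factors)
      finally show "degree (smult (poly p t) (\<Prod>s\<in>B - {t}. smult (1 / (t - s)) [:- s, 1:])) \<le> card B - 1"
        using \<open>t \<in> B\<close> assms(1) by simp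
    qed
    then show "degree L < card B"
      using assms(2) by linarith
  qed
  then have "poly p 0 = poly L 0" by simp
  also have "\<dots> = (\<Sum>t\<in>B. poly p t * (\<Prod>s\<in>B - {t}. s / (s - t)))"
    unfolding L_def poly_sum poly_smult poly_prod
    by (intro sum.cong refl arg_cong2[where f = "(*)"] prod.cong) (auto simp: divide_simps algebra_simps)
  finally show ?thesis by simp
qed

text \<open>
  Interpolate the polynomial of the previous lemmas at the nodes \<open>- q(x)\<close>, where its values are known by
  the cancellation property.
\<close>

lemma gp_value_stable:
  assumes fin: "finite A" and Apos: "\<And>z. z \<in> A \<Longrightarrow> 0 < z" and b: "0 < b"
    and ms: "sorted_wrt (>) ms" "0 \<notin> set ms" and card: "first_part ms < card A"
  shows "(\<Sum>x\<in>A. gp_value b ms (A - {x}) * (\<Prod>z\<in>A - {x}. pi_weight b z x)) = gp_value b ms A"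
proof -
  have False0: "0 \<notin> A" and nonneg: "\<And>z. z \<in> A \<Longrightarrow> 0 \<le> z"
    using Apos by fastforce+
  define q where "q = (\<lambda>x. x / (1 + b * x))"
  have pos: "1 + b * z > 0" if "z \<in> A" for z
    using b nonneg[OF that] by (simp add: add_pos_nonneg)
  have diff: "q z - q x = (z - x) / ((1 + b * z) * (1 + b * x))" if "z \<in> A" "x \<in> A" for x z
    using pos[OF that(1)] pos[OF that(2)] by (simp add: q_def field_simps)
  have inj: "inj_on (\<lambda>x. - q x) A"
  proof (rule inj_onI)
    fix x y assume xy: "x \<in> A" "y \<in> A" "- q x = - q y"
    then show "x = y"
      using diff[OF xy(1,2)] pos[OF xy(1)] pos[OF xy(2)] by simp
  qed
  obtain p where p: "degree p \<le> first_part ms" "\<And>y. y \<notin> A \<Longrightarrow> gp_value b ms (insert y A) = poly p y"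
    using gp_value_polynomial[OF fin ms] by blast
  have node: "poly p (- q x) = gp_value b ms (A - {x})" if x: "x \<in> A" for x
  proof -
    have "- q x < 0"
      using Apos[OF x] pos[OF x] by (simp add: q_def)
    then have "- q x \<notin> A"
      using nonneg by fastforce
    then show ?thesis
      using p(2)[of "- q x"] gp_value_cancel[OF fin x Apos[OF x] nonneg b] by (simp add: q_def)
  qed
  have ker: "pi_weight b z x = - q z / (- q z - - q x)" if "x \<in> A" "z \<in> A - {x}" for x z
  proof -
    have "- q z / (- q z - - q x) = q z / (q z - q x)"
      using minus_divide_divide[of "q z" "q z - q x"] by simp
    also have "\<dots> = pi_weight b z x"
    proof -
      have "z / u / (d / (u * w)) = z * w / d" if "u \<noteq> 0" "w \<noteq> 0" "d \<noteq> 0" for u w d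
        using that by simp
      moreover have "1 + b * z \<noteq> 0" "1 + b * x \<noteq> 0" "z - x \<noteq> 0"
        using that pos[of x] pos[of z] by auto
      ultimately show ?thesis
        using that diff[of z x] by (simp add: q_def pi_weight_def)
    qed
    finally show ?thesis by simp
  qed
  have "(\<Sum>x\<in>A. gp_value b ms (A - {x}) * (\<Prod>z\<in>A - {x}. pi_weight b z x)) =
      (\<Sum>x\<in>A. poly p (- q x) * (\<Prod>z\<in>A - {x}. - q z / (- q z - - q x)))"
    using node ker by (intro sum.cong refl arg_cong2[where f = "(*)"] prod.cong) auto
  also have "\<dots> = (\<Sum>t\<in>(\<lambda>x. - q x) ` A. poly p t * (\<Prod>s\<in>(\<lambda>x. - q x) ` A - {t}. s / (s - t)))"
  proof -
    have "(\<lambda>x. - q x) ` A - {- q x} = (\<lambda>x. - q x) ` (A - {x})" if "x \<in> A" for x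
      using inj that by (auto simp: inj_on_def)
    moreover have "inj_on (\<lambda>x. - q x) (A - {x})" for x
      using inj by (rule inj_on_subset) auto
    ultimately show ?thesis
      by (simp add: sum.reindex[OF inj] prod.reindex)
  qed
  also have "\<dots> = poly p 0"
    using fin p(1) card by (intro lagrange_at_zero) (auto simp: card_image[OF inj])
  also have "\<dots> = gp_value b ms (insert 0 A)"
    using p(2) False0 by simp
  also have "\<dots> = gp_value b ms A"
    using gp_value_drop_zero[of "insert 0 A" ms b] fin ms(2) False0 by simp
  finally show ?thesis .
qed

section \<open>The operators at a point\<close>

text \<open>
  In the variables \<open>q\<close> the following three identities are partial fraction decompositions. The first two
  reflect that a product of weights attached to a segment of variables survives lengthening the
  segment by an operator.
\<close>

lemma pi_weight_transfer_left:
  assumes "x \<noteq> y" "y \<noteq> z" "x \<noteq> z"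
  shows "pi_weight b x y * pi_weight b z x + pi_weight b y x * pi_weight b z y = pi_weight b z x * pi_weight b z y"
proof -
  have "x - y \<noteq> 0" "y - x \<noteq> 0" "z - x \<noteq> 0" "z - y \<noteq> 0" using assms by auto
  then show ?thesis
    unfolding pi_weight_def by (simp add: divide_simps) (simp add: algebra_simps)
qed

lemma pi_weight_transfer_right:
  assumes "x \<noteq> y" "y \<noteq> z" "x \<noteq> z"
  shows "pi_weight b x y * pi_weight b y z + pi_weight b y x * pi_weight b x z = pi_weight b x z * pi_weight b y z"
proof -
  have "x - y \<noteq> 0" "y - x \<noteq> 0" "x - z \<noteq> 0" "y - z \<noteq> 0" using assms by auto
  then show ?thesis
    unfolding pi_weight_def by (simp add: divide_simps) (simp add: algebra_simps)
qed

lemma pi_weight_unit: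
  assumes "x \<noteq> y"
  shows "pi_weight b x y + pi_weight b y x = 1"
proof -
  have "x - y \<noteq> 0" "y - x \<noteq> 0" using assms by auto
  then show ?thesis
    unfolding pi_weight_def by (simp add: divide_simps) (simp add: algebra_simps)
qed

lemma ring_x_induct [case_names const X add mult]:
  fixes f :: ring_x
  assumes const: "\<And>c. P (Poly_Mapping.single 0 c)"
    and X: "\<And>i. P (X i)"
    and add: "\<And>f g. P f \<Longrightarrow> P g \<Longrightarrow> P (f + g)"
    and mult: "\<And>f g. P f \<Longrightarrow> P g \<Longrightarrow> P (f * g)"
  shows "P f"
proof -
  have zero: "P 0" and one: "P 1"
    using const[of 0] const[of 1] by simp_all
  have sum: "(\<And>a. a \<in> A \<Longrightarrow> P (F a)) \<Longrightarrow> P (sum F A)" for A :: "(nat \<Rightarrow>\<^sub>0 nat) set" and F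
    by (induction A rule: infinite_finite_induct) (auto intro: zero add)
  have power: "P (Poly_Mapping.single (Poly_Mapping.single i k) 1)" for i k
  proof (induction k)
    case (Suc k)
    have "Poly_Mapping.single (Poly_Mapping.single i (Suc k)) 1 =
        X i * Poly_Mapping.single (Poly_Mapping.single i k) 1"
      by (simp add: X_def mult_single single_add[symmetric])
    then show ?case
      using Suc X mult by simp
  qed (simp add: one)
  have mon: "P (Poly_Mapping.single (\<Sum>i\<in>I. Poly_Mapping.single i (h i)) 1)" for I and h :: "nat \<Rightarrow> nat"
  proof (induction I rule: infinite_finite_induct)
    case (insert i I)
    have "Poly_Mapping.single (\<Sum>i\<in>insert i I. Poly_Mapping.single i (h i)) 1 =
        Poly_Mapping.single (Poly_Mapping.single i (h i)) 1 *
        Poly_Mapping.single (\<Sum>i\<in>I. Poly_Mapping.single i (h i)) (1 :: int poly)"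
      using insert.hyps by (simp add: mult_single)
    then show ?case
      using insert.IH power mult by simp
  qed (simp_all add: one)
  have "P (Poly_Mapping.single m c)" for m c
  proof -
    have "m = (\<Sum>i\<in>Poly_Mapping.keys m. Poly_Mapping.single i (Poly_Mapping.lookup m i))"
      by (rule poly_mapping_eqI) (auto simp: lookup_sum lookup_single when_def in_keys_iff)
    then have "P (Poly_Mapping.single m 1)"
      using mon[of "Poly_Mapping.lookup m" "Poly_Mapping.keys m"] by simp
    moreover have "Poly_Mapping.single m c = Poly_Mapping.single 0 c * Poly_Mapping.single m 1"
      by (simp add: mult_single)
    ultimately show ?thesis
      using const mult by simp
  qed
  then have "P (\<Sum>m\<in>Poly_Mapping.keys f. Poly_Mapping.single m (Poly_Mapping.lookup f m))"
    by (intro sum)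
  then show ?thesis
    by (simp only: ring_x_decomp[symmetric])
qed

lemma bij_simple_refl [simp]: "bij (simple_refl i)"
  by (simp add: simple_refl_def)

lemma inj_simple_refl [simp]: "inj (simple_refl i)"
  by (simp add: bij_is_inj)

lemma simple_refl_simps [simp]:
  "simple_refl i i = Suc i" "simple_refl i (Suc i) = i"
  "k \<noteq> i \<Longrightarrow> k \<noteq> Suc i \<Longrightarrow> simple_refl i k = k"
  by (simp_all add: simple_refl_def)

lemma simple_refl_involution [simp]: "simple_refl i (simple_refl i k) = k"
  by (simp add: simple_refl_def)

lemma simple_refl_comp_self [simp]: "simple_refl i \<circ> simple_refl i = id"
  by (simp add: fun_eq_iff)

lemma inv_simple_refl [simp]: "inv (simple_refl i) = simple_refl i"
  by (simp add: simple_refl_def)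

lemma simple_refl_braid:
  "simple_refl i \<circ> simple_refl (Suc i) \<circ> simple_refl i =
   simple_refl (Suc i) \<circ> simple_refl i \<circ> simple_refl (Suc i)"
proof
  fix k
  consider "k = i" | "k = Suc i" | "k = Suc (Suc i)" | "k \<noteq> i" "k \<noteq> Suc i" "k \<noteq> Suc (Suc i)"
    by blast
  then show "(simple_refl i \<circ> simple_refl (Suc i) \<circ> simple_refl i) k =
      (simple_refl (Suc i) \<circ> simple_refl i \<circ> simple_refl (Suc i)) k"
    by cases simp_all
qed

lemma simple_refl_commute:
  assumes "Suc i < j"
  shows "simple_refl i \<circ> simple_refl j = simple_refl j \<circ> simple_refl i"
proof
  fix k
  consider "k = i" | "k = Suc i" | "k = j" | "k = Suc j" | "k \<noteq> i" "k \<noteq> Suc i" "k \<noteq> j" "k \<noteq> Suc j"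
    by blast
  then show "(simple_refl i \<circ> simple_refl j) k = (simple_refl j \<circ> simple_refl i) k"
    using assms by cases simp_all
qed

lemma X_diff_nonzero:
  assumes "i \<noteq> j"
  shows "X i - X j \<noteq> 0"
proof
  assume "X i - X j = 0"
  then have "evaluate 1 (\<lambda>k. real k) (X i - X j) = 0" by simp
  then show False using assms by simp
qed

text \<open>
  Divisibility is inherited by sums and, through the twisted Leibniz rule
  \<open>f g - s(f g) = (f - s f) g + s f (g - s g)\<close>, by products.
\<close>

lemma divided_diff: "(X i - X (Suc i)) * divided_diff i f = f - perm_poly (simple_refl i) f"
proof -
  let ?s = "perm_poly (simple_refl i)" and ?d = "X i - X (Suc i)"
  have "\<exists>g. ?d * g = f - ?s f"
  proof (induction f rule: ring_x_induct)
    case (const c)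
    then show ?case by (intro exI[of _ 0]) (simp add: perm_poly_single)
  next
    case (X k)
    consider "k = i" | "k = Suc i" | "k \<noteq> i" "k \<noteq> Suc i" by blast
    then show ?case
    proof cases
      case 1 then show ?thesis by (intro exI[of _ 1]) (simp add: perm_poly_X)
    next
      case 2 then show ?thesis by (intro exI[of _ "- 1"]) (simp add: perm_poly_X)
    next
      case 3 then show ?thesis by (intro exI[of _ 0]) (simp add: perm_poly_X)
    qed
  next
    case (add f g)
    then obtain f' g' where "?d * f' = f - ?s f" "?d * g' = g - ?s g" by blast
    then show ?case by (intro exI[of _ "f' + g'"]) (simp add: perm_poly_add algebra_simps)
  next
    case (mult f g)
    then obtain f' g' where fg: "?d * f' = f - ?s f" "?d * g' = g - ?s g" by blast
    have "?d * (f' * g + ?s f * g') = (?d * f') * g + ?s f * (?d * g')" by (simp add: algebra_simps)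
    also have "\<dots> = f * g - ?s (f * g)"
      unfolding fg by (simp add: perm_poly_mult algebra_simps)
    finally show ?case by blast
  qed
  then obtain g where g: "?d * g = f - ?s f" by blast
  then have "h = g" if "?d * h = f - ?s f" for h
    using that X_diff_nonzero[of i "Suc i"] by (metis mult_left_cancel n_not_Suc_n)
  then show ?thesis
    unfolding divided_diff_def using g by (rule_tac theI) 
qed

lemma eval_pi_op:
  assumes "v i \<noteq> v (Suc i)"
  shows "evaluate b v (pi_op i f) = pi_weight b (v i) (v (Suc i)) * evaluate b v f +
    pi_weight b (v (Suc i)) (v i) * evaluate b (v \<circ> simple_refl i) f"
proof -
  define D where "D = evaluate b v (divided_diff i f)"
  have "evaluate b v ((X i - X (Suc i)) * divided_diff i f) = evaluate b v (f - perm_poly (simple_refl i) f)"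
    by (simp only: divided_diff)
  then have "(v i - v (Suc i)) * D = evaluate b v f - evaluate b (v \<circ> simple_refl i) f"
    by (simp add: eval_perm_poly D_def)
  then have E: "evaluate b (v \<circ> simple_refl i) f = evaluate b v f - (v i - v (Suc i)) * D"
    by simp
  have "pi_weight b (v i) (v (Suc i)) * evaluate b v f + pi_weight b (v (Suc i)) (v i) * evaluate b (v \<circ> simple_refl i) f =
      (pi_weight b (v i) (v (Suc i)) + pi_weight b (v (Suc i)) (v i)) * evaluate b v f +
      pi_weight b (v (Suc i)) (v i) * (v (Suc i) - v i) * D"
    unfolding E by (simp add: algebra_simps)
  also have "\<dots> = evaluate b v f + v (Suc i) * (1 + b * v i) * D"
    using pi_weight_unit[OF assms, of b] assms by (simp add: pi_weight_def)
  finally show ?thesis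
    by (simp add: pi_op_def D_def)
qed

lemma pi_op_fixed:
  assumes "\<And>b v. 0 < b \<Longrightarrow> inj v \<Longrightarrow> evaluate b (v \<circ> simple_refl i) f = evaluate b v f"
  shows "pi_op i f = f"
proof (rule eval_eqI)
  fix b :: real and v :: "nat \<Rightarrow> real" assume b: "0 < b" and v: "inj v"
  then have ne: "v i \<noteq> v (Suc i)" by (auto dest: injD)
  show "evaluate b v (pi_op i f) = evaluate b v f"
    using pi_weight_unit[OF ne, of b] by (simp add: eval_pi_op ne assms[OF b v] flip: distrib_right)
qed

lemma pi_op_commute:
  assumes "Suc i < j"
  shows "pi_op i (pi_op j f) = pi_op j (pi_op i f)"
proof (rule eval_eqI)
  fix b :: real and v :: "nat \<Rightarrow> real" assume v: "inj v"
  have ne: "v k = v l \<longleftrightarrow> k = l" for k l using v by (auto dest: injD)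
  show "evaluate b v (pi_op i (pi_op j f)) = evaluate b v (pi_op j (pi_op i f))"
    using assms simple_refl_commute[OF assms]
    by (simp add: eval_pi_op ne comp_assoc algebra_simps)
qed

text \<open>
  Both sides are combinations of the six values of \<open>f\<close> obtained by permuting three coordinates. The coefficients
  of the three longest permutations agree literally; the others agree by the identities for the weights.
\<close>

lemma pi_op_braid:
  "pi_op i (pi_op (Suc i) (pi_op i f)) = pi_op (Suc i) (pi_op i (pi_op (Suc i) f))"
proof (rule eval_eqI)
  fix b :: real and v :: "nat \<Rightarrow> real" assume v: "inj v"
  have ne: "v k = v l \<longleftrightarrow> k = l" for k l using v by (auto dest: injD)
  let ?s = "simple_refl i" and ?t = "simple_refl (Suc i)" and ?c = "pi_weight b"
  define x y z where "x = v i" and "y = v (Suc i)" and "z = v (Suc (Suc i))"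
  have xyz: "x \<noteq> y" "y \<noteq> z" "x \<noteq> z"
    using ne by (simp_all add: x_def y_def z_def)
  let ?E = "\<lambda>w. evaluate b (v \<circ> w) f"
  have ss: "v \<circ> ?s \<circ> ?s = v" "v \<circ> ?t \<circ> ?t = v" "v \<circ> ?s \<circ> ?t \<circ> ?s = v \<circ> ?t \<circ> ?s \<circ> ?t"
    by (simp_all add: comp_assoc) (simp add: fun_eq_iff simple_refl_braid[unfolded fun_eq_iff, simplified])
  have L: "evaluate b v (pi_op i (pi_op (Suc i) (pi_op i f))) =
      ?c x y * (?c y z * ?c x y + ?c y x * ?c x z) * evaluate b v f +
      ?c y x * (?c x y * ?c y z + ?c y x * ?c x z) * evaluate b (v \<circ> ?s) f +
      ?c x y * ?c z y * ?c x z * evaluate b (v \<circ> ?t) f + ?c x y * ?c z y * ?c z x * evaluate b (v \<circ> ?t \<circ> ?s) f +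
      ?c y x * ?c z x * ?c y z * evaluate b (v \<circ> ?s \<circ> ?t) f +
      ?c y x * ?c z x * ?c z y * evaluate b (v \<circ> ?t \<circ> ?s \<circ> ?t) f"
    unfolding x_def y_def z_def by (simp add: eval_pi_op ne ss algebra_simps)
  have R: "evaluate b v (pi_op (Suc i) (pi_op i (pi_op (Suc i) f))) =
      ?c y z * (?c y z * ?c x y + ?c z y * ?c x z) * evaluate b v f +
      ?c z y * (?c y z * ?c x y + ?c z y * ?c x z) * evaluate b (v \<circ> ?t) f +
      ?c y z * ?c y x * ?c x z * evaluate b (v \<circ> ?s) f + ?c y z * ?c y x * ?c z x * evaluate b (v \<circ> ?s \<circ> ?t) f +
      ?c z y * ?c z x * ?c x y * evaluate b (v \<circ> ?t \<circ> ?s) f +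
      ?c z y * ?c z x * ?c y x * evaluate b (v \<circ> ?t \<circ> ?s \<circ> ?t) f"
    unfolding x_def y_def z_def by (simp add: eval_pi_op ne ss algebra_simps)
  have 1: "?c y z * ?c x y + ?c y x * ?c x z = ?c x z * ?c y z"
    "?c x y * ?c y z + ?c y x * ?c x z = ?c x z * ?c y z"
    using pi_weight_transfer_right[of x y z b] xyz by (simp_all add: mult.commute)
  have 2: "?c y z * ?c x y + ?c z y * ?c x z = ?c x y * ?c x z"
    using pi_weight_transfer_left[of y z x b] xyz by simp
  show "evaluate b v (pi_op i (pi_op (Suc i) (pi_op i f))) = evaluate b v (pi_op (Suc i) (pi_op i (pi_op (Suc i) f)))"
    unfolding L R 1 2 by (simp add: algebra_simps)
qed

section \<open>Sorting compositions\<close>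

definition inversions :: "(nat \<Rightarrow> nat) \<Rightarrow> (nat \<times> nat) set" where
  "inversions \<alpha> = {(i, j). 1 \<le> i \<and> i < j \<and> \<alpha> i < \<alpha> j}"

lemma finite_inversions:
  assumes "weak_composition \<alpha>"
  shows "finite (inversions \<alpha>)"
proof -
  have "inversions \<alpha> \<subseteq> (\<Union>j\<in>{j. \<alpha> j \<noteq> 0}. {..<j} \<times> {j})"
    by (auto simp: inversions_def)
  then show ?thesis
    by (rule finite_subset) (use assms in \<open>auto simp: weak_composition_def\<close>)
qed

lemma simple_refl_if: "simple_refl i k = (if k = i then Suc i else if k = Suc i then i else k)"
  by simp

lemma simple_refl_mono:
  assumes "a < b" "(a, b) \<noteq> (i, Suc i)"
  shows "simple_refl i a < simple_refl i b" "(simple_refl i a, simple_refl i b) \<noteq> (i, Suc i)"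
  using assms unfolding simple_refl_if by (auto split: if_splits)

lemma simple_refl_pos: "1 \<le> i \<Longrightarrow> 1 \<le> simple_refl i k \<longleftrightarrow> 1 \<le> k"
  by (cases "k = i"; cases "k = Suc i") simp_all

lemma inversions_swap:
  assumes "1 \<le> i"
  shows "inversions (\<alpha> \<circ> simple_refl i) - {(i, Suc i)} =
    map_prod (simple_refl i) (simple_refl i) ` (inversions \<alpha> - {(i, Suc i)})"
proof -
  let ?s = "simple_refl i"
  have inv: "map_prod ?s ?s (map_prod ?s ?s e) = e" for e
    by (cases e) simp
  have sub: "map_prod ?s ?s ` (inversions \<beta> - {(i, Suc i)}) \<subseteq> inversions (\<beta> \<circ> ?s) - {(i, Suc i)}" for \<beta>
  proof (rule image_subsetI)
    fix e assume e: "e \<in> inversions \<beta> - {(i, Suc i)}"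
    obtain x y where xy: "e = (x, y)" by (cases e)
    then have "1 \<le> x" "x < y" "\<beta> x < \<beta> y" "(x, y) \<noteq> (i, Suc i)"
      using e by (simp_all add: inversions_def)
    then show "map_prod ?s ?s e \<in> inversions (\<beta> \<circ> ?s) - {(i, Suc i)}"
      unfolding xy using simple_refl_mono[of x y i] simple_refl_pos[OF assms, of x]
      by (simp add: inversions_def del: One_nat_def)
  qed
  have "inversions (\<alpha> \<circ> ?s) - {(i, Suc i)} =
      map_prod ?s ?s ` map_prod ?s ?s ` (inversions (\<alpha> \<circ> ?s) - {(i, Suc i)})"
    by (simp add: image_image inv)
  also have "\<dots> \<subseteq> map_prod ?s ?s ` (inversions (\<alpha> \<circ> ?s \<circ> ?s) - {(i, Suc i)})"
    by (intro image_mono sub)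
  finally show ?thesis
    using sub[of \<alpha>] by (simp add: comp_assoc)
qed

lemma card_inversions_swap:
  assumes "weak_composition \<alpha>" "1 \<le> i"
  shows "\<alpha> (Suc i) < \<alpha> i \<Longrightarrow> card (inversions (\<alpha> \<circ> simple_refl i)) = Suc (card (inversions \<alpha>))"
    and "\<alpha> i \<le> \<alpha> (Suc i) \<Longrightarrow> card (inversions (\<alpha> \<circ> simple_refl i)) \<le> card (inversions \<alpha>)"
proof -
  let ?s = "simple_refl i"
  have "inj (map_prod ?s ?s)" by (intro prod.inj_map) simp_all
  then have card: "card (inversions (\<alpha> \<circ> ?s) - {(i, Suc i)}) = card (inversions \<alpha> - {(i, Suc i)})"
    unfolding inversions_swap[OF assms(2)] by (intro card_image) (rule inj_on_subset, auto)
  have fin: "finite (inversions \<alpha>)" by (rule finite_inversions[OF assms(1)])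
  then have fin': "finite (inversions (\<alpha> \<circ> ?s))"
    using inversions_swap[OF assms(2), of \<alpha>] by (metis finite_Diff finite_Diff2 finite.emptyI finite_imageI finite_insert)
  show "card (inversions (\<alpha> \<circ> ?s)) = Suc (card (inversions \<alpha>))" if "\<alpha> (Suc i) < \<alpha> i"
  proof -
    have "(i, Suc i) \<notin> inversions \<alpha>" "(i, Suc i) \<in> inversions (\<alpha> \<circ> ?s)"
      using that assms(2) by (auto simp: inversions_def)
    then show ?thesis
      using card fin' by (metis Diff_insert0 Diff_empty card_Suc_Diff1)
  qed
  show "card (inversions (\<alpha> \<circ> ?s)) \<le> card (inversions \<alpha>)" if "\<alpha> i \<le> \<alpha> (Suc i)"
  proof -
    have "(i, Suc i) \<notin> inversions (\<alpha> \<circ> ?s)"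
      using that by (auto simp: inversions_def)
    then show ?thesis
      using card fin by (metis Diff_insert0 Diff_empty card_Diff1_le)
  qed
qed

lemma weak_composition_swap:
  assumes "weak_composition \<alpha>" "1 \<le> i"
  shows "weak_composition (\<alpha> \<circ> simple_refl i)"
proof -
  have "{k. (\<alpha> \<circ> simple_refl i) k \<noteq> 0} = simple_refl i -` {k. \<alpha> k \<noteq> 0}" by auto
  then show ?thesis
    using assms finite_vimageI[of "{k. \<alpha> k \<noteq> 0}" "simple_refl i"]
    by (auto simp: weak_composition_def)
qed

text \<open>
  Equality up to rearrangement, expressed by the sizes of the upper level sets. For a partition these
  sizes are the parts of the transposed partition, so they determine it.
\<close>

definition same_content :: "(nat \<Rightarrow> nat) \<Rightarrow> (nat \<Rightarrow> nat) \<Rightarrow> bool" where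
  "same_content \<alpha> \<beta> \<longleftrightarrow> (\<forall>c\<ge>1. card {i. c \<le> \<alpha> i} = card {i. c \<le> \<beta> i})"

lemma same_content_swap: "same_content (\<alpha> \<circ> simple_refl i) \<beta> \<longleftrightarrow> same_content \<alpha> \<beta>"
proof -
  have "{k. c \<le> (\<alpha> \<circ> simple_refl i) k} = simple_refl i ` {k. c \<le> \<alpha> k}" for c
    by (auto simp: image_iff) (metis simple_refl_involution)
  then have "card {k. c \<le> (\<alpha> \<circ> simple_refl i) k} = card {k. c \<le> \<alpha> k}" for c
    by (metis card_image inj_on_subset inj_simple_refl subset_UNIV)
  then show ?thesis by (simp add: same_content_def)
qed

lemma partition_le_iff:
  assumes "is_partition \<mu>" "1 \<le> c" "1 \<le> i"
  shows "c \<le> \<mu> i \<longleftrightarrow> i \<le> card {j. c \<le> \<mu> j}"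
proof -
  let ?S = "{j. c \<le> \<mu> j}"
  have wc: "weak_composition \<mu>" using assms(1) by (simp add: is_partition_def)
  have antimono: "\<mu> k \<le> \<mu> j" if "1 \<le> j" "j \<le> k" for j k
    using that assms(1) by (simp add: is_partition_def)
  have "?S \<subseteq> {j. \<mu> j \<noteq> 0}" using assms(2) by auto
  then have fin: "finite ?S"
    by (rule finite_subset) (use wc in \<open>simp add: weak_composition_def\<close>)
  have pos: "1 \<le> j" if "j \<in> ?S" for j
    using that wc assms(2) by (cases "j = 0") (auto simp: weak_composition_def)
  show ?thesis
  proof
    assume "c \<le> \<mu> i"
    then have "c \<le> \<mu> j" if "j \<in> {1..i}" for j
      using antimono[of j i] that by simp
    then have "{1..i} \<subseteq> ?S" by blast
    then show "i \<le> card ?S"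
      using card_mono[OF fin, of "{1..i}"] by simp
  next
    assume i: "i \<le> card ?S"
    show "c \<le> \<mu> i"
    proof (rule ccontr)
      assume i': "\<not> c \<le> \<mu> i"
      have "j < i" if "c \<le> \<mu> j" for j
        using i' that antimono[OF assms(3), of j] by (cases "i \<le> j") auto
      then have "?S \<subseteq> {1..<i}"
        using pos by auto
      then have "card ?S \<le> card {1..<i}" by (intro card_mono) auto
      then show False using i assms(3) by simp
    qed
  qed
qed

lemma partition_unique:
  assumes "is_partition \<mu>" "is_partition \<nu>" "same_content \<mu> \<nu>"
  shows "\<mu> = \<nu>"
proof
  fix i
  show "\<mu> i = \<nu> i"
  proof (cases "i = 0")
    case True
    then show ?thesis using assms(1,2) by (simp add: is_partition_def weak_composition_def)
  next
    case False
    then have "c \<le> \<mu> i \<longleftrightarrow> c \<le> \<nu> i" if "1 \<le> c" for c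
      using that assms(3) partition_le_iff[OF assms(1) that] partition_le_iff[OF assms(2) that]
      by (simp add: same_content_def)
    from this[of "\<mu> i"] this[of "\<nu> i"] show ?thesis by (cases "\<mu> i = 0"; cases "\<nu> i = 0") auto
  qed
qed

lemma inversions_partition: "is_partition \<mu> \<Longrightarrow> inversions \<mu> = {}"
  unfolding inversions_def is_partition_def
  by (auto simp del: One_nat_def) (meson leD less_imp_le)

lemma not_partition_ascent:
  assumes "weak_composition \<alpha>" "\<not> is_partition \<alpha>"
  obtains i where "1 \<le> i" "\<alpha> i < \<alpha> (Suc i)"
proof -
  have "\<exists>i\<ge>1. \<alpha> i < \<alpha> (Suc i)"
  proof (rule ccontr)
    assume "\<not> ?thesis"
    then have desc: "\<alpha> (Suc i) \<le> \<alpha> i" if "1 \<le> i" for i using that by (meson not_less)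
    have "\<alpha> j \<le> \<alpha> i" if "1 \<le> i" "i \<le> j" for i j
      using that(2)
    proof (induction j rule: dec_induct)
      case (step n)
      have "1 \<le> n" using step.hyps that(1) by linarith
      then show ?case using desc[of n] step.IH by linarith
    qed simp
    then have "is_partition \<alpha>" using assms(1) unfolding is_partition_def by blast
    then show False using assms(2) by blast
  qed
  then show ?thesis using that by blast
qed

lemma word_perm_simps: "word_perm [] = id" "word_perm (i # is) = simple_refl i \<circ> word_perm is"
  by (simp_all add: word_perm_def)

lemma bij_word_perm [simp]: "bij (word_perm is)"
  by (induction "is") (simp_all only: word_perm_simps bij_id bij_comp bij_simple_refl)

lemma perm_comp_word_perm_Nil [simp]: "perm_comp (word_perm []) \<alpha> = \<alpha>"
  by (simp add: perm_comp_def word_perm_simps)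

lemma perm_comp_word_perm_Cons [simp]:
  "perm_comp (word_perm (i # is)) \<alpha> = perm_comp (word_perm is) \<alpha> \<circ> simple_refl i"
proof -
  have "inv (word_perm (i # is)) = inv (word_perm is) \<circ> simple_refl i"
    using o_inv_distrib[of "simple_refl i" "word_perm is"] by (simp only: word_perm_simps bij_simple_refl bij_word_perm inv_simple_refl)
  then show ?thesis by (simp add: perm_comp_def fun_eq_iff)
qed

lemma pi_word_simps [simp]: "pi_word [] f = f" "pi_word (i # is) f = pi_op i (pi_word is f)"
  by (simp_all add: pi_word_def)

lemma perm_comp_word_perm_invariants:
  assumes "is \<in> lists {1..}" "weak_composition l"
  shows "weak_composition (perm_comp (word_perm is) l)" "same_content (perm_comp (word_perm is) l) l"
  using assms
  by (induction "is") (auto simp: weak_composition_swap same_content_swap, simp add: same_content_def)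

text \<open>
  The pairs of a composition and a polynomial that can be reached from \<open>l\<close> and \<open>f\<close> when every
  exchange of adjacent entries creates an inversion. For the minimal permutation sorting a composition, every
  reduced word is such a path, so these paths compute the operator of that permutation.
\<close>

inductive lascoux_path :: "(nat \<Rightarrow> nat) \<Rightarrow> ring_x \<Rightarrow> (nat \<Rightarrow> nat) \<Rightarrow> ring_x \<Rightarrow> bool" for l f where
  start: "lascoux_path l f l f"
| swap: "lascoux_path l f \<alpha> p \<Longrightarrow> 1 \<le> i \<Longrightarrow> \<alpha> (Suc i) < \<alpha> i \<Longrightarrow>
    lascoux_path l f (\<alpha> \<circ> simple_refl i) (pi_op i p)"

lemma lascoux_path_invariants:
  assumes "lascoux_path l f \<alpha> p" "weak_composition l"
  shows "weak_composition \<alpha>" "same_content \<alpha> l"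
  using assms
  by induction (auto simp: weak_composition_swap same_content_swap, simp add: same_content_def)

lemma sorting_word:
  assumes "weak_composition \<alpha>" "is_partition l" "same_content \<alpha> l"
  shows "\<exists>is\<in>lists {1..}. perm_comp (word_perm is) l = \<alpha> \<and> length is = card (inversions \<alpha>) \<and>
    lascoux_path l f \<alpha> (pi_word is f)"
  using assms
proof (induction "card (inversions \<alpha>)" arbitrary: \<alpha> rule: less_induct)
  case less
  show ?case
  proof (cases "is_partition \<alpha>")
    case True
    then have "\<alpha> = l" using partition_unique less.prems by blast
    then show ?thesis
      using inversions_partition[OF True] by (intro bexI[of _ "[]"]) (auto intro: start)
  next
    case False
    then obtain i where i: "1 \<le> i" "\<alpha> i < \<alpha> (Suc i)"
      using not_partition_ascent less.prems(1) by blast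
    let ?\<alpha> = "\<alpha> \<circ> simple_refl i"
    have wc: "weak_composition ?\<alpha>" by (rule weak_composition_swap[OF less.prems(1) i(1)])
    have restore: "?\<alpha> \<circ> simple_refl i = \<alpha>" by (simp add: comp_assoc)
    have desc: "?\<alpha> (Suc i) < ?\<alpha> i" using i by simp
    have card: "card (inversions \<alpha>) = Suc (card (inversions ?\<alpha>))"
      using card_inversions_swap(1)[OF wc i(1) desc] by (simp only: restore)
    then obtain js where js: "js \<in> lists {1..}" "perm_comp (word_perm js) l = ?\<alpha>"
        "length js = card (inversions ?\<alpha>)" "lascoux_path l f ?\<alpha> (pi_word js f)"
      using less.hyps[of ?\<alpha>] wc less.prems by (auto simp: same_content_swap)
    have "lascoux_path l f \<alpha> (pi_word (i # js) f)"
      using lascoux_path.swap[OF js(4) i(1) desc] unfolding restore by simp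
    then show ?thesis
      using i card restore js by (intro bexI[of _ "i # js"]) auto
  qed
qed

text \<open>
  Each letter creates at most one inversion. So a word of length equal to the final number of
  inversions creates one in every step.
\<close>

lemma minimal_word_lascoux_path:
  assumes "is \<in> lists {1..}" "is_partition l"
  shows "card (inversions (perm_comp (word_perm is) l)) \<le> length is \<and>
    (length is \<le> card (inversions (perm_comp (word_perm is) l)) \<longrightarrow>
      lascoux_path l f (perm_comp (word_perm is) l) (pi_word is f))"
  using assms(1)
proof (induction "is")
  case Nil
  then show ?case using inversions_partition[OF assms(2)] by (auto intro: start)
next
  case (Cons i js)
  then have i: "1 \<le> i" and js: "js \<in> lists {1..}" by auto
  let ?\<alpha> = "perm_comp (word_perm js) l"
  have wc: "weak_composition ?\<alpha>"
    using perm_comp_word_perm_invariants(1)[OF js] assms(2) by (simp add: is_partition_def)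
  consider "?\<alpha> (Suc i) < ?\<alpha> i" | "?\<alpha> i \<le> ?\<alpha> (Suc i)" by linarith
  then show ?case
  proof cases
    case 1
    then show ?thesis
      using card_inversions_swap(1)[OF wc i 1] Cons.IH lascoux_path.swap[OF _ i 1, of l f "pi_word js f"]
      by (simp only: perm_comp_word_perm_Cons pi_word_simps list.size add_Suc_right add_0_right Suc_le_mono) blast
  next
    case 2
    then show ?thesis
      using card_inversions_swap(2)[OF wc i 2] Cons.IH
      by (simp only: perm_comp_word_perm_Cons pi_word_simps list.size) linarith
  qed
qed

lemma LP_lascoux_path:
  assumes "weak_composition \<alpha>" "is_partition l" "same_content \<alpha> l"
  shows "lascoux_path l (\<Prod>(i, j)\<in>{(i, j)\<in>diagram l. i > j}. oplus beta (X i) (X j)) \<alpha> (LP \<alpha>)"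
proof -
  have wcl: "weak_composition l" using assms(2) by (simp add: is_partition_def)
  obtain js where js: "js \<in> lists {1..}" "perm_comp (word_perm js) l = \<alpha>" "length js = card (inversions \<alpha>)"
    using sorting_word[OF assms] by blast
  have sort: "sort_comp \<alpha> = l"
    unfolding sort_comp_def
  proof (rule the_equality)
    show "is_partition l \<and> (\<exists>w\<in>S_inf. \<alpha> = perm_comp w l)"
      using assms(2) js by (auto simp: S_inf_def)
    fix \<mu> assume \<mu>: "is_partition \<mu> \<and> (\<exists>w\<in>S_inf. \<alpha> = perm_comp w \<mu>)"
    then obtain ks where "ks \<in> lists {1..}" "\<alpha> = perm_comp (word_perm ks) \<mu>"
      by (auto simp: S_inf_def)
    then have "same_content \<alpha> \<mu>"
      using perm_comp_word_perm_invariants(2)[of ks \<mu>] \<mu> by (simp add: is_partition_def)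
    then have "same_content \<mu> l" using assms(3) by (simp add: same_content_def)
    then show "\<mu> = l" using partition_unique \<mu> assms(2) by blast
  qed
  let ?P = "\<lambda>u. u \<in> S_inf \<and> \<alpha> = perm_comp u l"
  have P: "?P (word_perm js)" using js by (auto simp: S_inf_def)
  define u where "u = min_perm \<alpha>"
  have "u = arg_min perm_length ?P"
    by (simp only: u_def min_perm_def sort)
  then have u: "?P u" and min: "\<And>w. ?P w \<Longrightarrow> perm_length u \<le> perm_length w"
    using arg_min_nat_lemma[of ?P "word_perm js" perm_length, OF P] by metis+
  have "\<exists>is. reduced_word is u"
  proof -
    obtain ks where "ks \<in> lists {1..}" "word_perm ks = u" using u by (auto simp: S_inf_def)
    then have "\<exists>k. \<exists>is\<in>lists {1..}. word_perm is = u \<and> length is = k" by blast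
    from LeastI_ex[OF this] show ?thesis
      by (auto simp: reduced_word_def perm_length_def)
  qed
  define rw where "rw = (SOME is. reduced_word is u)"
  have "reduced_word rw u"
    unfolding rw_def using \<open>\<exists>is. reduced_word is u\<close> by (rule someI_ex)
  then have rw: "rw \<in> lists {1..}" "word_perm rw = u" "length rw = perm_length u"
    by (auto simp: reduced_word_def)
  have "perm_length (word_perm js) \<le> length js"
    unfolding perm_length_def using js(1) by (intro Least_le) auto
  then have "length rw \<le> card (inversions (perm_comp (word_perm rw) l))"
    using min[OF P] js(3) rw u by simp
  then have "lascoux_path l f (perm_comp (word_perm rw) l) (pi_word rw f)" for f
    using minimal_word_lascoux_path[OF rw(1) assms(2)] by blast
  then have "lascoux_path l f \<alpha> (pi_word rw f)" for f
    using u rw(2) by simp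
  then show ?thesis
    unfolding LP_def pi_perm_def sort u_def[symmetric] rw_def[symmetric] .
qed

lemma lascoux_path_cases_ascent:
  assumes "lascoux_path l f \<alpha> p" "is_partition l" "\<not> is_partition \<alpha>"
  obtains i q where "1 \<le> i" "\<alpha> i < \<alpha> (Suc i)" "p = pi_op i q" "lascoux_path l f (\<alpha> \<circ> simple_refl i) q"
  using assms(1)
proof cases
  case start
  then show ?thesis using assms by simp
next
  case (swap \<beta> q i)
  then show ?thesis using that[of i q] by (simp add: comp_assoc)
qed

lemma lascoux_path_exists:
  assumes "weak_composition \<alpha>" "is_partition l" "same_content \<alpha> l"
  obtains p where "lascoux_path l f \<alpha> p"
  using sorting_word[OF assms] by blast

lemma lascoux_path_swap':
  assumes "lascoux_path l f \<alpha> p" "1 \<le> i" "\<alpha> (Suc i) < \<alpha> i" "\<beta> = \<alpha> \<circ> simple_refl i"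
  shows "lascoux_path l f \<beta> (pi_op i p)"
  using assms lascoux_path.swap by blast

text \<open>
  Confluence, by induction on the number of inversions. If the last steps of two paths to \<open>\<alpha>\<close> are at
  different places, both can be replaced by paths through a common composition, since the
  operators satisfy the commutation and braid relations.
\<close>

lemma lascoux_path_unique:
  assumes "is_partition l" "lascoux_path l f \<alpha> p" "lascoux_path l f \<alpha> q"
  shows "p = q"
  using assms(2,3)
proof (induction "card (inversions \<alpha>)" arbitrary: \<alpha> p q rule: less_induct)
  case less
  have wcl: "weak_composition l" using assms(1) by (simp add: is_partition_def)
  have wc: "weak_composition \<alpha>" and sc: "same_content \<alpha> l"
    using lascoux_path_invariants[OF less.prems(1) wcl] by auto
  have wcs: "weak_composition (\<beta> \<circ> simple_refl i)" if "weak_composition \<beta>" "1 \<le> i" for \<beta> i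
    using weak_composition_swap that by blast
  have IH: "p' = q'" if "lascoux_path l f (\<alpha> \<circ> simple_refl i) p'" "lascoux_path l f (\<alpha> \<circ> simple_refl i) q'"
    "1 \<le> i" "\<alpha> i < \<alpha> (Suc i)" for i p' q'
  proof (rule less.hyps[OF _ that(1,2)])
    have "card (inversions (\<alpha> \<circ> simple_refl i \<circ> simple_refl i)) = Suc (card (inversions (\<alpha> \<circ> simple_refl i)))"
      using that by (intro card_inversions_swap(1) wcs wc) auto
    then show "card (inversions (\<alpha> \<circ> simple_refl i)) < card (inversions \<alpha>)"
      by (simp add: comp_assoc)
  qed
  show ?case
  proof (cases "is_partition \<alpha>")
    case True
    have *: "r = f" if "lascoux_path l f \<alpha> r" for r
      using that
    proof cases
      case (swap \<beta> r' i)
      then have "\<alpha> i < \<alpha> (Suc i)" by simp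
      moreover have "\<alpha> (Suc i) \<le> \<alpha> i" using True \<open>1 \<le> i\<close> by (simp add: is_partition_def)
      ultimately show ?thesis by simp
    qed simp
    show ?thesis using *[OF less.prems(1)] *[OF less.prems(2)] by simp
  next
    case False
    obtain i p' where i: "1 \<le> i" "\<alpha> i < \<alpha> (Suc i)" "p = pi_op i p'" "lascoux_path l f (\<alpha> \<circ> simple_refl i) p'"
      using lascoux_path_cases_ascent[OF less.prems(1) assms(1) False] by blast
    obtain j q' where j: "1 \<le> j" "\<alpha> j < \<alpha> (Suc j)" "q = pi_op j q'" "lascoux_path l f (\<alpha> \<circ> simple_refl j) q'"
      using lascoux_path_cases_ascent[OF less.prems(2) assms(1) False] by blast
    have far: "pi_op i p' = pi_op j q'" if "Suc i < j" "1 \<le> i" "\<alpha> i < \<alpha> (Suc i)" "1 \<le> j" "\<alpha> j < \<alpha> (Suc j)"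
      and p': "lascoux_path l f (\<alpha> \<circ> simple_refl i) p'" and q': "lascoux_path l f (\<alpha> \<circ> simple_refl j) q'"
    for i j p' q'
    proof -
      let ?\<gamma> = "\<alpha> \<circ> simple_refl i \<circ> simple_refl j"
      have "weak_composition ?\<gamma>" by (intro wcs wc \<open>1 \<le> i\<close> \<open>1 \<le> j\<close>)
      then obtain r where r: "lascoux_path l f ?\<gamma> r"
        using lascoux_path_exists[of ?\<gamma> l f] sc assms(1) by (auto simp: same_content_swap)
      have "lascoux_path l f (\<alpha> \<circ> simple_refl i) (pi_op j r)"
        using r that by (intro lascoux_path_swap'[OF r]) (auto simp: comp_assoc)
      moreover have "lascoux_path l f (\<alpha> \<circ> simple_refl j) (pi_op i r)"
      proof (rule lascoux_path_swap'[OF r that(2)])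
        show "?\<gamma> (Suc i) < ?\<gamma> i" using that by auto
        show "\<alpha> \<circ> simple_refl j = ?\<gamma> \<circ> simple_refl i"
          using simple_refl_commute[OF that(1)]
          by (metis comp_assoc comp_id simple_refl_comp_self)
      qed
      ultimately show ?thesis
        using IH p' q' that pi_op_commute[OF that(1), of r] by metis
    qed
    have near: "pi_op i p' = pi_op (Suc i) q'" if "1 \<le> i" "\<alpha> i < \<alpha> (Suc i)" "\<alpha> (Suc i) < \<alpha> (Suc (Suc i))"
      and p': "lascoux_path l f (\<alpha> \<circ> simple_refl i) p'" and q': "lascoux_path l f (\<alpha> \<circ> simple_refl (Suc i)) q'"
    for i p' q'
    proof -
      let ?s = "simple_refl i" and ?t = "simple_refl (Suc i)"
      let ?\<gamma> = "\<alpha> \<circ> ?s \<circ> ?t \<circ> ?s"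
      have braid: "?\<gamma> = \<alpha> \<circ> ?t \<circ> ?s \<circ> ?t"
        using simple_refl_braid[of i] by (metis comp_assoc)
      have "weak_composition ?\<gamma>" using \<open>1 \<le> i\<close> by (intro wcs wc) auto
      then obtain r where r: "lascoux_path l f ?\<gamma> r"
        using lascoux_path_exists[of ?\<gamma> l f] sc assms(1) by (auto simp: same_content_swap)
      have 1: "lascoux_path l f (\<alpha> \<circ> ?s \<circ> ?t) (pi_op i r)"
        using that by (intro lascoux_path_swap'[OF r]) (auto simp: comp_assoc)
      have 2: "lascoux_path l f (\<alpha> \<circ> ?s) (pi_op (Suc i) (pi_op i r))"
        using that by (intro lascoux_path_swap'[OF 1]) (auto simp: comp_assoc)
      have 3: "lascoux_path l f (\<alpha> \<circ> ?t \<circ> ?s) (pi_op (Suc i) r)"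
      proof (rule lascoux_path_swap'[OF r])
        show "\<alpha> \<circ> ?t \<circ> ?s = ?\<gamma> \<circ> ?t" unfolding braid by (simp add: comp_assoc)
      qed (use that in auto)
      have 4: "lascoux_path l f (\<alpha> \<circ> ?t) (pi_op i (pi_op (Suc i) r))"
        using that by (intro lascoux_path_swap'[OF 3]) (auto simp: comp_assoc)
      show ?thesis
        using IH[OF p' 2] IH[OF q' 4] that pi_op_braid[of i r] by simp
    qed
    consider "i = j" | "Suc i < j" | "Suc j < i" | "j = Suc i" | "i = Suc j" by linarith
    then show ?thesis
    proof cases
      case 1
      then show ?thesis using IH i j by blast
    next
      case 2
      then show ?thesis using far[of i j p' q'] i j by simp
    next
      case 3
      then show ?thesis using far[of j i q' p'] i j by simp
    next
      case 4
      then show ?thesis using near[of i p' q'] i j by simp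
    next
      case 5
      then show ?thesis using near[of j q' p'] i j by simp
    qed
  qed
qed

text \<open>
  Induction on the number of inversions. Let the last step be at \<open>i\<close>. If \<open>i\<close> is adjacent to \<open>k\<close>, the three
  entries involved are \<open>a, a, c\<close> or \<open>a, c, c\<close> with \<open>a < c\<close>. Going back two steps leads to a polynomial \<open>r\<close>
  for \<open>c, a, a\<close> or \<open>c, c, a\<close> with \<open>p = \<pi>\<^sub>i \<pi>\<^sub>k r\<close>, and \<open>r\<close> is fixed by \<open>\<pi>\<^sub>i\<close> by induction. Then
  \<open>\<pi>\<^sub>k p = \<pi>\<^sub>k \<pi>\<^sub>i \<pi>\<^sub>k r = \<pi>\<^sub>i \<pi>\<^sub>k \<pi>\<^sub>i r = p\<close>.
\<close>

lemma lascoux_path_fixed: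
  assumes "is_partition l" and fixed: "\<And>i. 1 \<le> i \<Longrightarrow> l i = l (Suc i) \<Longrightarrow> pi_op i f = f"
    and "lascoux_path l f \<alpha> p" "1 \<le> k" "\<alpha> k = \<alpha> (Suc k)"
  shows "pi_op k p = p"
  using assms(3-)
proof (induction "card (inversions \<alpha>)" arbitrary: \<alpha> p k rule: less_induct)
  case less
  have wcl: "weak_composition l" using assms(1) by (simp add: is_partition_def)
  have wc: "weak_composition \<alpha>" and sc: "same_content \<alpha> l"
    using lascoux_path_invariants[OF less.prems(1) wcl] by auto
  have wcs: "weak_composition (\<beta> \<circ> simple_refl i)" if "weak_composition \<beta>" "1 \<le> i" for \<beta> i
    using weak_composition_swap that by blast
  have up: "card (inversions \<beta>) = Suc (card (inversions (\<beta> \<circ> simple_refl i)))"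
    if "1 \<le> i" "\<beta> i < \<beta> (Suc i)" "weak_composition \<beta>" for \<beta> i
  proof -
    have "card (inversions (\<beta> \<circ> simple_refl i \<circ> simple_refl i)) = Suc (card (inversions (\<beta> \<circ> simple_refl i)))"
      using that by (intro card_inversions_swap(1) wcs) auto
    then show ?thesis by (simp add: comp_assoc)
  qed
  from less.prems(1) show ?case
  proof cases
    case start
    then show ?thesis using fixed less.prems by simp
  next
    case (swap \<beta> q i)
    have \<beta>: "\<beta> = \<alpha> \<circ> simple_refl i" using swap(1) by (simp add: comp_assoc)
    have asc: "\<alpha> i < \<alpha> (Suc i)" using swap by simp
    have "i \<noteq> k" using asc less.prems by auto
    then consider "Suc i < k" | "Suc k < i" | "i = Suc k" | "k = Suc i" by linarith
    then show ?thesis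
    proof cases
      case 1
      then have "pi_op k q = q"
        using less.prems(2,3) up[OF swap(4) asc wc] by (intro less.hyps[OF _ swap(3)]) (simp_all add: \<beta>)
      then show ?thesis
        using pi_op_commute[OF 1, of q] swap(2) by simp
    next
      case 2
      then have "pi_op k q = q"
        using less.prems(2,3) up[OF swap(4) asc wc] by (intro less.hyps[OF _ swap(3)]) (simp_all add: \<beta>)
      then show ?thesis
        using pi_op_commute[OF 2, of q] swap(2) by simp
    next
      case 3
      let ?s = "simple_refl k"
      let ?\<gamma> = "\<beta> \<circ> ?s"
      have "weak_composition ?\<gamma>" using wc swap(4) less.prems by (simp add: \<beta> wcs)
      then obtain r where r: "lascoux_path l f ?\<gamma> r"
        using lascoux_path_exists[of ?\<gamma> l f] sc assms(1) by (auto simp: same_content_swap \<beta>)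
      have "lascoux_path l f \<beta> (pi_op k r)"
        using less.prems asc 3 by (intro lascoux_path_swap'[OF r]) (auto simp: comp_assoc \<beta>)
      then have q: "q = pi_op k r" using lascoux_path_unique[OF assms(1)] swap(3) by blast
      have "\<beta> k < \<beta> (Suc k)" using less.prems asc 3 by (simp add: \<beta>)
      then have "card (inversions ?\<gamma>) < card (inversions \<alpha>)"
        using up[OF swap(4) asc wc] up[OF less.prems(2), of \<beta>] wc swap(4) by (simp add: \<beta> wcs)
      then have "pi_op i r = r"
        using less.prems asc 3 swap(4) by (intro less.hyps[OF _ r]) (auto simp: \<beta>)
      then show ?thesis
        using pi_op_braid[of k r] 3 swap(2) q by simp
    next
      case 4
      let ?s = "simple_refl k"
      let ?\<gamma> = "\<beta> \<circ> ?s"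
      have "weak_composition ?\<gamma>" using wc swap(4) less.prems by (simp add: \<beta> wcs)
      then obtain r where r: "lascoux_path l f ?\<gamma> r"
        using lascoux_path_exists[of ?\<gamma> l f] sc assms(1) by (auto simp: same_content_swap \<beta>)
      have "lascoux_path l f \<beta> (pi_op k r)"
        using less.prems asc 4 by (intro lascoux_path_swap'[OF r]) (auto simp: comp_assoc \<beta>)
      then have q: "q = pi_op k r" using lascoux_path_unique[OF assms(1)] swap(3) by blast
      have "\<beta> k < \<beta> (Suc k)" using less.prems asc 4 by (simp add: \<beta>)
      then have "card (inversions ?\<gamma>) < card (inversions \<alpha>)"
        using up[OF swap(4) asc wc] up[OF less.prems(2), of \<beta>] wc swap(4) by (simp add: \<beta> wcs)
      then have "pi_op i r = r"
        using less.prems asc 4 swap(4) by (intro less.hyps[OF _ r]) (auto simp: \<beta>)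
      then show ?thesis
        using pi_op_braid[of i r] 4 swap(2) q by simp
    qed
  qed
qed

lemma lascoux_path_weak_swap:
  assumes "is_partition l" and "\<And>i. 1 \<le> i \<Longrightarrow> l i = l (Suc i) \<Longrightarrow> pi_op i f = f"
    and "lascoux_path l f \<alpha> p" "1 \<le> i" "\<alpha> (Suc i) \<le> \<alpha> i"
  shows "lascoux_path l f (\<alpha> \<circ> simple_refl i) (pi_op i p)"
proof (cases "\<alpha> (Suc i) = \<alpha> i")
  case True
  then have "\<alpha> \<circ> simple_refl i = \<alpha>"
    by (auto simp: fun_eq_iff simple_refl_def transpose_def)
  then show ?thesis
    using lascoux_path_fixed[OF assms(1,2,3,4)] True assms(3) by simp
next
  case False
  then show ?thesis using assms by (intro lascoux_path.swap) auto
qed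

section \<open>Carrying an entry across a segment\<close>

text \<open>
  One operator applied to a sum over a segment of variables extends the segment by one variable. The
  hypothesis on \<open>K\<close> is satisfied both by the weight and by the weight with exchanged arguments,
  corresponding to the two directions in which a segment can grow.
\<close>

lemma pi_weight_sum_insert:
  fixes K :: "real \<Rightarrow> real \<Rightarrow> real"
  assumes "finite B" "u \<notin> B" "w \<notin> B" "u \<noteq> w"
    and K: "\<And>y. y \<in> B \<Longrightarrow> K u w * K y u + K w u * K y w = K y u * K y w"
  shows "K u w * (\<Sum>y\<in>insert u B. H y * (\<Prod>z\<in>insert u B - {y}. K y z)) +
      K w u * (\<Sum>y\<in>insert w B. H y * (\<Prod>z\<in>insert w B - {y}. K y z)) =
    (\<Sum>y\<in>insert w (insert u B). H y * (\<Prod>z\<in>insert w (insert u B) - {y}. K y z))"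
proof -
  have ins: "(\<Prod>z\<in>insert a C - {y}. K y z) = K y a * (\<Prod>z\<in>C - {y}. K y z)"
    if "finite C" "a \<notin> C" "y \<noteq> a" for a C y
  proof -
    have "insert a C - {y} = insert a (C - {y})" using that by auto
    then show ?thesis using that by simp
  qed
  have one: "(\<Sum>y\<in>insert a B. H y * (\<Prod>z\<in>insert a B - {y}. K y z)) =
      H a * (\<Prod>z\<in>B. K a z) + (\<Sum>y\<in>B. H y * (K y a * (\<Prod>z\<in>B - {y}. K y z)))" if "a \<notin> B" for a
  proof -
    have "(\<Sum>y\<in>B. H y * (\<Prod>z\<in>insert a B - {y}. K y z)) =
        (\<Sum>y\<in>B. H y * (K y a * (\<Prod>z\<in>B - {y}. K y z)))"
    proof (rule sum.cong[OF refl])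
      fix y assume "y \<in> B"
      then have "y \<noteq> a" using that by auto
      then show "H y * (\<Prod>z\<in>insert a B - {y}. K y z) = H y * (K y a * (\<Prod>z\<in>B - {y}. K y z))"
        using ins[OF assms(1) that] by simp
    qed
    then show ?thesis using that assms(1) by simp
  qed
  have "(\<Sum>y\<in>insert w (insert u B). H y * (\<Prod>z\<in>insert w (insert u B) - {y}. K y z)) =
      H w * (K w u * (\<Prod>z\<in>B. K w z)) + H u * (K u w * (\<Prod>z\<in>B. K u z)) +
      (\<Sum>y\<in>B. H y * (K y w * (K y u * (\<Prod>z\<in>B - {y}. K y z))))"
  proof -
    have "(\<Prod>z\<in>insert w (insert u B) - {y}. K y z) = K y w * (K y u * (\<Prod>z\<in>B - {y}. K y z))"
      if "y \<in> B" for y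
    proof -
      have "y \<noteq> u" "y \<noteq> w" using that assms(2,3) by auto
      then show ?thesis using ins[of "insert u B" w y] ins[of B u y] assms(1-4) by simp
    qed
    then have "(\<Sum>y\<in>B. H y * (\<Prod>z\<in>insert w (insert u B) - {y}. K y z)) =
        (\<Sum>y\<in>B. H y * (K y w * (K y u * (\<Prod>z\<in>B - {y}. K y z))))"
      by (intro sum.cong refl) (simp only:)
    moreover have "(\<Prod>z\<in>insert w (insert u B) - {u}. K u z) = K u w * (\<Prod>z\<in>B. K u z)"
      using assms(1-4) ins[of "insert u B" w u] by auto
    moreover have "(\<Prod>z\<in>insert w (insert u B) - {w}. K w z) = K w u * (\<Prod>z\<in>B. K w z)"
      using assms(1-4) by simp
    ultimately show ?thesis using assms(1-4) by simp
  qed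
  moreover have "(\<Sum>y\<in>B. H y * (K y w * (K y u * (\<Prod>z\<in>B - {y}. K y z)))) =
      K u w * (\<Sum>y\<in>B. H y * (K y u * (\<Prod>z\<in>B - {y}. K y z))) +
      K w u * (\<Sum>y\<in>B. H y * (K y w * (\<Prod>z\<in>B - {y}. K y z)))"
  proof -
    have "H y * (K y w * (K y u * P)) = K u w * (H y * (K y u * P)) + K w u * (H y * (K y w * P))"
      if "y \<in> B" for y P
    proof -
      have "H y * (K y w * (K y u * P)) = H y * P * (K y u * K y w)" by simp
      also have "\<dots> = H y * P * (K u w * K y u + K w u * K y w)" using K[OF that] by simp
      finally show ?thesis by (simp add: algebra_simps)
    qed
    then show ?thesis by (simp add: sum_distrib_left flip: sum.distrib)
  qed
  ultimately show ?thesis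
    using one[OF assms(2)] one[OF assms(3)] by (simp add: algebra_simps)
qed

definition generic :: "nat \<Rightarrow> (nat \<Rightarrow> real) \<Rightarrow> bool" where
  "generic n v \<longleftrightarrow> inj_on v {1..n} \<and> (\<forall>i\<in>{1..n}. 0 < v i)"

lemma simple_refl_image:
  assumes "k \<le> i" "i < m"
  shows "simple_refl i ` {k..m} = {k..m}"
proof -
  have sub: "simple_refl i ` {k..m} \<subseteq> {k..m}"
    using assms by (auto simp: simple_refl_if)
  then have "simple_refl i ` simple_refl i ` {k..m} \<subseteq> simple_refl i ` {k..m}"
    by (rule image_mono)
  then show ?thesis using sub by (simp add: image_image)
qed

lemma generic_swap:
  assumes "generic n v" "1 \<le> i" "i < n"
  shows "generic n (v \<circ> simple_refl i)"
proof -
  have im: "simple_refl i ` {1..n} = {1..n}" by (rule simple_refl_image[OF assms(2,3)])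
  then have "inj_on (v \<circ> simple_refl i) {1..n}"
    using assms(1) by (intro comp_inj_on inj_on_subset[OF inj_simple_refl]) (auto simp: generic_def)
  moreover have "0 < v (simple_refl i k)" if "k \<in> {1..n}" for k
    using assms(1) im that unfolding generic_def by blast
  ultimately show ?thesis by (simp add: generic_def)
qed

lemma generic_neq:
  assumes "generic n v" "1 \<le> i" "i < n"
  shows "v i \<noteq> v (Suc i)"
proof
  assume "v i = v (Suc i)"
  then have "i = Suc i"
    using assms by (intro inj_onD[of v "{1..n}"]) (auto simp: generic_def)
  then show False by simp
qed

lemma generic_notin_image:
  assumes "generic n v" "A \<subseteq> {1..n}" "i \<in> {1..n}" "i \<notin> A"
  shows "v i \<notin> v ` A"
proof
  assume "v i \<in> v ` A"
  then obtain j where "j \<in> A" "v i = v j" by blast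
  then have "i = j" using assms by (intro inj_onD[of v "{1..n}"]) (auto simp: generic_def)
  then show False using \<open>j \<in> A\<close> assms(4) by simp
qed

text \<open>
  If a polynomial distinguishes one variable of a segment and is symmetric in the others, then
  successive operators replace the distinguished variable by each variable in turn. The factor \<open>C\<close>,
  symmetric in the segment, is carried along. In the mirror image \<open>eval_pi_word_down\<close> the distinguished
  variable is the last one.
\<close>

lemma eval_pi_word_up:
  assumes "1 \<le> k" "M \<le> n" "k \<le> t" "t \<le> M"
    and C: "\<And>v i. generic n v \<Longrightarrow> k \<le> i \<Longrightarrow> i < M \<Longrightarrow> C (v \<circ> simple_refl i) = C v"
    and p: "\<And>v. generic n v \<Longrightarrow> evaluate b v p = C v * H (v ` {k..M}) (v k)"
    and v: "generic n v"
  shows "evaluate b v (pi_word (rev [k..<t]) p) =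
    C v * (\<Sum>y\<in>v ` {k..t}. H (v ` {k..M}) y * (\<Prod>z\<in>v ` {k..t} - {y}. pi_weight b y z))"
  using assms(3,4) v
proof (induction t arbitrary: v rule: dec_induct)
  case base
  then show ?case using p by simp
next
  case (step t)
  let ?s = "simple_refl t"
  have t: "1 \<le> t" "t < n" "t < M" using step.hyps step.prems(1) assms(1,2) by auto
  let ?A = "v ` {k..M}" and ?B = "v ` {k..<t}" and ?u = "v t" and ?w = "v (Suc t)"
  have gs: "generic n (v \<circ> ?s)" by (rule generic_swap[OF step.prems(2) t(1,2)])
  have ne: "?u \<noteq> ?w" by (rule generic_neq[OF step.prems(2) t(1,2)])
  have A: "(v \<circ> ?s) ` {k..M} = ?A"
    unfolding image_comp[symmetric] simple_refl_image[OF step.hyps(1) t(3)] ..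
  have B: "(v \<circ> ?s) ` {k..t} = insert ?w ?B"
  proof -
    have "{k..t} = insert t {k..<t}" using step.hyps by auto
    moreover have "(v \<circ> ?s) ` {k..<t} = v ` {k..<t}" by (rule image_cong) auto
    ultimately show ?thesis by simp
  qed
  have B': "v ` {k..t} = insert ?u ?B"
  proof -
    have "{k..t} = insert t {k..<t}" using step.hyps by auto
    then show ?thesis by simp
  qed
  have B'': "v ` {k..Suc t} = insert ?w (insert ?u ?B)"
  proof -
    have "{k..Suc t} = insert (Suc t) (insert t {k..<t})" using step.hyps by auto
    then show ?thesis by simp
  qed
  have notin: "?u \<notin> ?B" "?w \<notin> ?B"
    using t assms(1) by (intro generic_notin_image[OF step.prems(2)]; auto)+
  have "evaluate b v (pi_word (rev [k..<Suc t]) p) =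
      pi_weight b ?u ?w * evaluate b v (pi_word (rev [k..<t]) p) +
      pi_weight b ?w ?u * evaluate b (v \<circ> ?s) (pi_word (rev [k..<t]) p)"
    using step.hyps by (simp add: eval_pi_op[OF ne])
  also have "evaluate b v (pi_word (rev [k..<t]) p) =
      C v * (\<Sum>y\<in>insert ?u ?B. H ?A y * (\<Prod>z\<in>insert ?u ?B - {y}. pi_weight b y z))"
    using step.IH[OF _ step.prems(2)] t(3) by (simp only: B' less_imp_le)
  also have "evaluate b (v \<circ> ?s) (pi_word (rev [k..<t]) p) =
      C v * (\<Sum>y\<in>insert ?w ?B. H ?A y * (\<Prod>z\<in>insert ?w ?B - {y}. pi_weight b y z))"
    using step.IH[OF _ gs] t(3) C[OF step.prems(2) step.hyps(1) t(3)] by (simp only: A B less_imp_le)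
  also have "pi_weight b ?u ?w * (C v * (\<Sum>y\<in>insert ?u ?B. H ?A y * (\<Prod>z\<in>insert ?u ?B - {y}. pi_weight b y z))) +
      pi_weight b ?w ?u * (C v * (\<Sum>y\<in>insert ?w ?B. H ?A y * (\<Prod>z\<in>insert ?w ?B - {y}. pi_weight b y z))) =
      C v * (pi_weight b ?u ?w * (\<Sum>y\<in>insert ?u ?B. H ?A y * (\<Prod>z\<in>insert ?u ?B - {y}. pi_weight b y z)) +
      pi_weight b ?w ?u * (\<Sum>y\<in>insert ?w ?B. H ?A y * (\<Prod>z\<in>insert ?w ?B - {y}. pi_weight b y z)))"
    by (simp only: distrib_left mult.left_commute)
  also have "pi_weight b ?u ?w * (\<Sum>y\<in>insert ?u ?B. H ?A y * (\<Prod>z\<in>insert ?u ?B - {y}. pi_weight b y z)) +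
      pi_weight b ?w ?u * (\<Sum>y\<in>insert ?w ?B. H ?A y * (\<Prod>z\<in>insert ?w ?B - {y}. pi_weight b y z)) =
      (\<Sum>y\<in>insert ?w (insert ?u ?B). H ?A y * (\<Prod>z\<in>insert ?w (insert ?u ?B) - {y}. pi_weight b y z))"
  proof (rule pi_weight_sum_insert)
    show "pi_weight b ?u ?w * pi_weight b y ?u + pi_weight b ?w ?u * pi_weight b y ?w = pi_weight b y ?u * pi_weight b y ?w"
      if "y \<in> ?B" for y
      using that notin ne by (intro pi_weight_transfer_left) auto
  qed (use notin ne in auto)
  finally show ?case by (simp only: B'')
qed

lemma eval_pi_word_down:
  assumes "1 \<le> k" "M \<le> n" "k \<le> t" "t \<le> M"
    and C: "\<And>v i. generic n v \<Longrightarrow> k \<le> i \<Longrightarrow> i < M \<Longrightarrow> C (v \<circ> simple_refl i) = C v"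
    and p: "\<And>v. generic n v \<Longrightarrow> evaluate b v p = C v * H (v ` {k..M}) (v M)"
    and v: "generic n v"
  shows "evaluate b v (pi_word [t..<M] p) =
    C v * (\<Sum>y\<in>v ` {t..M}. H (v ` {k..M}) y * (\<Prod>z\<in>v ` {t..M} - {y}. pi_weight b z y))"
  using assms(4,3) v
proof (induction t arbitrary: v rule: inc_induct)
  case base
  then show ?case using p by simp
next
  case (step t)
  let ?s = "simple_refl t"
  have t: "1 \<le> t" "t < n" "t < M" using step.hyps step.prems(1) assms(1,2) by auto
  let ?A = "v ` {k..M}" and ?B = "v ` {Suc (Suc t)..M}" and ?u = "v t" and ?w = "v (Suc t)"
  have gs: "generic n (v \<circ> ?s)" by (rule generic_swap[OF step.prems(2) t(1,2)])
  have ne: "?u \<noteq> ?w" by (rule generic_neq[OF step.prems(2) t(1,2)])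
  have A: "(v \<circ> ?s) ` {k..M} = ?A"
    unfolding image_comp[symmetric] simple_refl_image[OF step.prems(1) t(3)] ..
  have B: "(v \<circ> ?s) ` {Suc t..M} = insert ?u ?B"
  proof -
    have "{Suc t..M} = insert (Suc t) {Suc (Suc t)..M}" using t by auto
    moreover have "(v \<circ> ?s) ` {Suc (Suc t)..M} = v ` {Suc (Suc t)..M}" by (rule image_cong) auto
    ultimately show ?thesis by simp
  qed
  have B': "v ` {Suc t..M} = insert ?w ?B"
  proof -
    have "{Suc t..M} = insert (Suc t) {Suc (Suc t)..M}" using t by auto
    then show ?thesis by simp
  qed
  have B'': "v ` {t..M} = insert ?w (insert ?u ?B)"
  proof -
    have "{t..M} = insert (Suc t) (insert t {Suc (Suc t)..M})" using t by auto
    then show ?thesis by simp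
  qed
  have notin: "?u \<notin> ?B" "?w \<notin> ?B"
    using t assms(1,2) by (intro generic_notin_image[OF step.prems(2)]; auto)+
  have k: "k \<le> Suc t" using step.prems by simp
  have "evaluate b v (pi_word [t..<M] p) =
      pi_weight b ?u ?w * evaluate b v (pi_word [Suc t..<M] p) +
      pi_weight b ?w ?u * evaluate b (v \<circ> ?s) (pi_word [Suc t..<M] p)"
    using t by (simp add: eval_pi_op[OF ne] upt_conv_Cons)
  also have "evaluate b v (pi_word [Suc t..<M] p) =
      C v * (\<Sum>y\<in>insert ?w ?B. H ?A y * (\<Prod>z\<in>insert ?w ?B - {y}. pi_weight b z y))"
    using step.IH[OF k step.prems(2)] by (simp only: B')
  also have "evaluate b (v \<circ> ?s) (pi_word [Suc t..<M] p) =
      C v * (\<Sum>y\<in>insert ?u ?B. H ?A y * (\<Prod>z\<in>insert ?u ?B - {y}. pi_weight b z y))"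
    using step.IH[OF k gs] C[OF step.prems(2,1) t(3)] by (simp only: A B)
  also have "pi_weight b ?u ?w * (C v * (\<Sum>y\<in>insert ?w ?B. H ?A y * (\<Prod>z\<in>insert ?w ?B - {y}. pi_weight b z y))) +
      pi_weight b ?w ?u * (C v * (\<Sum>y\<in>insert ?u ?B. H ?A y * (\<Prod>z\<in>insert ?u ?B - {y}. pi_weight b z y))) =
      C v * (pi_weight b ?w ?u * (\<Sum>y\<in>insert ?u ?B. H ?A y * (\<Prod>z\<in>insert ?u ?B - {y}. pi_weight b z y)) +
      pi_weight b ?u ?w * (\<Sum>y\<in>insert ?w ?B. H ?A y * (\<Prod>z\<in>insert ?w ?B - {y}. pi_weight b z y)))"
    by (simp only: distrib_left mult.left_commute add.commute)
  also have "pi_weight b ?w ?u * (\<Sum>y\<in>insert ?u ?B. H ?A y * (\<Prod>z\<in>insert ?u ?B - {y}. pi_weight b z y)) +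
      pi_weight b ?u ?w * (\<Sum>y\<in>insert ?w ?B. H ?A y * (\<Prod>z\<in>insert ?w ?B - {y}. pi_weight b z y)) =
      (\<Sum>y\<in>insert ?w (insert ?u ?B). H ?A y * (\<Prod>z\<in>insert ?w (insert ?u ?B) - {y}. pi_weight b z y))"
  proof (rule pi_weight_sum_insert[where K = "\<lambda>y z. pi_weight b z y"])
    show "pi_weight b ?w ?u * pi_weight b ?u y + pi_weight b ?u ?w * pi_weight b ?w y = pi_weight b ?u y * pi_weight b ?w y"
      if "y \<in> ?B" for y
      using that notin ne pi_weight_transfer_right[of ?w ?u y b] by (auto simp: mult.commute)
  qed (use notin ne in auto)
  finally show ?case by (simp only: B'')
qed

text \<open>
  The operators of \<open>eval_pi_word_up\<close> carry the entry at \<open>k\<close> to the place \<open>t\<close>, past entries that are not larger;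
  those of \<open>eval_pi_word_down\<close> carry the entry at \<open>M\<close> to the place \<open>t\<close>, past entries that are not smaller.
\<close>

lemma lascoux_path_up:
  assumes "is_partition l" and fixed: "\<And>i. 1 \<le> i \<Longrightarrow> l i = l (Suc i) \<Longrightarrow> pi_op i f = f"
    and path: "lascoux_path l f \<alpha> p" and "1 \<le> k" "k \<le> t" and le: "\<And>j. k < j \<Longrightarrow> j \<le> t \<Longrightarrow> \<alpha> j \<le> \<alpha> k"
  shows "lascoux_path l f (\<lambda>i. if k \<le> i \<and> i < t then \<alpha> (Suc i) else if i = t then \<alpha> k else \<alpha> i)
    (pi_word (rev [k..<t]) p)"
  using assms(5) le
proof (induction t rule: dec_induct)
  case base
  have "(\<lambda>i. if k \<le> i \<and> i < k then \<alpha> (Suc i) else if i = k then \<alpha> k else \<alpha> i) = \<alpha>"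
    by (auto simp: fun_eq_iff)
  then show ?case using path by simp
next
  case (step t)
  let ?\<beta> = "\<lambda>t i. if k \<le> i \<and> i < t then \<alpha> (Suc i) else if i = t then \<alpha> k else \<alpha> i"
  have "lascoux_path l f (?\<beta> t \<circ> simple_refl t) (pi_op t (pi_word (rev [k..<t]) p))"
    using step assms(4) by (intro lascoux_path_weak_swap[OF assms(1) fixed]) auto
  moreover have "?\<beta> t \<circ> simple_refl t = ?\<beta> (Suc t)"
    using step.hyps by (auto simp: fun_eq_iff simple_refl_if)
  ultimately show ?case using step.hyps by simp
qed

lemma lascoux_path_down:
  assumes "is_partition l" and fixed: "\<And>i. 1 \<le> i \<Longrightarrow> l i = l (Suc i) \<Longrightarrow> pi_op i f = f"
    and path: "lascoux_path l f \<alpha> p" and "1 \<le> t" "t \<le> M" and le: "\<And>j. t \<le> j \<Longrightarrow> j < M \<Longrightarrow> \<alpha> M \<le> \<alpha> j"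
  shows "lascoux_path l f (\<lambda>i. if t < i \<and> i \<le> M then \<alpha> (i - 1) else if i = t then \<alpha> M else \<alpha> i)
    (pi_word [t..<M] p)"
  using assms(5,4) le
proof (induction t rule: inc_induct)
  case base
  have "(\<lambda>i. if M < i \<and> i \<le> M then \<alpha> (i - 1) else if i = M then \<alpha> M else \<alpha> i) = \<alpha>"
    by (auto simp: fun_eq_iff)
  then show ?case using path by simp
next
  case (step t)
  let ?\<beta> = "\<lambda>t i. if t < i \<and> i \<le> M then \<alpha> (i - 1) else if i = t then \<alpha> M else \<alpha> i"
  have "lascoux_path l f (?\<beta> (Suc t) \<circ> simple_refl t) (pi_op t (pi_word [Suc t..<M] p))"
    using step by (intro lascoux_path_weak_swap[OF assms(1) fixed]) auto
  moreover have "?\<beta> (Suc t) \<circ> simple_refl t = ?\<beta> t"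
    using step.hyps by (auto simp: fun_eq_iff simple_refl_if)
  ultimately show ?case using step.hyps by (simp add: upt_conv_Cons)
qed

definition reverse_segment :: "nat \<Rightarrow> nat \<Rightarrow> (nat \<Rightarrow> nat) \<Rightarrow> nat \<Rightarrow> nat" where
  "reverse_segment k m l i = (if k \<le> i \<and> i \<le> m then l (k + m - i) else l i)"

section \<open>Building the polynomial row by row\<close>

text \<open>
  A symmetric partition with at most \<open>n\<close> parts. The number \<open>r\<close> counts the rows that extend beyond the
  diagonal, which is the number of parts of the strict partition.
\<close>

locale symmetric_shape =
  fixes l :: "nat \<Rightarrow> nat" and n r :: nat
  assumes partition: "is_partition l"
    and symmetric: "\<And>i j. 1 \<le> i \<Longrightarrow> 1 \<le> j \<Longrightarrow> j \<le> l i \<longleftrightarrow> i \<le> l j"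
    and support: "\<And>i. n < i \<Longrightarrow> l i = 0"
    and diagonal: "\<And>k. 1 \<le> k \<Longrightarrow> k < l k \<longleftrightarrow> k \<le> r"
begin

definition start_poly :: ring_x where
  "start_poly = (\<Prod>(i, j)\<in>{(i, j)\<in>diagram l. i > j}. oplus beta (X i) (X j))"

definition rows :: "nat \<Rightarrow> real \<Rightarrow> (nat \<Rightarrow> real) \<Rightarrow> real" where
  "rows k b v = (\<Prod>i\<in>{1..<k}. \<Prod>j\<in>{Suc i..l i}. oplus b (v i) (v j))"

definition parts :: "nat \<Rightarrow> nat list" where
  "parts k = map (\<lambda>i. l i - i) [k..<Suc r]"

text \<open>
  The invariant of the construction: the entries at the places \<open>k, \<dots>, m\<close> have been reversed, the rows from \<open>k\<close> on
  have been turned into a \<open>GP\<close> polynomial in \<open>x\<^sub>k, \<dots>, x\<^sub>m\<close>, and the rows before \<open>k\<close> are untouched.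
\<close>

definition stage :: "nat \<Rightarrow> nat \<Rightarrow> bool" where
  "stage k m \<longleftrightarrow> (\<exists>p. lascoux_path l start_poly (reverse_segment k m l) p \<and>
    (\<forall>b>0. \<forall>v. generic n v \<longrightarrow> evaluate b v p = rows k b v * gp_value b (parts k) (v ` {k..m})))"

lemma antimono: "1 \<le> i \<Longrightarrow> i \<le> j \<Longrightarrow> l j \<le> l i"
  using partition by (simp add: is_partition_def)

lemma part_le: "1 \<le> i \<Longrightarrow> l i \<le> n"
  using symmetric[of i "Suc n"] support[of "Suc n"] by (cases "Suc n \<le> l i") auto

lemma strict_lower_cells:
  "{(i, j)\<in>diagram l. i > j} = {(i, j). 1 \<le> j \<and> j < i \<and> i \<le> l j}"
  using symmetric by (auto simp: diagram_def)

lemma eval_start_poly: "evaluate b v start_poly = rows (Suc r) b v"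
proof -
  have "evaluate b v start_poly = (\<Prod>(i, j)\<in>{(i, j). 1 \<le> j \<and> j < i \<and> i \<le> l j}. oplus b (v i) (v j))"
    unfolding start_poly_def strict_lower_cells by (simp add: case_prod_unfold)
  also have "\<dots> = (\<Prod>(j, i)\<in>Sigma {1..<Suc r} (\<lambda>j. {Suc j..l j}). oplus b (v j) (v i))"
  proof (rule prod.reindex_bij_witness[where i = prod.swap and j = prod.swap])
    fix a assume a: "a \<in> {(i, j). 1 \<le> j \<and> j < i \<and> i \<le> l j}"
    then have "snd a \<le> r" using diagonal[of "snd a"] by auto
    then show "prod.swap a \<in> Sigma {1..<Suc r} (\<lambda>j. {Suc j..l j})" using a by auto
  qed (auto simp: oplus_def algebra_simps)
  also have "\<dots> = rows (Suc r) b v"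
    unfolding rows_def by (subst prod.Sigma) auto
  finally show ?thesis .
qed

text \<open>
  If the rows \<open>k\<close> and \<open>k + 1\<close> have equal length, then by symmetry so have the columns, and
  exchanging \<open>k\<close> and \<open>k + 1\<close> permutes the cells below the diagonal, up to reflecting the cell in position
  \<open>(k + 1, k)\<close>.
\<close>

lemma start_poly_fixed:
  assumes k: "1 \<le> k" "l k = l (Suc k)"
  shows "pi_op k start_poly = start_poly"
proof (rule pi_op_fixed)
  fix b :: real and v :: "nat \<Rightarrow> real"
  let ?s = "simple_refl k"
  let ?S = "{(i, j). 1 \<le> j \<and> j < i \<and> i \<le> l j}"
  define \<phi> where "\<phi> = (\<lambda>(i, j). if (i, j) = (Suc k, k) then (i, j) else (?s i, ?s j))"
  have l: "l (?s j) = l j" for j using k by (auto simp: simple_refl_if)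
  have row: "?s i \<le> l j" if "1 \<le> j" "1 \<le> i" "i \<le> l j" for i j
    using that symmetric[of k j] symmetric[of "Suc k" j] k by (auto simp: simple_refl_if)
  have "\<phi> a \<in> ?S" if a_in: "a \<in> ?S" for a
  proof -
    obtain i j where a: "a = (i, j)" "1 \<le> j" "j < i" "i \<le> l j" using a_in by auto
    show ?thesis
    proof (cases "(j, i) = (k, Suc k)")
      case True
      then show ?thesis using a by (simp add: \<phi>_def)
    next
      case False
      then have "\<phi> a = (?s i, ?s j)" using a by (auto simp: \<phi>_def)
      moreover have "?s j < ?s i" by (rule simple_refl_mono(1)[OF a(3) False])
      moreover have "1 \<le> ?s j" using a(2) simple_refl_pos[OF k(1)] by blast
      moreover have "?s i \<le> l (?s j)" unfolding l using a by (intro row) auto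
      ultimately show ?thesis by simp
    qed
  qed
  moreover have "\<phi> (\<phi> a) = a" if a_in: "a \<in> ?S" for a
  proof -
    obtain i j where a: "a = (i, j)" "j < i" using a_in by auto
    show ?thesis
    proof (cases "(j, i) = (k, Suc k)")
      case True
      then show ?thesis using a by (simp add: \<phi>_def)
    next
      case False
      then have "(?s j, ?s i) \<noteq> (k, Suc k)" by (rule simple_refl_mono(2)[OF a(2)])
      then show ?thesis using False a(1) unfolding \<phi>_def by auto
    qed
  qed
  moreover have "oplus b ((v \<circ> ?s) (fst (\<phi> a))) ((v \<circ> ?s) (snd (\<phi> a))) = oplus b (v (fst a)) (v (snd a))" for a
    by (auto simp: \<phi>_def oplus_def algebra_simps split: prod.splits)
  ultimately have "(\<Prod>a\<in>?S. oplus b (v (fst a)) (v (snd a))) =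
      (\<Prod>a\<in>?S. oplus b ((v \<circ> ?s) (fst a)) ((v \<circ> ?s) (snd a)))"
    by (intro prod.reindex_bij_witness[where i = \<phi> and j = \<phi>]) auto
  then show "evaluate b (v \<circ> ?s) start_poly = evaluate b v start_poly"
    unfolding start_poly_def strict_lower_cells by (simp add: case_prod_unfold)
qed

text \<open>
  The rows before \<open>k\<close> contain both or neither of the variables in the segment as long as it does not
  extend beyond the row \<open>k - 1\<close>.
\<close>

lemma rows_swap:
  assumes "1 \<le> k" "k \<le> i" "\<And>a. 1 \<le> a \<Longrightarrow> a < k \<Longrightarrow> i < l a"
  shows "rows k b (v \<circ> simple_refl i) = rows k b v"
  unfolding rows_def
proof (rule prod.cong[OF refl])
  fix a assume a: "a \<in> {1..<k}"
  have "bij_betw (simple_refl i) {Suc a..l a} {Suc a..l a}"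
    using simple_refl_image[of "Suc a" i "l a"] a assms
    by (auto simp: bij_betw_def intro: inj_on_subset[OF inj_simple_refl])
  then have "(\<Prod>j\<in>{Suc a..l a}. oplus b (v a) (v j)) =
      (\<Prod>j\<in>{Suc a..l a}. oplus b (v a) (v (simple_refl i j)))"
    by (rule prod.reindex_bij_betw[symmetric])
  then show "(\<Prod>j\<in>{Suc a..l a}. oplus b ((v \<circ> simple_refl i) a) ((v \<circ> simple_refl i) j)) =
      (\<Prod>j\<in>{Suc a..l a}. oplus b (v a) (v j))"
    using a assms(2) by simp
qed

lemma parts_Cons: "k \<le> r \<Longrightarrow> parts k = (l k - k) # parts (Suc k)"
  by (simp add: parts_def upt_conv_Cons del: upt_Suc)

lemma parts_Nil: "r < k \<Longrightarrow> parts k = []"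
  by (simp add: parts_def)

lemma parts_strict: 
  assumes "1 \<le> k"
  shows "sorted_wrt (>) (parts k)" "0 \<notin> set (parts k)"
proof -
  have dec: "l j - j < l i - i" if "1 \<le> i" "i < j" "i \<le> r" for i j
    using that antimono[of i j] diagonal[of i] by auto
  show "sorted_wrt (>) (parts k)"
    unfolding parts_def sorted_wrt_map using assms
    by (intro sorted_wrt_mono_rel[OF _ sorted_wrt_upt]) (auto intro!: dec)
  have pos: "0 < l i - i" if "i \<in> {k..<Suc r}" for i
    using that diagonal[of i] assms by auto
  show "0 \<notin> set (parts k)"
  proof
    assume "0 \<in> set (parts k)"
    then have "0 \<in> (\<lambda>i. l i - i) ` {k..<Suc r}"
      by (simp only: parts_def set_map set_upt)
    then obtain i where "0 = l i - i" "i \<in> {k..<Suc r}"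
      by (rule imageE)
    then show False using pos[of i] by linarith
  qed
qed

lemma card_image_segment:
  assumes "generic n v" "1 \<le> k" "m \<le> n"
  shows "card (v ` {k..m}) = Suc m - k"
proof -
  have "inj_on v {k..m}" by (rule inj_on_subset[of v "{1..n}"]) (use assms in \<open>auto simp: generic_def\<close>)
  then show ?thesis by (simp add: card_image)
qed

text \<open>
  The entry at \<open>m + 1\<close> is carried to the front of the segment. On values, this is the left-hand side of the
  stability property.
\<close>

lemma stage_extend:
  assumes "stage k m" "1 \<le> k" "k \<le> Suc m" "Suc m \<le> n" "1 < k \<Longrightarrow> Suc m \<le> l (k - 1)"
    and "first_part (parts k) < Suc (Suc m) - k"
  shows "stage k (Suc m)"
proof -
  obtain p where path: "lascoux_path l start_poly (reverse_segment k m l) p"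
    and p: "\<And>b v. 0 < b \<Longrightarrow> generic n v \<Longrightarrow> evaluate b v p = rows k b v * gp_value b (parts k) (v ` {k..m})"
    using assms(1) by (auto simp: stage_def)
  let ?p = "pi_word [k..<Suc m] p"
  have "lascoux_path l start_poly (\<lambda>i. if k < i \<and> i \<le> Suc m then reverse_segment k m l (i - 1)
      else if i = k then reverse_segment k m l (Suc m) else reverse_segment k m l i) ?p"
  proof (intro lascoux_path_down[OF partition start_poly_fixed path] assms(2,3))
    fix j assume "k \<le> j" "j < Suc m"
    then show "reverse_segment k m l (Suc m) \<le> reverse_segment k m l j"
      using assms(2) by (auto simp: reverse_segment_def intro!: antimono)
  qed
  moreover have "(\<lambda>i. if k < i \<and> i \<le> Suc m then reverse_segment k m l (i - 1)
      else if i = k then reverse_segment k m l (Suc m) else reverse_segment k m l i) = reverse_segment k (Suc m) l"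
    using assms(2,3) by (auto simp: fun_eq_iff reverse_segment_def intro!: arg_cong[where f = l])
  ultimately have path': "lascoux_path l start_poly (reverse_segment k (Suc m) l) ?p" by simp
  have "evaluate b v ?p = rows k b v * gp_value b (parts k) (v ` {k..Suc m})" if b: "0 < b" and v: "generic n v" for b v
  proof -
    let ?A = "v ` {k..Suc m}"
    have "evaluate b v ?p = rows k b v *
        (\<Sum>y\<in>?A. gp_value b (parts k) (?A - {y}) * (\<Prod>z\<in>?A - {y}. pi_weight b z y))"
    proof (rule eval_pi_word_down[where n = n and H = "\<lambda>A y. gp_value b (parts k) (A - {y})"])
      show "rows k b (v \<circ> simple_refl i) = rows k b v" if "generic n v" "k \<le> i" "i < Suc m" for v i
      proof (rule rows_swap[OF assms(2) that(2)])
        fix a assume "1 \<le> a" "a < k"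
        then have "1 < k" "a \<le> k - 1" by auto
        then show "i < l a" using that(3) assms(5) antimono[OF \<open>1 \<le> a\<close>, of "k - 1"] by linarith
      qed
      show "evaluate b v p = rows k b v * gp_value b (parts k) (v ` {k..Suc m} - {v (Suc m)})" if "generic n v" for v
      proof -
        have "v (Suc m) \<notin> v ` {k..m}"
          using assms(2,4) by (intro generic_notin_image[OF that]) auto
        moreover have "{k..Suc m} = insert (Suc m) {k..m}" using assms(3) by auto
        ultimately show ?thesis using p[OF b that] by simp
      qed
    qed (use assms v in auto)
    also have "(\<Sum>y\<in>?A. gp_value b (parts k) (?A - {y}) * (\<Prod>z\<in>?A - {y}. pi_weight b z y)) =
        gp_value b (parts k) ?A"
    proof (rule gp_value_stable)
      show "0 < z" if "z \<in> ?A" for z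
        using that v assms(2,4) by (auto simp: generic_def)
      show "first_part (parts k) < card ?A"
        using assms(6) by (simp only: card_image_segment[OF v assms(2,4)])
    qed (use b parts_strict[OF assms(2)] in auto)
    finally show ?thesis .
  qed
  then show ?thesis using path' by (auto simp: stage_def)
qed

text \<open>
  The entry at \<open>k\<close> is carried to the end of the segment. Each of the \<open>l k - k\<close> weights \<open>c(y, z)\<close>
  combines with the factor \<open>y \<oplus> z\<close> from row \<open>k\<close> to \<open>y (y \<oplus> z) / (y \<ominus> z)\<close>, and the powers of \<open>y\<close> add up to the first part.
\<close>

lemma stage_add_row:
  assumes "stage (Suc k) (l k)" "1 \<le> k" "k \<le> r"
  shows "stage k (l k)"
proof -
  let ?m = "l k"
  have m: "k < ?m" "?m \<le> n" using diagonal[of k] part_le[of k] assms(2,3) by auto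
  obtain p where path: "lascoux_path l start_poly (reverse_segment (Suc k) ?m l) p"
    and p: "\<And>b v. 0 < b \<Longrightarrow> generic n v \<Longrightarrow>
      evaluate b v p = rows (Suc k) b v * gp_value b (parts (Suc k)) (v ` {Suc k..?m})"
    using assms(1) by (auto simp: stage_def)
  let ?p = "pi_word (rev [k..<?m]) p"
  have "lascoux_path l start_poly (\<lambda>i. if k \<le> i \<and> i < ?m then reverse_segment (Suc k) ?m l (Suc i)
      else if i = ?m then reverse_segment (Suc k) ?m l k else reverse_segment (Suc k) ?m l i) ?p"
  proof (intro lascoux_path_up[OF partition start_poly_fixed path] assms(2))
    show "k \<le> ?m" using m by simp
    fix j assume "k < j" "j \<le> ?m"
    then show "reverse_segment (Suc k) ?m l j \<le> reverse_segment (Suc k) ?m l k"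
      using assms(2) by (auto simp: reverse_segment_def intro!: antimono)
  qed
  moreover have "(\<lambda>i. if k \<le> i \<and> i < ?m then reverse_segment (Suc k) ?m l (Suc i)
      else if i = ?m then reverse_segment (Suc k) ?m l k else reverse_segment (Suc k) ?m l i) = reverse_segment k ?m l"
    using m by (auto simp: fun_eq_iff reverse_segment_def)
  ultimately have path': "lascoux_path l start_poly (reverse_segment k ?m l) ?p" by simp
  have "evaluate b v ?p = rows k b v * gp_value b (parts k) (v ` {k..?m})" if b: "0 < b" and v: "generic n v" for b v
  proof -
    let ?A = "v ` {k..?m}"
    let ?H = "\<lambda>A y. (\<Prod>z\<in>A - {y}. oplus b y z) * gp_value b (parts (Suc k)) (A - {y})"
    have "evaluate b v ?p = rows k b v * (\<Sum>y\<in>?A. ?H ?A y * (\<Prod>z\<in>?A - {y}. pi_weight b y z))"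
    proof (rule eval_pi_word_up[where n = n and H = ?H])
      show "rows k b (v \<circ> simple_refl i) = rows k b v" if "generic n v" "k \<le> i" "i < ?m" for v i
      proof (rule rows_swap[OF assms(2) that(2)])
        fix a assume "1 \<le> a" "a < k"
        then show "i < l a" using that(3) antimono[of a k] by auto
      qed
      show "evaluate b v p = rows k b v * ?H (v ` {k..?m}) (v k)" if g: "generic n v" for v
      proof -
        have "v k \<notin> v ` {Suc k..?m}"
          using assms(2) m by (intro generic_notin_image[OF g]) auto
        moreover have "{k..?m} = insert k {Suc k..?m}" using m by auto
        ultimately have A: "v ` {k..?m} - {v k} = v ` {Suc k..?m}" by auto
        have "inj_on v {Suc k..?m}"
          by (rule inj_on_subset[of v "{1..n}"]) (use g assms(2) m in \<open>auto simp: generic_def\<close>)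
        then have "(\<Prod>z\<in>v ` {Suc k..?m}. oplus b (v k) z) = (\<Prod>j\<in>{Suc k..?m}. oplus b (v k) (v j))"
          by (simp add: prod.reindex)
        moreover have "rows (Suc k) b v = rows k b v * (\<Prod>j\<in>{Suc k..?m}. oplus b (v k) (v j))"
          unfolding rows_def using assms(2) by (simp add: prod.atLeastLessThan_Suc)
        ultimately show ?thesis unfolding A using p[OF b g] by simp
      qed
    qed (use assms m v in auto)
    also have "(\<Sum>y\<in>?A. ?H ?A y * (\<Prod>z\<in>?A - {y}. pi_weight b y z)) = gp_value b ((l k - k) # parts (Suc k)) ?A"
      unfolding gp_value.simps
    proof (rule sum.cong[OF refl])
      fix y assume y: "y \<in> ?A"
      have "card (?A - {y}) = l k - k"
        using y card_image_segment[OF v assms(2) m(2)] by simp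
      then have "y ^ (l k - k) * (\<Prod>z\<in>?A - {y}. gp_ratio b y z) = (\<Prod>z\<in>?A - {y}. y * gp_ratio b y z)"
        by (simp only: prod.distrib prod_constant)
      also have "\<dots> = (\<Prod>z\<in>?A - {y}. oplus b y z * pi_weight b y z)"
        by (intro prod.cong refl) (simp add: gp_ratio_def pi_weight_def)
      also have "\<dots> = (\<Prod>z\<in>?A - {y}. oplus b y z) * (\<Prod>z\<in>?A - {y}. pi_weight b y z)"
        by (rule prod.distrib)
      finally show "?H ?A y * (\<Prod>z\<in>?A - {y}. pi_weight b y z) =
          y ^ (l k - k) * (\<Prod>z\<in>?A - {y}. gp_ratio b y z) * gp_value b (parts (Suc k)) (?A - {y})"
        by (simp only: mult.assoc mult.commute mult.left_commute)
    qed
    finally show ?thesis by (simp only: parts_Cons[OF assms(3)])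
  qed
  then show ?thesis using path' by (auto simp: stage_def)
qed

lemma stage_extend_many:
  assumes "stage k m0" "1 \<le> k" "k \<le> Suc m0" "m0 \<le> m" "m \<le> n" "1 < k \<Longrightarrow> m \<le> l (k - 1)"
    and "first_part (parts k) < Suc (Suc m0) - k"
  shows "stage k m"
  using assms(4,5,6)
proof (induction m rule: dec_induct)
  case base
  then show ?case using assms(1) by simp
next
  case (step m)
  have "stage k m" using step.prems by (intro step.IH) auto
  moreover have "first_part (parts k) < Suc (Suc m) - k" using assms(7) step.hyps by linarith
  ultimately show ?case using assms(2,3) step by (intro stage_extend) auto
qed

text \<open>
  Before the last row beyond the diagonal is used, the segment starting behind it carries the constant 1 and
  can be lengthened freely. From then on the rows are added one by one, each time lengthening the
  segment until it has reached the end of the preceding row, or \<open>n\<close>.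
\<close>

lemma stage_full: 
  assumes "k \<le> r"
  shows "stage (Suc k) (if k = 0 then n else l k)"
  using assms
proof (induction k rule: inc_induct)
  case base
  have "reverse_segment (Suc r) r l = l" by (auto simp: fun_eq_iff reverse_segment_def)
  then have "stage (Suc r) r"
    unfolding stage_def using eval_start_poly lascoux_path.start[of l start_poly]
    by (intro exI[of _ start_poly]) (auto simp: parts_Nil)
  moreover have "r = 0 \<or> r < l r" using diagonal[of r] by (cases r) auto
  moreover have "r = 0 \<or> l r \<le> n" using part_le[of r] by (cases r) auto
  ultimately show ?case
    by (rule_tac stage_extend_many[of "Suc r" r]) (auto simp: parts_Nil)
next
  case (step k)
  have "stage (Suc k) (l (Suc k))"
    using step by (intro stage_add_row) auto
  moreover have "Suc k < l (Suc k)" using diagonal[of "Suc k"] step.hyps by simp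
  moreover have "l (Suc k) \<le> n" "k = 0 \<or> l k \<le> n" using part_le[of "Suc k"] part_le[of k] by (cases k, auto)+
  moreover have "k = 0 \<or> l (Suc k) \<le> l k" using antimono[of k "Suc k"] by (cases k) auto
  ultimately show ?case
    using step.hyps by (rule_tac stage_extend_many[of "Suc k" "l (Suc k)"]) (auto simp: parts_Cons)
qed

lemma same_content_reverse: "same_content (reverse_comp n l) l"
  unfolding same_content_def
proof (intro allI impI)
  fix c :: nat assume c: "1 \<le> c"
  have "l 0 = 0" using partition by (simp add: is_partition_def weak_composition_def)
  then have sub: "1 \<le> i \<and> i \<le> n" if "c \<le> l i" for i
    using that c support[of i] by (cases "i = 0"; cases "n < i") auto
  have "{i. c \<le> reverse_comp n l i} = (\<lambda>i. n + 1 - i) ` {i. c \<le> l i}"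
  proof (intro set_eqI iffI)
    fix x assume "x \<in> {i. c \<le> reverse_comp n l i}"
    then have "c \<le> l (n + 1 - x)" "x = n + 1 - (n + 1 - x)"
      using c by (auto simp: reverse_comp_def split: if_splits)
    then show "x \<in> (\<lambda>i. n + 1 - i) ` {i. c \<le> l i}" by blast
  next
    fix x assume "x \<in> (\<lambda>i. n + 1 - i) ` {i. c \<le> l i}"
    then obtain i where "x = n + 1 - i" "c \<le> l i" by blast
    moreover have "1 \<le> n + 1 - i" "n + 1 - i \<le> n" "n + 1 - (n + 1 - i) = i"
      using sub[OF \<open>c \<le> l i\<close>] by auto
    ultimately show "x \<in> {i. c \<le> reverse_comp n l i}"
      by (simp add: reverse_comp_def)
  qed
  moreover have "inj_on (\<lambda>i. n + 1 - i) {i. c \<le> l i}"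
  proof (rule inj_onI)
    fix i j assume "i \<in> {i. c \<le> l i}" "j \<in> {i. c \<le> l i}" "n + 1 - i = n + 1 - j"
    then show "i = j" using sub[of i] sub[of j] by auto
  qed
  ultimately show "card {i. c \<le> reverse_comp n l i} = card {i. c \<le> l i}"
    by (simp add: card_image)
qed

lemma eval_LP_reverse:
  assumes "0 < b" "generic n v"
  shows "evaluate b v (LP (reverse_comp n l)) = gp_value b (parts 1) (v ` {1..n})"
proof -
  have l0: "l 0 = 0" using partition by (simp add: is_partition_def weak_composition_def)
  have rev: "reverse_segment 1 n l = reverse_comp n l"
  proof
    fix i
    show "reverse_segment 1 n l i = reverse_comp n l i"
      using l0 support[of i] by (cases "i = 0") (auto simp: reverse_segment_def reverse_comp_def)
  qed
  have "weak_composition (reverse_comp n l)"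
    using finite_subset[of "{i. reverse_comp n l i \<noteq> 0}" "{1..n}"]
    by (auto simp: weak_composition_def reverse_comp_def)
  then have LP: "lascoux_path l start_poly (reverse_comp n l) (LP (reverse_comp n l))"
    unfolding start_poly_def by (intro LP_lascoux_path partition same_content_reverse)
  have "stage 1 n" using stage_full[of 0] by simp
  then obtain p where "lascoux_path l start_poly (reverse_comp n l) p"
    and p: "\<And>b v. 0 < b \<Longrightarrow> generic n v \<Longrightarrow> evaluate b v p = rows 1 b v * gp_value b (parts 1) (v ` {1..n})"
    unfolding stage_def rev by blast
  then have "LP (reverse_comp n l) = p"
    using lascoux_path_unique[OF partition LP] by blast
  then show ?thesis using p[OF assms] by (simp add: rows_def)
qed

end

section \<open>The symmetrization formula\<close>

lemma to_frac_simps [simp]: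
  "to_frac (p + q) = to_frac p + to_frac q"
  "to_frac (p - q) = to_frac p - to_frac q"
  "to_frac (p * q) = to_frac p * to_frac q"
  "to_frac 0 = 0" "to_frac 1 = 1"
  "to_frac (of_nat k) = of_nat k"
  by (simp_all add: to_frac_def Zero_fract_def One_fract_def of_nat_fract)

lemma to_frac_eq_iff [simp]: "to_frac p = to_frac q \<longleftrightarrow> p = q"
  by (simp add: to_frac_def eq_fract)

lemma to_frac_eq_0_iff [simp]: "to_frac p = 0 \<longleftrightarrow> p = 0"
  using to_frac_eq_iff[of p 0] by simp

lemma to_frac_sum [simp]: "to_frac (sum f A) = (\<Sum>a\<in>A. to_frac (f a))"
  by (induction A rule: infinite_finite_induct) simp_all

lemma to_frac_prod [simp]: "to_frac (prod f A) = (\<Prod>a\<in>A. to_frac (f a))"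
  by (induction A rule: infinite_finite_induct) simp_all

lemma to_frac_oplus: "to_frac (oplus b x y) = oplus (to_frac b) (to_frac x) (to_frac y)"
  by (simp add: oplus_def)

lemma perm_fract_divide:
  assumes "bij w" "q \<noteq> 0"
  shows "perm_fract w (to_frac p / to_frac q) = to_frac (perm_poly w p) / to_frac (perm_poly w q)"
  using perm_fract_Fract[OF assms, of p] by (simp add: to_frac_def)

lemma perm_poly_eq_0_iff: "bij w \<Longrightarrow> perm_poly w p = 0 \<longleftrightarrow> p = 0"
proof
  assume w: "bij w" and "perm_poly w p = 0"
  then have "perm_poly (inv w) (perm_poly w p) = 0"
    by (simp add: perm_poly_def inj_map_key bij_imp_bij_inv)
  moreover have "perm_poly (inv w) (perm_poly w p) = p"
  proof (rule eval_eqI)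
    fix b :: real and v :: "nat \<Rightarrow> real"
    have "v \<circ> inv w \<circ> w = v" using w by (simp add: fun_eq_iff bij_is_inj)
    then show "evaluate b v (perm_poly (inv w) (perm_poly w p)) = evaluate b v p"
      using w by (simp add: eval_perm_poly bij_imp_bij_inv)
  qed
  ultimately show "p = 0" by simp
qed (simp add: perm_poly_def inj_map_key)

lemma sum_fractions:
  fixes N D :: "'a \<Rightarrow> 'b :: field"
  assumes "finite W" "\<And>w. w \<in> W \<Longrightarrow> D w \<noteq> 0"
  shows "(\<Sum>w\<in>W. N w / D w) * (\<Prod>w\<in>W. D w) = (\<Sum>w\<in>W. N w * (\<Prod>w'\<in>W - {w}. D w'))"
proof -
  have "N w / D w * (\<Prod>w\<in>W. D w) = N w * (\<Prod>w'\<in>W - {w}. D w')" if "w \<in> W" for w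
    using assms(2)[OF that] by (simp add: prod.remove[OF assms(1) that])
  then show ?thesis by (simp add: sum_distrib_right)
qed

text \<open>
  After clearing denominators, an identity of rational functions is an identity of polynomials and can be
  tested at points.
\<close>

lemma to_frac_eq_sum_fractions:
  assumes "finite W" "\<And>w. w \<in> W \<Longrightarrow> D w \<noteq> 0"
    and "\<And>b v. 0 < b \<Longrightarrow> inj v \<Longrightarrow> (\<And>i. 0 < v i) \<Longrightarrow>
      (\<forall>w\<in>W. evaluate b v (D w) \<noteq> 0) \<and> evaluate b v p = (\<Sum>w\<in>W. evaluate b v (N w) / evaluate b v (D w))"
  shows "to_frac p = (\<Sum>w\<in>W. to_frac (N w) / to_frac (D w))"
proof -
  have "p * (\<Prod>w\<in>W. D w) = (\<Sum>w\<in>W. N w * (\<Prod>w'\<in>W - {w}. D w'))"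
  proof (rule eval_eqI)
    fix b :: real and v :: "nat \<Rightarrow> real" assume "0 < b" "inj v" "\<And>i. 0 < v i"
    then have *: "\<And>w. w \<in> W \<Longrightarrow> evaluate b v (D w) \<noteq> 0"
      "evaluate b v p = (\<Sum>w\<in>W. evaluate b v (N w) / evaluate b v (D w))" using assms(3) by blast+
    show "evaluate b v (p * (\<Prod>w\<in>W. D w)) = evaluate b v (\<Sum>w\<in>W. N w * (\<Prod>w'\<in>W - {w}. D w'))"
      using sum_fractions[OF assms(1) *(1), where N = "\<lambda>w. evaluate b v (N w)"] by (simp add: *(2))
  qed
  then have "to_frac (p * (\<Prod>w\<in>W. D w)) = to_frac (\<Sum>w\<in>W. N w * (\<Prod>w'\<in>W - {w}. D w'))"
    by (simp only:)
  then have "to_frac p * (\<Prod>w\<in>W. to_frac (D w)) = (\<Sum>w\<in>W. to_frac (N w) * (\<Prod>w'\<in>W - {w}. to_frac (D w')))"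
    by (simp only: to_frac_simps to_frac_sum to_frac_prod)
  also have "\<dots> = (\<Sum>w\<in>W. to_frac (N w) / to_frac (D w)) * (\<Prod>w\<in>W. to_frac (D w))"
    using assms(1,2) by (intro sum_fractions[symmetric]) auto
  finally show ?thesis using assms(1,2) by simp
qed

text \<open>
  The summand of the symmetrization formula for one ordering of the variables. Sorting the orderings by
  their first element matches the recursion of \<open>gp_value\<close>; the orderings of the variables behind the last
  nonzero part account for the factorial.
\<close>

fun gp_term :: "real \<Rightarrow> nat list \<Rightarrow> real list \<Rightarrow> real" where
  "gp_term b (a # ms) (x # xs) = x ^ a * (\<Prod>y\<in>set xs. gp_ratio b x y) * gp_term b ms xs"
| "gp_term b _ _ = 1"

lemma sum_gp_term:
  assumes "finite A" "length ms \<le> card A"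
  shows "(\<Sum>xs\<in>permutations_of_set A. gp_term b ms xs) = fact (card A - length ms) * gp_value b ms A"
  using assms
proof (induction ms arbitrary: A)
  case Nil
  then show ?case by simp
next
  case (Cons a ms)
  then have "A \<noteq> {}" by auto
  have "(\<Sum>xs\<in>permutations_of_set A. gp_term b (a # ms) xs) =
      (\<Sum>x\<in>A. \<Sum>xs\<in>(#) x ` permutations_of_set (A - {x}). gp_term b (a # ms) xs)"
    unfolding permutations_of_set_nonempty[OF \<open>A \<noteq> {}\<close>] using Cons.prems(1)
    by (intro sum.UNION_disjoint) auto
  also have "\<dots> = (\<Sum>x\<in>A. \<Sum>xs\<in>permutations_of_set (A - {x}).
      x ^ a * (\<Prod>y\<in>A - {x}. gp_ratio b x y) * gp_term b ms xs)"
  proof (rule sum.cong[OF refl])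
    fix x
    have "(\<Sum>xs\<in>(#) x ` permutations_of_set (A - {x}). gp_term b (a # ms) xs) =
        (\<Sum>xs\<in>permutations_of_set (A - {x}). gp_term b (a # ms) (x # xs))"
      by (subst sum.reindex) auto
    also have "\<dots> = (\<Sum>xs\<in>permutations_of_set (A - {x}).
      x ^ a * (\<Prod>y\<in>A - {x}. gp_ratio b x y) * gp_term b ms xs)"
      by (intro sum.cong refl) (simp add: permutations_of_setD)
    finally show "(\<Sum>xs\<in>(#) x ` permutations_of_set (A - {x}). gp_term b (a # ms) xs) =
        (\<Sum>xs\<in>permutations_of_set (A - {x}). x ^ a * (\<Prod>y\<in>A - {x}. gp_ratio b x y) * gp_term b ms xs)" .
  qed
  also have "\<dots> = (\<Sum>x\<in>A. x ^ a * (\<Prod>y\<in>A - {x}. gp_ratio b x y) *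
      (fact (card A - length (a # ms)) * gp_value b ms (A - {x})))"
    using Cons by (intro sum.cong refl) (simp add: sum_distrib_left[symmetric] card_Diff_singleton)
  also have "\<dots> = fact (card A - length (a # ms)) * gp_value b (a # ms) A"
    by (simp add: sum_distrib_left algebra_simps)
  finally show ?case .
qed

lemma gp_term_segment:
  assumes "k \<le> Suc r" "r \<le> n" "inj_on u {1..n}" "1 \<le> k"
  shows "gp_term b (map \<mu> [k..<Suc r]) (map u [k..<Suc n]) =
    (\<Prod>i\<in>{k..r}. u i ^ \<mu> i * (\<Prod>j\<in>{Suc i..n}. gp_ratio b (u i) (u j)))"
  using assms(1,4)
proof (induction k rule: inc_induct)
  case base
  then show ?case by simp
next
  case (step k)
  have "inj_on u {Suc k..n}"
    by (rule inj_on_subset[OF assms(3)]) auto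
  then have "(\<Prod>y\<in>set (map u [Suc k..<Suc n]). gp_ratio b (u k) y) = (\<Prod>j\<in>{Suc k..n}. gp_ratio b (u k) (u j))"
    by (simp add: prod.reindex atLeastLessThanSuc_atLeastAtMost del: upt_Suc)
  moreover have "{k..r} = insert k {Suc k..r}" using step.hyps by auto
  ultimately show ?case
    using step assms(2) by (simp add: upt_conv_Cons del: upt_Suc)
qed

lemma bij_betw_permutation_lists:
  assumes "inj_on v {1..n}"
  shows "bij_betw (\<lambda>w. map (v \<circ> w) [1..<Suc n]) {w. w permutes {1..n}} (permutations_of_set (v ` {1..n}))"
proof -
  let ?F = "\<lambda>w. map (v \<circ> w) [1..<Suc n]"
  have inj: "inj_on ?F {w. w permutes {1..n}}"
  proof (rule inj_onI)
    fix w w' assume w: "w \<in> {w. w permutes {1..n}}" "w' \<in> {w. w permutes {1..n}}" and eq: "?F w = ?F w'"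
    show "w = w'"
    proof
      fix i
      show "w i = w' i"
      proof (cases "i \<in> {1..n}")
        case True
        then have "i \<in> set [1..<Suc n]" by auto
        moreover have "\<forall>x\<in>set [1..<Suc n]. (v \<circ> w) x = (v \<circ> w') x"
          using eq by (simp only: map_eq_conv)
        ultimately have "(v \<circ> w) i = (v \<circ> w') i" by (metis (no_types))
        then have "v (w i) = v (w' i)" by simp
        moreover have "w i \<in> {1..n}" "w' i \<in> {1..n}" using w True by (simp_all only: mem_Collect_eq permutes_in_image)
        ultimately show ?thesis using assms by (auto dest: inj_onD)
      next
        case False
        then show ?thesis using w by (simp add: permutes_not_in)
      qed
    qed
  qed
  have "?F w \<in> permutations_of_set (v ` {1..n})" if "w permutes {1..n}" for w
  proof (rule permutations_of_setI)
    have "set (?F w) = v ` w ` {1..n}" by (simp add: image_comp atLeastLessThanSuc_atLeastAtMost del: upt_Suc)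
    then show "set (?F w) = v ` {1..n}" using permutes_image[OF that] by simp
    have "inj_on (v \<circ> w) {1..n}"
      using assms permutes_image[OF that] permutes_inj_on[OF that] by (intro comp_inj_on) auto
    then show "distinct (?F w)"
      unfolding distinct_map by (simp add: atLeastLessThanSuc_atLeastAtMost del: upt_Suc)
  qed
  then have sub: "?F ` {w. w permutes {1..n}} \<subseteq> permutations_of_set (v ` {1..n})" by blast
  have "card (?F ` {w. w permutes {1..n}}) = card (permutations_of_set (v ` {1..n}))"
    using card_permutations[of "{1..n}" n] card_image[OF inj] card_image[OF assms] by simp
  then have "?F ` {w. w permutes {1..n}} = permutations_of_set (v ` {1..n})"
    using sub by (intro card_subset_eq) auto
  then show ?thesis using inj by (simp add: bij_betw_def)
qed

definition restrict_poly :: "nat \<Rightarrow> ring_x \<Rightarrow> ring_x" where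
  "restrict_poly n p = (\<Sum>m | m \<in> Poly_Mapping.keys p \<and> Poly_Mapping.keys m \<subseteq> {1..n}.
    Poly_Mapping.single m (Poly_Mapping.lookup p m))"

lemma lookup_restrict_poly: "Poly_Mapping.lookup (restrict_poly n p) = restrict_vars n (Poly_Mapping.lookup p)"
  by (auto simp: restrict_poly_def restrict_vars_def lookup_sum lookup_single when_def in_keys_iff fun_eq_iff)

lemma eval_restrict_poly: "evaluate b v (restrict_poly n p) = evaluate b (\<lambda>i. if i \<in> {1..n} then v i else 0) p"
proof -
  let ?v = "\<lambda>i. if i \<in> {1..n} then v i else 0"
  have in_range: "eval_mon ?v m = eval_mon v m" if "Poly_Mapping.keys m \<subseteq> {1..n}" for m
    unfolding eval_mon_def using that by (intro prod.cong) auto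
  have out: "eval_mon ?v m = 0" if m: "\<not> Poly_Mapping.keys m \<subseteq> {1..n}" for m
  proof -
    obtain i where i: "i \<in> Poly_Mapping.keys m" "i \<notin> {1..n}" using m by blast
    have "?v i = 0" using i(2) by (rule if_not_P)
    then have "?v i ^ Poly_Mapping.lookup m i = 0" using i(1) by (simp only: in_keys_iff power_eq_0_iff neq0_conv)
    with i(1) have "\<exists>i\<in>Poly_Mapping.keys m. ?v i ^ Poly_Mapping.lookup m i = 0" by (rule bexI[rotated])
    then show ?thesis unfolding eval_mon_def by (rule prod_zero[OF finite_keys])
  qed
  have "evaluate b v (restrict_poly n p) = (\<Sum>m | m \<in> Poly_Mapping.keys p \<and> Poly_Mapping.keys m \<subseteq> {1..n}.
      eval_coeff b (Poly_Mapping.lookup p m) * eval_mon v m)"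
    by (simp add: restrict_poly_def eval_single)
  also have "\<dots> = (\<Sum>m | m \<in> Poly_Mapping.keys p \<and> Poly_Mapping.keys m \<subseteq> {1..n}.
      eval_coeff b (Poly_Mapping.lookup p m) * eval_mon ?v m)"
    by (rule sum.cong[OF refl]) (simp only: mem_Collect_eq in_range)
  also have "\<dots> = evaluate b ?v p"
    unfolding evaluate_def using out by (intro sum.mono_neutral_left) auto
  finally show ?thesis .
qed

lemma restrict_poly_restrict_poly:
  assumes "n \<le> n'"
  shows "restrict_poly n (restrict_poly n' p) = restrict_poly n p"
  using assms by (intro poly_mapping_eqI) (auto simp: lookup_restrict_poly restrict_vars_def)

lemma eval_polynomial_in_variable: "\<exists>q. \<forall>t. evaluate b (v(i := t)) f = poly q t"
proof (induction f rule: ring_x_induct)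
  case (const c)
  show ?case by (intro exI[of _ "[:eval_coeff b c:]"]) (simp add: eval_single eval_mon_def)
next
  case (X j)
  show ?case
  proof (cases "i = j")
    case True
    then show ?thesis by (intro exI[of _ "[:0, 1:]"]) simp
  next
    case False
    then show ?thesis by (intro exI[of _ "[:v j:]"]) simp
  qed
next
  case (add f g)
  then obtain q q' where "\<forall>t. evaluate b (v(i := t)) f = poly q t" "\<forall>t. evaluate b (v(i := t)) g = poly q' t" by blast
  then show ?case by (intro exI[of _ "q + q'"]) (simp only: eval_add poly_add simp_thms)
next
  case (mult f g)
  then obtain q q' where "\<forall>t. evaluate b (v(i := t)) f = poly q t" "\<forall>t. evaluate b (v(i := t)) g = poly q' t" by blast
  then show ?case by (intro exI[of _ "q * q'"]) (simp only: eval_mult poly_mult simp_thms)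
qed

text \<open>
  The polynomial \<open>p\<close> is the \<open>GP\<close> polynomial in \<open>x\<^sub>1, \<dots>, x\<^sub>n\<close> for the strict partition with parts \<open>ms\<close>.
\<close>

definition represents :: "nat list \<Rightarrow> nat \<Rightarrow> ring_x \<Rightarrow> bool" where
  "represents ms n p \<longleftrightarrow> restrict_poly n p = p \<and>
    (\<forall>b>0. \<forall>v. generic n v \<longrightarrow> evaluate b v p = gp_value b ms (v ` {1..n}))"

lemma representsD: "represents ms n p \<Longrightarrow> 0 < b \<Longrightarrow> generic n v \<Longrightarrow> evaluate b v p = gp_value b ms (v ` {1..n})"
  by (simp add: represents_def)

lemma generic_if_inj: "inj v \<Longrightarrow> (\<And>i. 0 < v i) \<Longrightarrow> generic n v"
  by (simp add: generic_def inj_on_subset[of v UNIV])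

lemma representsI:
  assumes "\<And>b v. 0 < b \<Longrightarrow> generic n v \<Longrightarrow> evaluate b v p = gp_value b ms (v ` {1..n})"
  shows "represents ms n p"
proof -
  have "restrict_poly n p = p"
  proof (rule eval_eqI)
    fix b :: real and v :: "nat \<Rightarrow> real" assume b: "0 < b" and "inj v" "\<And>i. 0 < v i"
    then have v: "generic n v" by (intro generic_if_inj)
    let ?v = "\<lambda>i. if i \<in> {1..n} then v i else 0"
    have "inj_on ?v {1..n} \<longleftrightarrow> inj_on v {1..n}" by (rule inj_on_cong) simp
    then have "generic n ?v" using v by (simp add: generic_def)
    moreover have "?v ` {1..n} = v ` {1..n}" by (intro image_cong) auto
    ultimately show "evaluate b v (restrict_poly n p) = evaluate b v p"
      using assms[OF b v] assms[OF b, of ?v] by (simp add: eval_restrict_poly)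
  qed
  then show ?thesis using assms by (simp add: represents_def)
qed

lemma represents_unique:
  assumes "represents ms n p" "represents ms n q"
  shows "p = q"
proof (rule eval_eqI)
  fix b :: real and v :: "nat \<Rightarrow> real" assume "0 < b" "inj v" "\<And>i. 0 < v i"
  then show "evaluate b v p = evaluate b v q"
    using representsD[OF assms(1)] representsD[OF assms(2)] generic_if_inj by simp
qed

text \<open>
  Setting the last variable to 0 leads to a point that is not generic. Both sides are
  polynomials in that variable, so the equality extends from the positive values to 0.
\<close>

lemma represents_restrict_poly:
  assumes p: "represents ms (Suc n) p" and ms: "sorted_wrt (>) ms" "0 \<notin> set ms"
  shows "represents ms n (restrict_poly n p)"
proof (rule representsI)
  fix b :: real and v assume b: "0 < b" and v: "generic n v"
  let ?v = "\<lambda>i. if i \<in> {1..n} then v i else 0" and ?A = "v ` {1..n}"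
  obtain q where q: "\<And>t. evaluate b (?v(Suc n := t)) p = poly q t"
    using eval_polynomial_in_variable by blast
  obtain g where g: "\<And>t. t \<notin> ?A \<Longrightarrow> gp_value b ms (insert t ?A) = poly g t"
    using gp_value_polynomial[of ?A ms b] ms by auto
  have "poly q t = poly g t" if t: "t \<in> {0<..} - ?A" for t
  proof -
    have "{1..Suc n} = insert (Suc n) {1..n}" by auto
    moreover have "(?v(Suc n := t)) ` {1..n} = ?A" by (intro image_cong) auto
    ultimately have im: "(?v(Suc n := t)) ` {1..Suc n} = insert t ?A"
      by (simp only: image_insert fun_upd_same)
    have "inj_on (?v(Suc n := t)) {1..n} \<longleftrightarrow> inj_on v {1..n}" by (rule inj_on_cong) auto
    moreover have "(?v(Suc n := t)) ` {1..n} = ?A" by (intro image_cong) auto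
    moreover have "{1..Suc n} = insert (Suc n) {1..n}" by auto
    ultimately have "inj_on (?v(Suc n := t)) {1..Suc n}"
      using v t by (simp add: generic_def)
    moreover have "0 < (?v(Suc n := t)) i" if "i \<in> {1..Suc n}" for i
      using v t that by (auto simp: generic_def)
    ultimately have "generic (Suc n) (?v(Suc n := t))"
      unfolding generic_def by blast
    then have "evaluate b (?v(Suc n := t)) p = gp_value b ms (insert t ?A)"
      using representsD[OF p b] by (simp only: im)
    then show ?thesis using q g t by simp
  qed
  then have "{0<..} - ?A \<subseteq> {t. poly (q - g) t = 0}" by auto
  moreover have "infinite ({0<..} - ?A)"
    by (intro Diff_infinite_finite) (simp_all add: infinite_Ioi)
  ultimately have "q - g = 0"
    using poly_roots_finite[of "q - g"] finite_subset by blast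
  moreover have "0 \<notin> ?A" using v by (force simp: generic_def)
  ultimately have "poly q 0 = gp_value b ms (insert 0 ?A)" using g by simp
  also have "\<dots> = gp_value b ms ?A"
    using gp_value_drop_zero[of "insert 0 ?A" ms b] ms(2) \<open>0 \<notin> ?A\<close> by simp
  also have "poly q 0 = evaluate b v (restrict_poly n p)"
  proof -
    have "?v(Suc n := 0) = ?v" by (auto simp: fun_eq_iff)
    then show ?thesis using q[of 0] by (simp add: eval_restrict_poly)
  qed
  finally show "evaluate b v (restrict_poly n p) = gp_value b ms ?A" .
qed

text \<open>
  A permutation \<open>w\<close> contributes the term for the ordering \<open>x\<^sub>w\<^sub>(\<^sub>1\<^sub>), \<dots>, x\<^sub>w\<^sub>(\<^sub>n\<^sub>)\<close> of the variables.
\<close>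

lemma represents_GP_rational:
  assumes p: "represents (map \<mu> [1..<Suc r]) n p" and "r \<le> n"
    and \<mu>: "\<And>i. \<mu> i \<noteq> 0 \<longleftrightarrow> 1 \<le> i \<and> i \<le> r"
  shows "to_frac p = GP_rational \<mu> n"
proof -
  have support: "{i. \<mu> i \<noteq> 0} = {1..r}" by (rule set_eqI) (simp only: mem_Collect_eq \<mu> atLeastAtMost_iff)
  then have r: "num_parts \<mu> = r" by (simp add: num_parts_def)
  let ?W = "{w. w permutes {1..n}}" and ?k = "fact (n - r) :: nat"
  define N where "N = monomial \<mu> * (\<Prod>i\<in>{1..r}. \<Prod>j\<in>{Suc i..n}. oplus beta (X i) (X j) * (1 + beta * X j))"
  define D where "D = (\<Prod>i\<in>{1..r}. \<Prod>j\<in>{Suc i..n}. X i - X j)"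
  have "X i - X j \<noteq> 0" if "j \<in> {Suc i..n}" for i j
    using that by (intro X_diff_nonzero) auto
  then have "D \<noteq> 0" unfolding D_def by (simp only: prod_zero_iff finite_atLeastAtMost) blast
  have evD: "evaluate b u D \<noteq> 0" if "inj_on u {1..n}" for b u
  proof -
    have "u i - u j \<noteq> 0" if "i \<in> {1..r}" "j \<in> {Suc i..n}" for i j
      using that assms(2) inj_onD[OF \<open>inj_on u {1..n}\<close>, of i j] by auto
    then show ?thesis
      unfolding D_def by (simp only: eval_prod eval_diff eval_X prod_zero_iff finite_atLeastAtMost) blast
  qed
  have "evaluate b u N / evaluate b u D = gp_term b (map \<mu> [1..<Suc r]) (map u [1..<Suc n])" if u: "inj_on u {1..n}" for b u
  proof -
    have "evaluate b u N = (\<Prod>i\<in>{1..r}. u i ^ \<mu> i) *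
        (\<Prod>i\<in>{1..r}. \<Prod>j\<in>{Suc i..n}. oplus b (u i) (u j) * (1 + b * u j))"
      unfolding N_def monomial_def support by simp
    moreover have "evaluate b u D = (\<Prod>i\<in>{1..r}. \<Prod>j\<in>{Suc i..n}. u i - u j)"
      unfolding D_def by simp
    moreover have "gp_term b (map \<mu> [1..<Suc r]) (map u [1..<Suc n]) =
        (\<Prod>i\<in>{1..r}. u i ^ \<mu> i) * (\<Prod>i\<in>{1..r}. \<Prod>j\<in>{Suc i..n}. gp_ratio b (u i) (u j))"
      using gp_term_segment[OF _ assms(2) u, of 1 b \<mu>] by (simp add: prod.distrib)
    ultimately show ?thesis by (simp add: gp_ratio_def prod_dividef)
  qed
  note term_eq = this
  have fin: "finite ?W" by (simp add: finite_permutations)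
  have bij: "bij w" if "w \<in> ?W" for w using that by (auto intro: permutes_bij)
  have "to_frac (of_nat ?k * p) = (\<Sum>w\<in>?W. to_frac (perm_poly w N) / to_frac (perm_poly w D))"
  proof (rule to_frac_eq_sum_fractions[OF fin])
    show "perm_poly w D \<noteq> 0" if "w \<in> ?W" for w
      using perm_poly_eq_0_iff[OF bij[OF that]] \<open>D \<noteq> 0\<close> by simp
  next
    fix b :: real and v :: "nat \<Rightarrow> real" assume b: "0 < b" and v: "inj v" "\<And>i. 0 < v i"
    have g: "generic n v" using v by (rule generic_if_inj)
    have inj: "inj_on (v \<circ> w) {1..n}" if "w \<in> ?W" for w
    proof (rule comp_inj_on)
      show "inj_on w {1..n}" using bij[OF that] by (meson bij_is_inj inj_on_subset subset_UNIV)
      show "inj_on v (w ` {1..n})" using v(1) by (meson inj_on_subset subset_UNIV)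
    qed
    have injv: "inj_on v {1..n}" using g by (simp add: generic_def)
    have "(\<Sum>w\<in>?W. evaluate b v (perm_poly w N) / evaluate b v (perm_poly w D)) =
        (\<Sum>w\<in>?W. gp_term b (map \<mu> [1..<Suc r]) (map (v \<circ> w) [1..<Suc n]))"
      by (intro sum.cong refl) (simp only: eval_perm_poly[OF bij] term_eq[OF inj])
    also have "\<dots> = (\<Sum>xs\<in>permutations_of_set (v ` {1..n}). gp_term b (map \<mu> [1..<Suc r]) xs)"
      using bij_betw_permutation_lists[OF injv] by (rule sum.reindex_bij_betw)
    also have "\<dots> = of_nat ?k * gp_value b (map \<mu> [1..<Suc r]) (v ` {1..n})"
    proof -
      have card: "card (v ` {1..n}) = n" using card_image[OF injv] by simp
      have len: "length (map \<mu> [1..<Suc r]) = r" by simp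
      have "finite (v ` {1..n})" by simp
      then show ?thesis
        using sum_gp_term[of "v ` {1..n}" "map \<mu> [1..<Suc r]" b] assms(2) by (simp only: card len of_nat_fact)
    qed
    also have "\<dots> = evaluate b v (of_nat ?k * p)"
      by (simp only: eval_mult eval_of_nat representsD[OF p b g])
    finally have "evaluate b v (of_nat ?k * p) = (\<Sum>w\<in>?W. evaluate b v (perm_poly w N) / evaluate b v (perm_poly w D))"
      by (rule sym)
    moreover have "\<forall>w\<in>?W. evaluate b v (perm_poly w D) \<noteq> 0"
      using evD[OF inj] by (simp add: eval_perm_poly[OF bij])
    ultimately show "(\<forall>w\<in>?W. evaluate b v (perm_poly w D) \<noteq> 0) \<and>
      evaluate b v (of_nat ?k * p) = (\<Sum>w\<in>?W. evaluate b v (perm_poly w N) / evaluate b v (perm_poly w D))" by blast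
  qed
  also have "\<dots> = (\<Sum>w\<in>?W. perm_fract w (to_frac N / to_frac D))"
    using perm_fract_divide[OF bij \<open>D \<noteq> 0\<close>] by simp
  also have "to_frac N / to_frac D = to_frac (monomial \<mu>) * (\<Prod>i\<in>{1..r}. \<Prod>j\<in>{i+1..n}.
      oplus (to_frac beta) (to_frac (X i)) (to_frac (X j)) /
      ominus (to_frac beta) (to_frac (X i)) (to_frac (X j)))"
    by (simp add: N_def D_def to_frac_oplus ominus_def prod_dividef)
  finally have "of_nat ?k * to_frac p = (\<Sum>w\<in>?W. perm_fract w (to_frac (monomial \<mu>) *
      (\<Prod>i\<in>{1..r}. \<Prod>j\<in>{i+1..n}.
      oplus (to_frac beta) (to_frac (X i)) (to_frac (X j)) /
      ominus (to_frac beta) (to_frac (X i)) (to_frac (X j)))))"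
    by (simp only: to_frac_simps)
  then have "GP_rational \<mu> n = 1 / of_nat ?k * (of_nat ?k * to_frac p)"
    unfolding GP_rational_def r by simp
  moreover have "of_nat ?k \<noteq> (0 :: ring_x fract)"
  proof -
    have "of_nat ?k \<noteq> (0 :: ring_x)" by (simp only: of_nat_eq_0_iff) simp
    then show ?thesis by (metis to_frac_eq_0_iff to_frac_simps(6))
  qed
  ultimately show ?thesis by simp
qed

text \<open>
  Polynomials for all large numbers of variables give, by restriction, a compatible family for all
  numbers of variables. Its coefficients form the unique power series in the definition of \<open>GP\<close>: the
  coefficient of a monomial can be read off from any member of the family with enough variables.
\<close>

lemma restrict_GP:
  assumes ms: "sorted_wrt (>) (map \<mu> [1..<Suc r])" "0 \<notin> set (map \<mu> [1..<Suc r])"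
    and \<mu>: "\<And>i. \<mu> i \<noteq> 0 \<longleftrightarrow> 1 \<le> i \<and> i \<le> r"
    and ex: "\<And>n. n0 \<le> n \<Longrightarrow> represents (map \<mu> [1..<Suc r]) n (P n)"
    and "r \<le> n0"
  shows "restrict_vars n0 (GP \<mu>) = Poly_Mapping.lookup (P n0)"
proof -
  let ?ms = "map \<mu> [1..<Suc r]"
  have "\<exists>p. represents ?ms n p" for n
  proof (cases "n0 \<le> n")
    case True
    then show ?thesis using ex by blast
  next
    case False
    then have "n \<le> n0" by simp
    then show ?thesis
      by (induction n rule: inc_induct) (use ex represents_restrict_poly[OF _ ms] in blast)+
  qed
  then obtain Q where Q: "\<And>n. represents ?ms n (Q n)" by metis
  have Q_restrict: "Q n = restrict_poly n (Q n')" if "n \<le> n'" for n n'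
    using that
  proof (induction n' rule: dec_induct)
    case base
    then show ?case using Q[of n] by (simp add: represents_def)
  next
    case (step k)
    have "Q k = restrict_poly k (Q (Suc k))"
      using represents_unique[OF Q represents_restrict_poly[OF Q ms]] .
    then show ?case using step restrict_poly_restrict_poly[of n k] by simp
  qed
  have "{i. \<mu> i \<noteq> 0} = {1..r}" by (rule set_eqI) (simp only: mem_Collect_eq \<mu> atLeastAtMost_iff)
  then have r: "num_parts \<mu> = r" by (simp add: num_parts_def)
  define top where "top = (\<lambda>m :: nat \<Rightarrow>\<^sub>0 nat. Max (insert 0 (Poly_Mapping.keys m)))"
  have top: "Poly_Mapping.keys m \<subseteq> {1..top m}" if "0 \<notin> Poly_Mapping.keys m" for m
  proof
    fix i assume i: "i \<in> Poly_Mapping.keys m"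
    then have "i \<le> top m" unfolding top_def by (intro Max_ge) auto
    moreover have "i \<noteq> 0" using i that by (cases i) auto
    ultimately show "i \<in> {1..top m}" by simp
  qed
  define f :: series_x where
    "f = (\<lambda>m. if 0 \<in> Poly_Mapping.keys m then 0 else Poly_Mapping.lookup (Q (top m)) m)"
  have f: "restrict_vars n f = Poly_Mapping.lookup (Q n)" for n
  proof
    fix m
    show "restrict_vars n f m = Poly_Mapping.lookup (Q n) m"
    proof (cases "Poly_Mapping.keys m \<subseteq> {1..n}")
      case True
      then have "0 \<notin> Poly_Mapping.keys m" by auto
      moreover have "top m \<le> n" using True unfolding top_def by auto
      ultimately show ?thesis
        using Q_restrict[of "top m" n] top[of m] True
        by (simp add: restrict_vars_def f_def lookup_restrict_poly)
    next
      case False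
      have "Poly_Mapping.lookup (restrict_poly n (Q n)) m = 0"
        using False by (simp add: lookup_restrict_poly restrict_vars_def)
      then show ?thesis using False Q_restrict[of n n] by (simp add: restrict_vars_def)
    qed
  qed
  have "GP \<mu> = f"
    unfolding GP_def r
  proof (rule the_equality)
    show "(\<forall>m. 0 \<in> Poly_Mapping.keys m \<longrightarrow> f m = 0) \<and>
      (\<forall>n\<ge>r. \<exists>p. restrict_vars n f = Poly_Mapping.lookup p \<and> to_frac p = GP_rational \<mu> n)"
      using f represents_GP_rational[OF Q _ \<mu>] by (auto simp: f_def)
  next
    fix g assume g: "(\<forall>m. 0 \<in> Poly_Mapping.keys m \<longrightarrow> g m = 0) \<and>
      (\<forall>n\<ge>r. \<exists>p. restrict_vars n g = Poly_Mapping.lookup p \<and> to_frac p = GP_rational \<mu> n)"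
    have gQ: "restrict_vars n g = Poly_Mapping.lookup (Q n)" if n: "r \<le> n" for n
    proof -
      obtain p where "restrict_vars n g = Poly_Mapping.lookup p" "to_frac p = GP_rational \<mu> n"
        using g n by blast
      then show ?thesis using represents_GP_rational[OF Q n \<mu>] by (metis to_frac_eq_iff)
    qed
    show "g = f"
    proof
      fix m
      show "g m = f m"
      proof (cases "0 \<in> Poly_Mapping.keys m")
        case True
        then show ?thesis using g by (simp add: f_def)
      next
        case False
        let ?n = "max r (top m)"
        have "Poly_Mapping.keys m \<subseteq> {1..?n}" using top[OF False] by force
        moreover have "restrict_vars ?n g m = restrict_vars ?n f m" using gQ[of ?n] f by simp
        ultimately show ?thesis by (simp add: restrict_vars_def)
      qed
    qed
  qed
  then show ?thesis
    using f[of n0] represents_unique[OF Q ex] by simp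
qed

section \<open>From skew-symmetric partitions to shifted parts\<close>

text \<open>
  At the first place of disagreement, each partition would have to contain the entry of the other one
  at the same or a later place.
\<close>

lemma strict_partition_unique:
  assumes "strict_partition \<mu>" "strict_partition \<nu>" "{\<mu> i | i. \<mu> i \<noteq> 0} = {\<nu> i | i. \<nu> i \<noteq> 0}"
  shows "\<mu> = \<nu>"
proof -
  have le: "\<mu> i \<le> \<nu> i" if \<mu>: "strict_partition \<mu>" and \<nu>: "strict_partition \<nu>"
    and sub: "{\<mu> i | i. \<mu> i \<noteq> 0} \<subseteq> {\<nu> i | i. \<nu> i \<noteq> 0}" and less: "\<And>j. j < i \<Longrightarrow> \<mu> j = \<nu> j"
    for \<mu> \<nu> and i :: nat
  proof (cases "\<mu> i = 0")
    case False
    then obtain k where k: "\<mu> i = \<nu> k" "\<nu> k \<noteq> 0" using sub by fastforce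
    have "\<not> k < i"
    proof
      assume "k < i"
      then have "\<mu> k = \<mu> i" using less k by simp
      then have "k = i" using \<mu> False by (auto simp: strict_partition_def dest: inj_onD)
      then show False using \<open>k < i\<close> by simp
    qed
    moreover have "1 \<le> i"
      using \<mu> False by (cases "i = 0") (auto simp: strict_partition_def is_partition_def weak_composition_def)
    ultimately show ?thesis using k \<nu> by (simp add: strict_partition_def is_partition_def)
  qed simp
  have "\<mu> i = \<nu> i" for i
  proof (induction i rule: less_induct)
    case (less i)
    show ?case using le[of \<mu> \<nu> i] le[of \<nu> \<mu> i] assms less by (intro antisym) auto
  qed
  then show ?thesis by blast
qed

lemma half_less_eq:
  assumes "is_partition l"
  shows "half_less l = (\<lambda>i. if i = 0 then 0 else l i - i)"
proof -
  let ?\<nu> = "\<lambda>i. if i = 0 then 0 else l i - i"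
  have wc: "finite {i. l i \<noteq> 0}" and anti: "\<And>i j. 1 \<le> i \<Longrightarrow> i \<le> j \<Longrightarrow> l j \<le> l i"
    using assms by (auto simp: is_partition_def weak_composition_def)
  have "finite {i. ?\<nu> i \<noteq> 0}" by (rule finite_subset[OF _ wc]) (auto split: if_splits)
  moreover have dec: "?\<nu> j < ?\<nu> i" if "1 \<le> i" "i < j" "?\<nu> i \<noteq> 0" for i j
    using anti[of i j] that by auto
  have "?\<nu> j \<le> ?\<nu> i" if "1 \<le> i" "i \<le> j" for i j
    using anti[of i j] that by auto
  moreover have "inj_on ?\<nu> {i. ?\<nu> i \<noteq> 0}"
  proof (rule inj_onI)
    fix i j assume ij: "i \<in> {i. ?\<nu> i \<noteq> 0}" "j \<in> {i. ?\<nu> i \<noteq> 0}" "?\<nu> i = ?\<nu> j"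
    then have "1 \<le> i" "1 \<le> j" by (auto split: if_splits)
    then show "i = j" using dec[of i j] dec[of j i] ij by (cases i j rule: linorder_cases) auto
  qed
  ultimately have strict: "strict_partition ?\<nu>"
    by (simp add: strict_partition_def is_partition_def weak_composition_def)
  have set: "{?\<nu> i | i. ?\<nu> i \<noteq> 0} = {l i - i | i. 1 \<le> i} \<inter> {1..}"
  proof (intro set_eqI iffI)
    fix x assume "x \<in> {?\<nu> i | i. ?\<nu> i \<noteq> 0}"
    then obtain i where "x = ?\<nu> i" "?\<nu> i \<noteq> 0" by blast
    then have "x = l i - i" "1 \<le> i" "1 \<le> x" by (auto split: if_splits)
    then show "x \<in> {l i - i | i. 1 \<le> i} \<inter> {1..}" by auto
  next
    fix x assume "x \<in> {l i - i | i. 1 \<le> i} \<inter> {1..}"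
    then obtain i where "x = l i - i" "1 \<le> i" "1 \<le> x" by auto
    then have "x = ?\<nu> i" "?\<nu> i \<noteq> 0" by auto
    then show "x \<in> {?\<nu> i | i. ?\<nu> i \<noteq> 0}" by blast
  qed
  show ?thesis
    unfolding half_less_def
  proof (rule the_equality)
    show "strict_partition ?\<nu> \<and> {?\<nu> i | i. ?\<nu> i \<noteq> 0} = {l i - i | i. 1 \<le> i} \<inter> {1..}"
      using strict set by blast
  qed (use strict_partition_unique[OF _ strict] set in auto)
qed

lemma symmetric_partition_cells:
  assumes "symmetric_partition l" "1 \<le> i" "1 \<le> j"
  shows "j \<le> l i \<longleftrightarrow> i \<le> l j"
proof -
  have l: "is_partition l" "transpose_partition l = l" using assms(1) by (auto simp: symmetric_partition_def)
  have "l 0 = 0" using l(1) by (simp add: is_partition_def weak_composition_def)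
  then have "{k. j \<le> l k} = {k. 1 \<le> k \<and> j \<le> l k}" using assms(3) by (auto simp: Suc_le_eq intro: gr0I)
  then have "card {k. j \<le> l k} = transpose_partition l j" using assms(3) by (simp add: transpose_partition_def)
  then show ?thesis using partition_le_iff[OF l(1) assms(3,2)] l(2) by simp
qed

lemma diagonal_length:
  assumes "is_partition l"
  shows "\<exists>r. \<forall>k\<ge>1. k < l k \<longleftrightarrow> k \<le> r"
proof -
  let ?S = "{k. 1 \<le> k \<and> k < l k}"
  have "finite {k. l k \<noteq> 0}" using assms by (simp add: is_partition_def weak_composition_def)
  then have fin: "finite ?S" by (rule rev_finite_subset) auto
  have down: "j \<in> ?S" if "k \<in> ?S" "1 \<le> j" "j \<le> k" for j k
  proof -
    have "l k \<le> l j" using assms that by (simp add: is_partition_def)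
    then show ?thesis using that by auto
  qed
  show ?thesis
  proof (cases "?S = {}")
    case True
    then show ?thesis by (intro exI[of _ 0]) auto
  next
    case False
    have "k < l k \<longleftrightarrow> k \<le> Max ?S" if "1 \<le> k" for k
    proof
      assume "k < l k"
      then show "k \<le> Max ?S" using fin that by (intro Max_ge) auto
    next
      assume "k \<le> Max ?S"
      then show "k < l k" using down[OF Max_in[OF fin False] that] by simp
    qed
    then show ?thesis by blast
  qed
qed

theorem corollary3p25:
  fixes n :: nat and l \<mu> :: "nat \<Rightarrow> nat"
  assumes "l \<in> compositions_upto n"
    and "skew_symmetric_partition l"
    and "\<mu> = half_less l"
  shows "restrict_vars n (GP \<mu>) = Poly_Mapping.lookup (LP (reverse_comp n l))"
proof -
  have sym: "symmetric_partition l" using assms(2) by (simp add: skew_symmetric_partition_def)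
  then have part: "is_partition l" by (simp add: symmetric_partition_def)
  obtain r where r: "\<And>k. 1 \<le> k \<Longrightarrow> k < l k \<longleftrightarrow> k \<le> r" using diagonal_length[OF part] by blast
  have support: "l i = 0" if "n < i" for i using assms(1) that by (simp add: compositions_upto_def)
  have shape: "symmetric_shape l N r" if "n \<le> N" for N
    by unfold_locales (use part symmetric_partition_cells[OF sym] support r that in auto)
  have \<mu>: "\<mu> = (\<lambda>i. if i = 0 then 0 else l i - i)"
    unfolding assms(3) by (rule half_less_eq[OF part])
  have parts: "map \<mu> [1..<Suc r] = symmetric_shape.parts l r 1"
    unfolding symmetric_shape.parts_def[OF shape[OF order_refl]] \<mu> by (intro map_cong) auto
  show ?thesis
  proof (rule restrict_GP[where P = "\<lambda>N. LP (reverse_comp N l)" and r = r])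
    show "sorted_wrt (>) (map \<mu> [1..<Suc r])" "0 \<notin> set (map \<mu> [1..<Suc r])"
      unfolding parts using symmetric_shape.parts_strict[OF shape[OF order_refl], of 1] by simp_all
    show "\<mu> i \<noteq> 0 \<longleftrightarrow> 1 \<le> i \<and> i \<le> r" for i
      using r[of i] by (cases "i = 0") (auto simp: \<mu>)
    \<comment> \<open>The partition also has at most \<open>N\<close> parts, so the construction gives the polynomials for all \<open>N \<ge> n\<close>.\<close>
    show "represents (map \<mu> [1..<Suc r]) N (LP (reverse_comp N l))" if "n \<le> N" for N
      unfolding parts using symmetric_shape.eval_LP_reverse[OF shape[OF that]] by (rule representsI)
    show "r \<le> n"
      using r[of r] support[of r] by (cases "r = 0"; cases "n < r") auto
  qed
qed

end
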